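(* Assume $\mathcal N$ is saturable and let $b_*$ be a bounded heteroclinic traveling-wave profile of speed $c\neq\pm1$. For every $B_0\in H^1(\mathbb R;\mathbb R^2)$, the perturbation equation $B_t=\Sigma B_x+N_*(x;B)$, $B(\cdot,0)=B_0$, has a unique global mild solution $$B\in C^0\big([0,\infty);H^1(\mathbb R)\big)\cap C^1\big([0,\infty);L^2(\mathbb R)\big),$$ and it satisfies $\|B(\cdot,t)\|_{H^1}\le Ce^{Ct}\|B_0\|_{H^1}$ for all $t\ge0$. Here $C$ depends on $\mathcal N$ and $b_*$ but not on $B_0$.
   Context: Nonlinearity: $\mathcal N:[0,\infty)\to\mathbb R$ is smooth, $\mathcal N'(s)<0$ for $s>0$, $\mathcal N(0)=1$, $\mathcal N(1)=0$. It is saturable: $\lim_{s\to\infty}\mathcal N(s)=\mathcal N_\infty\in(-\infty,0)$, and $\mathcal N(s)-\mathcal N_\infty$ and all derivatives $\mathcal N^{(k)}(s)$ decay to zero sufficiently rapidly as $s\to\infty$ (e.g. $|\mathcal N(r^2)-\mathcal N_\infty|=O(r^{-\alpha})$, $|\mathcal N^{(k)}(r^2)|=O(r^{-\alpha-k})$). $b_*=(u_*,v_* )$ is a time-independent solution of $u_t=cu_x+v_x+\mathcal N(u^2+v^2)v$, $v_t=u_x+cv_x-\mathcal N(u^2+v^2)u$. It is bounded with bounded derivatives and converges exponentially to spatially uniform equilibria as $x\to\pm\infty$. Notation: $r_*^2=u_*^2+v_*^2$, $\Sigma=\begin{bmatrix}c&1\\1&c\end{bmatrix}$, $\delta\mathcal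 N_*(x;U,V)=\mathcal N((u_*+U)^2+(v_*+V)^2)-\mathcal N(r_*^2)$, and $N_*(x;B)=\big(\mathcal N(r_*^2)V+\delta\mathcal N_*v_*,\ -\mathcal N(r_*^2)U-\delta\mathcal N_*u_*\big)$ for $B=(U,V)$. A mild solution is a solution of $B(t)=T_c(t)B_0+\int_0^tT_c(t-t')N_*(B(t'))\,dt'$, where $T_c(t)=\exp(t\Sigma\partial_x)$ is the unitary group on $H^s$ with Fourier symbol $e^{i\Sigma kt}$. *)

theory Defs
  imports "HOL-Analysis.Analysis"
begin

definition L2 :: "(real \<Rightarrow> real \<times> real) set" where
  "L2 = {f. f \<in> borel_measurable lborel \<and> integrable lborel (\<lambda>x. (norm (f x))\<^sup>2)}"

definition l2norm :: "(real \<Rightarrow> real \<times> real) \<Rightarrow> real" where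
  "l2norm f = sqrt (\<integral>x. (norm (f x))\<^sup>2 \<partial>lborel)"

definition l2inner :: "(real \<Rightarrow> real \<times> real) \<Rightarrow> (real \<Rightarrow> real \<times> real) \<Rightarrow> real" where
  "l2inner f g = (\<integral>x. inner (f x) (g x) \<partial>lborel)"

definition test_fun :: "(real \<Rightarrow> real) \<Rightarrow> bool" where
  "test_fun \<phi> \<longleftrightarrow>
     (\<exists>D :: nat \<Rightarrow> real \<Rightarrow> real. D 0 = \<phi> \<and>
        (\<forall>k x. (D k has_real_derivative D (Suc k) x) (at x))) \<and>
     (\<exists>R. \<forall>x. \<bar>x\<bar> > R \<longrightarrow> \<phi> x = 0)"

definition weak_deriv :: "(real \<Rightarrow> real \<times> real) \<Rightarrow> (real \<Rightarrow> real \<times> real) \<Rightarrow> bool" where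
  "weak_deriv f g \<longleftrightarrow>
     (\<forall>\<phi>. test_fun \<phi> \<longrightarrow>
        (\<integral>x. deriv \<phi> x *\<^sub>R f x \<partial>lborel) = - (\<integral>x. \<phi> x *\<^sub>R g x \<partial>lborel))"

definition H1 :: "(real \<Rightarrow> real \<times> real) set" where
  "H1 = {f. f \<in> L2 \<and> (\<exists>g. g \<in> L2 \<and> weak_deriv f g)}"

definition h1norm :: "(real \<Rightarrow> real \<times> real) \<Rightarrow> real" where
  "h1norm f = sqrt ((l2norm f)\<^sup>2 + (l2norm (SOME g. g \<in> L2 \<and> weak_deriv f g))\<^sup>2)"

definition smooth_nonneg :: "(real \<Rightarrow> real) \<Rightarrow> (nat \<Rightarrow> real \<Rightarrow> real) \<Rightarrow> bool" where
  "smooth_nonneg N D \<longleftrightarrow> D 0 = N \<and>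
     (\<forall>k. \<forall>s\<ge>0. (D k has_real_derivative D (Suc k) s) (at s within {0..}))"

definition nonlinearity :: "(real \<Rightarrow> real) \<Rightarrow> bool" where
  "nonlinearity N \<longleftrightarrow> (\<exists>D. smooth_nonneg N D \<and> (\<forall>s>0. D 1 s < 0)) \<and> N 0 = 1 \<and> N 1 = 0"

definition saturable :: "(real \<Rightarrow> real) \<Rightarrow> bool" where
  "saturable N \<longleftrightarrow>
     (\<exists>D Ninf \<alpha>. smooth_nonneg N D \<and> Ninf < 0 \<and> (N \<longlongrightarrow> Ninf) at_top \<and> \<alpha> > 0 \<and>
        (\<forall>k. \<exists>M. \<forall>r\<ge>1.
           \<bar>D k (r\<^sup>2) - (if k = 0 then Ninf else 0)\<bar> \<le> M * r powr (- (\<alpha> + real k))))"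

definition equilibrium :: "(real \<Rightarrow> real) \<Rightarrow> real \<Rightarrow> real \<Rightarrow> bool" where
  "equilibrium N p q \<longleftrightarrow> N (p\<^sup>2 + q\<^sup>2) * q = 0 \<and> N (p\<^sup>2 + q\<^sup>2) * p = 0"

definition heteroclinic_profile :: "(real \<Rightarrow> real) \<Rightarrow> real \<Rightarrow> (real \<Rightarrow> real) \<Rightarrow> (real \<Rightarrow> real) \<Rightarrow> bool" where
  "heteroclinic_profile N c u v \<longleftrightarrow>
     (\<exists>u' v'.
        (\<forall>x. (u has_real_derivative u' x) (at x) \<and> (v has_real_derivative v' x) (at x)) \<and>
        (\<forall>x. c * u' x + v' x + N ((u x)\<^sup>2 + (v x)\<^sup>2) * v x = 0 \<and>
             u' x + c * v' x - N ((u x)\<^sup>2 + (v x)\<^sup>2) * u x = 0) \<and>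
        bounded (range u) \<and> bounded (range v) \<and> bounded (range u') \<and> bounded (range v')) \<and>
     (\<exists>up vp um vm K \<mu>. \<mu> > 0 \<and> equilibrium N up vp \<and> equilibrium N um vm \<and>
        (up, vp) \<noteq> (um, vm) \<and>
        (\<forall>x\<ge>0. norm ((u x, v x) - (up, vp)) \<le> K * exp (- \<mu> * x)) \<and>
        (\<forall>x\<le>0. norm ((u x, v x) - (um, vm)) \<le> K * exp (\<mu> * x)))"

definition Nstar :: "(real \<Rightarrow> real) \<Rightarrow> (real \<Rightarrow> real) \<Rightarrow> (real \<Rightarrow> real) \<Rightarrow> real \<Rightarrow> real \<times> real \<Rightarrow> real \<times> real" where
  "Nstar N u v x B =
     (let U = fst B; V = snd B; r2 = (u x)\<^sup>2 + (v x)\<^sup>2;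
          dN = N ((u x + U)\<^sup>2 + (v x + V)\<^sup>2) - N r2
      in (N r2 * V + dN * v x, - N r2 * U - dN * u x))"

text \<open>T_c(t) = exp(t \<Sigma> \<partial>_x), written explicitly via the characteristic components
  p = U + V (speed c+1) and q = U - V (speed c-1).\<close>
definition Tc :: "real \<Rightarrow> real \<Rightarrow> (real \<Rightarrow> real \<times> real) \<Rightarrow> real \<Rightarrow> real \<times> real" where
  "Tc c t f x =
     (let p = fst (f (x + (c + 1) * t)) + snd (f (x + (c + 1) * t));
          q = fst (f (x + (c - 1) * t)) - snd (f (x + (c - 1) * t))
      in ((p + q) / 2, (p - q) / 2))"

text \<open>Mild solution, the Duhamel integral taken weakly in L2 (pairing with every L2 function).\<close>
definition mild_solution :: "(real \<Rightarrow> real) \<Rightarrow> real \<Rightarrow> (real \<Rightarrow> real) \<Rightarrow> (real \<Rightarrow> real)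
    \<Rightarrow> (real \<Rightarrow> real \<times> real) \<Rightarrow> (real \<Rightarrow> real \<Rightarrow> real \<times> real) \<Rightarrow> bool" where
  "mild_solution N c u v B0 B \<longleftrightarrow>
     (\<forall>t\<ge>0. \<forall>\<phi>\<in>L2.
        set_integrable lborel {0..t} (\<lambda>s. l2inner (Tc c (t - s) (\<lambda>y. Nstar N u v y (B s y))) \<phi>) \<and>
        l2inner (B t) \<phi> = l2inner (Tc c t B0) \<phi> +
          (LINT s:{0..t}|lborel. l2inner (Tc c (t - s) (\<lambda>y. Nstar N u v y (B s y))) \<phi>))"

definition sol_class :: "(real \<Rightarrow> real \<Rightarrow> real \<times> real) \<Rightarrow> bool" where
  "sol_class B \<longleftrightarrow>
     (\<forall>t\<ge>0. B t \<in> H1) \<and>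
     (\<forall>t\<ge>0. ((\<lambda>s. h1norm (\<lambda>x. B s x - B t x)) \<longlongrightarrow> 0) (at t within {0..})) \<and>
     (\<exists>B'. (\<forall>t\<ge>0. B' t \<in> L2) \<and>
        (\<forall>t\<ge>0. ((\<lambda>s. l2norm (\<lambda>x. B' s x - B' t x)) \<longlongrightarrow> 0) (at t within {0..})) \<and>
        (\<forall>t\<ge>0. ((\<lambda>h. l2norm (\<lambda>x. (1 / h) *\<^sub>R (B (t + h) x - B t x) - B' t x)) \<longlongrightarrow> 0)
                  (at 0 within {-t..})))"

end

(* In the characteristic components U + V and U - V the group Tc acts by translations, and Nstar
   is globally Lipschitz in B because N is saturable.  Replacing the datum by its continuous
   representative, the Duhamel equation can therefore be solved pointwise, for all real times, by a
   contraction in a weighted sup norm; a ball of L2 bounds is closed and invariant.  The equation is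
   autonomous in time, so the time difference quotients of the solution satisfy a linear Duhamel
   inequality and are Cauchy in L2; this gives B_t, and B_x is then read off the equation because
   Sigma is invertible for c different from 1 and -1.  Linear growth of B_t and B_x comes from the
   same inequality.  Uniqueness follows by testing the weak Duhamel formula with the difference of
   two solutions. *)
theory Submission
  imports Defs
begin

section \<open>The space L2\<close>

text \<open>The superposition operator of the nonlinearity is Lipschitz on L2 but need not be
  differentiable there, so a fixed point in L2 alone yields neither B_t nor B_x. Two kinds of
  estimates are therefore run side by side: L2 bounds, in which \<open>Tc\<close> is isometric, and
  sup bounds, in which it costs a factor 2. The sup bound makes the time increments of the solution
  uniformly small, and this controls the quadratic remainder of the linearisation in L2. Smallness
  near t = 0 comes from the Hoelder-1/2 continuity of an H1 datum, hence the passage to the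
  continuous representative; joint continuity in (t, x) then also settles measurability in the
  Duhamel integrals and Fubini arguments. Differences are taken in time because the coefficients
  depend on x through the profile: a shift in x would create extra terms, a shift in time only
  changes the datum. Admitting negative times makes every limit two-sided.\<close>

lemma L2_measurable [measurable_dest]: "f \<in> L2 \<Longrightarrow> f \<in> borel_measurable borel"
  by (simp add: L2_def)

lemma L2_integrable: "f \<in> L2 \<Longrightarrow> integrable lborel (\<lambda>x. (norm (f x))\<^sup>2)"
  by (simp add: L2_def)

lemma l2norm_nonneg [simp]: "0 \<le> l2norm f"
  by (simp add: l2norm_def)

lemma l2norm_power2: "(l2norm f)\<^sup>2 = (\<integral>x. (norm (f x))\<^sup>2 \<partial>lborel)"
  by (simp add: l2norm_def)

lemma L2_nn_integral:
  assumes "f \<in> L2"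
  shows "(\<integral>\<^sup>+x. ennreal ((norm (f x))\<^sup>2) \<partial>lborel) = ennreal ((l2norm f)\<^sup>2)"
  unfolding l2norm_power2 by (rule nn_integral_eq_integral) (use assms in \<open>auto simp: L2_def\<close>)

lemma L2_nn_integralI:
  assumes [measurable]: "f \<in> borel_measurable borel"
    and le: "(\<integral>\<^sup>+x. ennreal ((norm (f x))\<^sup>2) \<partial>lborel) \<le> ennreal (k\<^sup>2)" and "0 \<le> k"
  shows "f \<in> L2" and "l2norm f \<le> k"
proof -
  have "integrable lborel (\<lambda>x. (norm (f x))\<^sup>2)"
    by (rule integrableI_bounded) (auto intro: le_less_trans[OF le])
  then show f: "f \<in> L2" by (simp add: L2_def)
  have "ennreal ((l2norm f)\<^sup>2) \<le> ennreal (k\<^sup>2)"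
    using le L2_nn_integral[OF f] by simp
  then have "(l2norm f)\<^sup>2 \<le> k\<^sup>2" by (simp add: ennreal_le_iff)
  then show "l2norm f \<le> k" using \<open>0 \<le> k\<close> by (rule power2_le_imp_le)
qed

lemma L2_bound:
  assumes g: "g \<in> L2" and [measurable]: "f \<in> borel_measurable borel"
    and le: "AE x in lborel. norm (f x) \<le> C * norm (g x)" and "0 \<le> C"
  shows "f \<in> L2" and "l2norm f \<le> C * l2norm g"
proof -
  note [measurable] = L2_measurable[OF g]
  have "(\<integral>\<^sup>+x. ennreal ((norm (f x))\<^sup>2) \<partial>lborel) \<le> (\<integral>\<^sup>+x. ennreal (C\<^sup>2) * ennreal ((norm (g x))\<^sup>2) \<partial>lborel)"
    using le
  proof (intro nn_integral_mono_AE, eventually_elim)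
    fix x assume "norm (f x) \<le> C * norm (g x)"
    then have "(norm (f x))\<^sup>2 \<le> (C * norm (g x))\<^sup>2" by (intro power_mono) auto
    then show "ennreal ((norm (f x))\<^sup>2) \<le> ennreal (C\<^sup>2) * ennreal ((norm (g x))\<^sup>2)"
      by (simp add: ennreal_mult[symmetric] power_mult_distrib)
  qed
  also have "\<dots> = ennreal ((C * l2norm g)\<^sup>2)"
    by (subst nn_integral_cmult) (auto simp: L2_nn_integral[OF g] ennreal_mult[symmetric] power_mult_distrib)
  finally have le': "(\<integral>\<^sup>+x. ennreal ((norm (f x))\<^sup>2) \<partial>lborel) \<le> ennreal ((C * l2norm g)\<^sup>2)" .
  show "f \<in> L2" "l2norm f \<le> C * l2norm g"
    by (rule L2_nn_integralI[OF _ le']; use \<open>0 \<le> C\<close> in simp)+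
qed

lemma l2norm_mono:
  assumes "g \<in> L2" "f \<in> borel_measurable borel" "\<And>x. norm (f x) \<le> C * norm (g x)" "0 \<le> C"
  shows "f \<in> L2" and "l2norm f \<le> C * l2norm g"
  using L2_bound[OF assms(1,2) _ assms(4)] assms(3) by auto

lemma L2_cong_AE:
  assumes "f \<in> L2" "g \<in> borel_measurable borel" "AE x in lborel. f x = g x"
  shows "g \<in> L2" and "l2norm g = l2norm f"
proof -
  show g: "g \<in> L2" by (rule L2_bound[OF assms(1,2), where C=1]) (use assms(3) in auto)
  have "AE x in lborel. norm (g x) \<le> 1 * norm (f x)" "AE x in lborel. norm (f x) \<le> 1 * norm (g x)"
    using assms(3) by (eventually_elim, simp)+
  then have "l2norm g \<le> l2norm f" "l2norm f \<le> l2norm g"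
    using L2_bound(2)[OF assms(1,2), of 1] L2_bound(2)[OF g L2_measurable[OF assms(1)], of 1]
    by auto
  then show "l2norm g = l2norm f" by simp
qed

lemma L2_scaleR [simp, intro]: "f \<in> L2 \<Longrightarrow> (\<lambda>x. r *\<^sub>R f x) \<in> L2"
  by (rule l2norm_mono[where C="\<bar>r\<bar>"]) auto

lemma l2norm_scaleR: "l2norm (\<lambda>x. r *\<^sub>R f x) = \<bar>r\<bar> * l2norm f"
  by (simp add: l2norm_def power_mult_distrib real_sqrt_mult)

lemma L2_zero [simp, intro]: "(\<lambda>x. 0) \<in> L2" "l2norm (\<lambda>x. 0) = 0"
  by (simp_all add: L2_def l2norm_def)

lemma L2_minus [simp, intro]: "f \<in> L2 \<Longrightarrow> (\<lambda>x. - f x) \<in> L2"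
  using L2_scaleR[of f "-1"] by simp

lemma L2_add [simp, intro]:
  assumes "f \<in> L2" "g \<in> L2"
  shows "(\<lambda>x. f x + g x) \<in> L2"
proof -
  have [measurable]: "f \<in> borel_measurable borel" "g \<in> borel_measurable borel"
    using assms by (auto intro: L2_measurable)
  have "integrable lborel (\<lambda>x. (norm (f x + g x))\<^sup>2)"
  proof (rule Bochner_Integration.integrable_bound)
    show "integrable lborel (\<lambda>x. 2 * (norm (f x))\<^sup>2 + 2 * (norm (g x))\<^sup>2)"
      using assms by (auto simp: L2_def)
    have "(norm (f x + g x))\<^sup>2 \<le> 2 * (norm (f x))\<^sup>2 + 2 * (norm (g x))\<^sup>2" for x
    proof -
      have "(norm (f x + g x))\<^sup>2 \<le> (norm (f x) + norm (g x))\<^sup>2"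
        by (intro power_mono norm_triangle_ineq) auto
      then show ?thesis using sum_squares_bound[of "norm (f x)" "norm (g x)"]
        by (simp add: power2_sum)
    qed
    then show "AE x in lborel. norm ((norm (f x + g x))\<^sup>2) \<le> norm (2 * (norm (f x))\<^sup>2 + 2 * (norm (g x))\<^sup>2)"
      by (auto intro!: AE_I2 order_trans[OF _ abs_ge_self])
  qed measurable
  then show ?thesis by (simp add: L2_def)
qed

lemma L2_diff [simp, intro]: "f \<in> L2 \<Longrightarrow> g \<in> L2 \<Longrightarrow> (\<lambda>x. f x - g x) \<in> L2"
  using L2_add[of f "\<lambda>x. - g x"] by simp

section \<open>Cauchy-Schwarz inequality and the L2 seminorm\<close>

lemma
  assumes "f \<in> L2" "g \<in> L2"
  shows L2_norm_mult_integrable: "integrable lborel (\<lambda>x. norm (f x) * norm (g x))"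
    and L2_norm_mult_le: "(\<integral>x. norm (f x) * norm (g x) \<partial>lborel) \<le> l2norm f * l2norm g"
proof -
  have [measurable]: "f \<in> borel_measurable borel" "g \<in> borel_measurable borel"
    using assms by (auto intro: L2_measurable)
  show int: "integrable lborel (\<lambda>x. norm (f x) * norm (g x))"
  proof (rule Bochner_Integration.integrable_bound)
    show "integrable lborel (\<lambda>x. (norm (f x))\<^sup>2 + (norm (g x))\<^sup>2)"
      using assms by (auto simp: L2_def)
    show "AE x in lborel. norm (norm (f x) * norm (g x)) \<le> norm ((norm (f x))\<^sup>2 + (norm (g x))\<^sup>2)"
    proof (intro AE_I2)
      fix x
      have "2 * norm (f x) * norm (g x) \<le> (norm (f x))\<^sup>2 + (norm (g x))\<^sup>2" by (rule sum_squares_bound)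
      moreover have "0 \<le> norm (f x) * norm (g x)" by simp
      ultimately show "norm (norm (f x) * norm (g x)) \<le> norm ((norm (f x))\<^sup>2 + (norm (g x))\<^sup>2)"
        unfolding real_norm_def by linarith
    qed
  qed measurable
  have "(ennreal (\<integral>x. norm (f x) * norm (g x) \<partial>lborel))\<^sup>2
      = (\<integral>\<^sup>+x. ennreal (norm (f x)) * ennreal (norm (g x)) \<partial>lborel)\<^sup>2"
    by (subst nn_integral_eq_integral[symmetric]) (auto simp: int ennreal_mult)
  also have "\<dots> \<le> (\<integral>\<^sup>+x. (ennreal (norm (f x)))\<^sup>2 \<partial>lborel) * (\<integral>\<^sup>+x. (ennreal (norm (g x)))\<^sup>2 \<partial>lborel)"
    by (rule Cauchy_Schwarz_nn_integral) measurable
  also have "\<dots> = ennreal ((l2norm f * l2norm g)\<^sup>2)"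
    by (simp add: ennreal_power L2_nn_integral assms ennreal_mult[symmetric] power_mult_distrib)
  finally have "(\<integral>x. norm (f x) * norm (g x) \<partial>lborel)\<^sup>2 \<le> (l2norm f * l2norm g)\<^sup>2"
    by (simp add: ennreal_power integral_nonneg_AE)
  then show "(\<integral>x. norm (f x) * norm (g x) \<partial>lborel) \<le> l2norm f * l2norm g"
    by (rule power2_le_imp_le) simp
qed

lemma L2_inner_integrable:
  assumes "f \<in> L2" "g \<in> L2"
  shows "integrable lborel (\<lambda>x. inner (f x) (g x))"
proof (rule Bochner_Integration.integrable_bound[OF L2_norm_mult_integrable[OF assms]])
  show "(\<lambda>x. inner (f x) (g x)) \<in> borel_measurable lborel"
    using assms[THEN L2_measurable] by measurable
qed (auto intro: Cauchy_Schwarz_ineq2)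

lemma l2inner_le:
  assumes "f \<in> L2" "g \<in> L2"
  shows "\<bar>l2inner f g\<bar> \<le> l2norm f * l2norm g"
proof -
  have "\<bar>l2inner f g\<bar> \<le> (\<integral>x. norm (inner (f x) (g x)) \<partial>lborel)"
    unfolding l2inner_def by (metis integral_norm_bound real_norm_def)
  also have "\<dots> \<le> (\<integral>x. norm (f x) * norm (g x) \<partial>lborel)"
    by (intro integral_mono integrable_norm L2_inner_integrable L2_norm_mult_integrable assms)
       (auto intro: Cauchy_Schwarz_ineq2)
  finally show ?thesis using L2_norm_mult_le[OF assms] by simp
qed

lemma l2inner_add_left: "f \<in> L2 \<Longrightarrow> g \<in> L2 \<Longrightarrow> h \<in> L2 \<Longrightarrow> l2inner (\<lambda>x. f x + g x) h = l2inner f h + l2inner g h"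
  by (simp add: l2inner_def inner_add_left L2_inner_integrable)

lemma l2inner_diff_left: "f \<in> L2 \<Longrightarrow> g \<in> L2 \<Longrightarrow> h \<in> L2 \<Longrightarrow> l2inner (\<lambda>x. f x - g x) h = l2inner f h - l2inner g h"
  by (simp add: l2inner_def inner_diff_left L2_inner_integrable)

lemma l2inner_self: "l2inner f f = (l2norm f)\<^sup>2"
  by (simp add: l2inner_def l2norm_power2 power2_norm_eq_inner)

lemma l2norm_triangle:
  assumes "f \<in> L2" "g \<in> L2"
  shows "l2norm (\<lambda>x. f x + g x) \<le> l2norm f + l2norm g"
proof (rule power2_le_imp_le)
  have "(l2norm (\<lambda>x. f x + g x))\<^sup>2 = (\<integral>x. (norm (f x))\<^sup>2 + 2 * inner (f x) (g x) + (norm (g x))\<^sup>2 \<partial>lborel)"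
    unfolding l2norm_power2
    by (simp add: power2_norm_eq_inner inner_add_left inner_add_right inner_commute algebra_simps)
  also have "\<dots> = (l2norm f)\<^sup>2 + 2 * l2inner f g + (l2norm g)\<^sup>2"
    unfolding l2norm_power2 l2inner_def
    by (simp add: assms L2_inner_integrable L2_integrable)
  also have "\<dots> \<le> (l2norm f + l2norm g)\<^sup>2"
    using l2inner_le[OF assms] by (simp add: power2_sum)
  finally show "(l2norm (\<lambda>x. f x + g x))\<^sup>2 \<le> (l2norm f + l2norm g)\<^sup>2" .
qed simp

lemma l2norm_minus [simp]: "l2norm (\<lambda>x. - f x) = l2norm f"
  by (simp add: l2norm_def)

lemma l2norm_minus_commute: "l2norm (\<lambda>x. f x - g x) = l2norm (\<lambda>x. g x - f x)"
  by (simp add: l2norm_def norm_minus_commute)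

lemma l2norm_triangle_diff:
  assumes "f \<in> L2" "g \<in> L2"
  shows "l2norm (\<lambda>x. f x - g x) \<le> l2norm f + l2norm g"
  using l2norm_triangle[of f "\<lambda>x. - g x"] assms by simp

lemma l2norm_triangle_sub:
  assumes "f \<in> L2" "g \<in> L2"
  shows "l2norm f \<le> l2norm (\<lambda>x. f x - g x) + l2norm g"
  using l2norm_triangle[of "\<lambda>x. f x - g x" g] assms by simp

lemma l2norm_dist_triangle:
  assumes "f \<in> L2" "g \<in> L2" "h \<in> L2"
  shows "l2norm (\<lambda>x. f x - h x) \<le> l2norm (\<lambda>x. f x - g x) + l2norm (\<lambda>x. g x - h x)"
  using l2norm_triangle[of "\<lambda>x. f x - g x" "\<lambda>x. g x - h x"] assms by simp

lemma L2_translate: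
  assumes "f \<in> L2"
  shows "(\<lambda>x. f (x + s)) \<in> L2" and "l2norm (\<lambda>x. f (x + s)) = l2norm f"
proof -
  have [measurable]: "f \<in> borel_measurable borel" using assms by (rule L2_measurable)
  show "(\<lambda>x. f (x + s)) \<in> L2"
    using lborel_integrable_real_affine[OF L2_integrable[OF assms], of 1 s]
    by (simp add: L2_def add.commute)
  show "l2norm (\<lambda>x. f (x + s)) = l2norm f"
    using lborel_integral_real_affine[of 1 "\<lambda>x. (norm (f x))\<^sup>2" s]
    by (simp add: l2norm_def add.commute)
qed

section \<open>Limit theorems in L2: Fatou, Minkowski, completeness, dominated convergence\<close>

lemma L2_Fatou:
  assumes f: "\<And>n::nat. f n \<in> L2" and le: "\<And>n. l2norm (f n) \<le> k"
    and lim: "AE x in lborel. (\<lambda>n. f n x) \<longlonglongrightarrow> g x" and [measurable]: "g \<in> borel_measurable borel"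
  shows "g \<in> L2" and "l2norm g \<le> k"
proof -
  have [measurable]: "f n \<in> borel_measurable borel" for n using f by (rule L2_measurable)
  have "0 \<le> k" using le[of 0] l2norm_nonneg[of "f 0"] by linarith
  have "(\<integral>\<^sup>+x. ennreal ((norm (g x))\<^sup>2) \<partial>lborel) = (\<integral>\<^sup>+x. liminf (\<lambda>n. ennreal ((norm (f n x))\<^sup>2)) \<partial>lborel)"
    using lim
  proof (intro nn_integral_cong_AE, eventually_elim)
    fix x assume "(\<lambda>n. f n x) \<longlonglongrightarrow> g x"
    then have "(\<lambda>n. ennreal ((norm (f n x))\<^sup>2)) \<longlonglongrightarrow> ennreal ((norm (g x))\<^sup>2)"
      by (intro tendsto_ennrealI tendsto_intros)
    then show "ennreal ((norm (g x))\<^sup>2) = liminf (\<lambda>n. ennreal ((norm (f n x))\<^sup>2))"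
      by (rule lim_imp_Liminf[OF sequentially_bot, symmetric])
  qed
  also have "\<dots> \<le> liminf (\<lambda>n. \<integral>\<^sup>+x. ennreal ((norm (f n x))\<^sup>2) \<partial>lborel)"
    by (rule nn_integral_liminf) measurable
  also have "\<dots> \<le> liminf (\<lambda>n::nat. ennreal (k\<^sup>2))"
    by (intro Liminf_mono always_eventually allI)
       (use le in \<open>auto simp: L2_nn_integral f intro!: ennreal_leI power_mono\<close>)
  also have "\<dots> = ennreal (k\<^sup>2)" by (rule Liminf_const) simp
  finally have *: "(\<integral>\<^sup>+x. ennreal ((norm (g x))\<^sup>2) \<partial>lborel) \<le> ennreal (k\<^sup>2)" .
  show "g \<in> L2" "l2norm g \<le> k"
    by (rule L2_nn_integralI[OF _ * \<open>0 \<le> k\<close>]; measurable)+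
qed

text \<open>Minkowski's integral inequality against a given majorant. Splitting
  \<open>norm (Y s x)\<close> into \<open>sqrt (\<kappa> s)\<close> and
  \<open>norm (Y s x) / sqrt (\<kappa> s)\<close>, Cauchy-Schwarz in s and Tonelli bound the squared
  L2 norm by the integral of \<kappa> times the integral of |Y s|^2 / \<kappa> s, hence by the
  square of the first factor. The division is the reason for \<open>0 < \<kappa> s\<close>.\<close>

lemma L2_Minkowski:
  fixes Y :: "real \<Rightarrow> real \<Rightarrow> real \<times> real"
  assumes Y[measurable]: "case_prod Y \<in> borel_measurable borel"
    and [measurable]: "\<kappa> \<in> borel_measurable borel" "A \<in> sets borel"
    and pos: "\<And>s. s \<in> A \<Longrightarrow> 0 < \<kappa> s" and int: "set_integrable lborel A \<kappa>"
    and Y2: "\<And>s. s \<in> A \<Longrightarrow> Y s \<in> L2" "\<And>s. s \<in> A \<Longrightarrow> l2norm (Y s) \<le> \<kappa> s"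
  shows "(\<lambda>x. LINT s:A|lborel. Y s x) \<in> L2"
    and "l2norm (\<lambda>x. LINT s:A|lborel. Y s x) \<le> (LINT s:A|lborel. \<kappa> s)"
proof -
  have [measurable]: "(\<lambda>p. Y (fst p) (snd p)) \<in> borel_measurable (lborel \<Otimes>\<^sub>M lborel)"
    "(\<lambda>p. Y (snd p) (fst p)) \<in> borel_measurable (lborel \<Otimes>\<^sub>M lborel)"
  proof -
    have Y': "case_prod Y \<in> borel_measurable (borel \<Otimes>\<^sub>M borel)" using Y by (simp add: borel_prod)
    have "(\<lambda>p. (fst p, snd p)) \<in> lborel \<Otimes>\<^sub>M lborel \<rightarrow>\<^sub>M borel \<Otimes>\<^sub>M (borel :: real measure)"
      "(\<lambda>p. (snd p, fst p)) \<in> lborel \<Otimes>\<^sub>M lborel \<rightarrow>\<^sub>M borel \<Otimes>\<^sub>M (borel :: real measure)" by measurable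
    from measurable_compose[OF this(1) Y'] measurable_compose[OF this(2) Y']
    show "(\<lambda>p. Y (fst p) (snd p)) \<in> borel_measurable (lborel \<Otimes>\<^sub>M lborel)"
    "(\<lambda>p. Y (snd p) (fst p)) \<in> borel_measurable (lborel \<Otimes>\<^sub>M lborel)" by auto
  qed
  define J where "J = (LINT s:A|lborel. \<kappa> s)"
  define a where "a s = indicator A s * sqrt (\<kappa> s)" for s
  define b where "b s x = indicator A s * norm (Y s x) / sqrt (\<kappa> s)" for s x
  have [measurable]: "a \<in> borel_measurable borel" unfolding a_def by measurable
  have b1[measurable]: "(\<lambda>p. b (fst p) (snd p)) \<in> borel_measurable (lborel \<Otimes>\<^sub>M lborel)"
    unfolding b_def by measurable
  have b2[measurable]: "(\<lambda>p. b (snd p) (fst p)) \<in> borel_measurable (lborel \<Otimes>\<^sub>M lborel)"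
    unfolding b_def by measurable
  have b3[measurable]: "(\<lambda>s. b s x) \<in> borel_measurable lborel" for x
    using measurable_Pair2[OF b2, of x] by simp
  have b4[measurable]: "(\<lambda>x. b s x) \<in> borel_measurable lborel" for s
    using measurable_Pair2[OF b1, of s] by simp
  have J0: "0 \<le> J" unfolding J_def set_lebesgue_integral_def
    by (intro integral_nonneg_AE AE_I2) (use pos in \<open>auto simp: indicator_def intro: less_imp_le\<close>)
  have kint: "(\<integral>\<^sup>+s. ennreal (indicator A s * \<kappa> s) \<partial>lborel) = ennreal J"
    unfolding J_def set_lebesgue_integral_def using int[unfolded set_integrable_def] pos
    by (subst nn_integral_eq_integral) (auto simp: indicator_def intro!: AE_I2 less_imp_le)
  have sq: "(ennreal (norm (LINT s:A|lborel. Y s x)))\<^sup>2 \<le> ennreal J * (\<integral>\<^sup>+s. (ennreal (b s x))\<^sup>2 \<partial>lborel)" for x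
  proof -
    have "ennreal (norm (LINT s:A|lborel. Y s x)) \<le> (\<integral>\<^sup>+s. ennreal (a s) * ennreal (b s x) \<partial>lborel)"
    proof (cases "set_integrable lborel A (\<lambda>s. Y s x)")
      case True
      have "ennreal (norm (LINT s:A|lborel. Y s x)) \<le> (\<integral>\<^sup>+s. ennreal (norm (indicator A s *\<^sub>R Y s x)) \<partial>lborel)"
        unfolding set_lebesgue_integral_def
        by (rule integral_norm_bound_ennreal) (use True in \<open>simp add: set_integrable_def\<close>)
      also have "\<dots> = (\<integral>\<^sup>+s. ennreal (a s) * ennreal (b s x) \<partial>lborel)"
      proof (intro nn_integral_cong)
        fix s
        show "ennreal (norm (indicator A s *\<^sub>R Y s x)) = ennreal (a s) * ennreal (b s x)"
          using pos[of s] by (cases "s \<in> A") (auto simp: a_def b_def ennreal_mult[symmetric])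
      qed
      finally show ?thesis .
    next
      \<comment> \<open>A point x at which the integrand is not integrable is harmless: the Bochner
        integral is 0 there by default.\<close>
      case False
      then show ?thesis
        unfolding set_lebesgue_integral_def set_integrable_def by (simp add: not_integrable_integral_eq)
    qed
    then have "(ennreal (norm (LINT s:A|lborel. Y s x)))\<^sup>2 \<le> (\<integral>\<^sup>+s. ennreal (a s) * ennreal (b s x) \<partial>lborel)\<^sup>2"
      by (intro power_mono) auto
    also have "\<dots> \<le> (\<integral>\<^sup>+s. (ennreal (a s))\<^sup>2 \<partial>lborel) * (\<integral>\<^sup>+s. (ennreal (b s x))\<^sup>2 \<partial>lborel)"
      by (rule Cauchy_Schwarz_nn_integral) measurable
    also have "(\<integral>\<^sup>+s. (ennreal (a s))\<^sup>2 \<partial>lborel) = (\<integral>\<^sup>+s. ennreal (indicator A s * \<kappa> s) \<partial>lborel)"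
    proof (intro nn_integral_cong)
      fix s
      show "(ennreal (a s))\<^sup>2 = ennreal (indicator A s * \<kappa> s)"
        using pos[of s] by (cases "s \<in> A") (auto simp: a_def ennreal_power)
    qed
    finally show ?thesis using kint by simp
  qed
  have meas[measurable]: "(\<lambda>x. LINT s:A|lborel. Y s x) \<in> borel_measurable lborel"
    unfolding set_lebesgue_integral_def
    by (rule sigma_finite_measure.borel_measurable_lebesgue_integral[OF sigma_finite_lborel])
       (simp add: split_beta')
  have "(\<integral>\<^sup>+x. ennreal ((norm (LINT s:A|lborel. Y s x))\<^sup>2) \<partial>lborel)
      \<le> (\<integral>\<^sup>+x. ennreal J * (\<integral>\<^sup>+s. (ennreal (b s x))\<^sup>2 \<partial>lborel) \<partial>lborel)"
    by (intro nn_integral_mono) (use sq in \<open>simp add: ennreal_power\<close>)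
  also have "\<dots> = ennreal J * (\<integral>\<^sup>+x. (\<integral>\<^sup>+s. (ennreal (b s x))\<^sup>2 \<partial>lborel) \<partial>lborel)"
    by (rule nn_integral_cmult) measurable
  also have "(\<integral>\<^sup>+x. (\<integral>\<^sup>+s. (ennreal (b s x))\<^sup>2 \<partial>lborel) \<partial>lborel) = (\<integral>\<^sup>+s. (\<integral>\<^sup>+x. (ennreal (b s x))\<^sup>2 \<partial>lborel) \<partial>lborel)"
    by (rule lborel_pair.Fubini'[of "\<lambda>s x. (ennreal (b s x))\<^sup>2"]) (simp add: split_beta')
  also have "\<dots> \<le> (\<integral>\<^sup>+s. ennreal (indicator A s * \<kappa> s) \<partial>lborel)"
  proof (intro nn_integral_mono)
    fix s
    show "(\<integral>\<^sup>+x. (ennreal (b s x))\<^sup>2 \<partial>lborel) \<le> ennreal (indicator A s * \<kappa> s)"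
    proof (cases "s \<in> A")
      case True
      note k = pos[OF True]
      have m: "Y s \<in> borel_measurable borel" using Y2(1)[OF True] by (rule L2_measurable)
      have "(\<integral>\<^sup>+x. (ennreal (b s x))\<^sup>2 \<partial>lborel) = (\<integral>\<^sup>+x. ennreal (1 / \<kappa> s) * ennreal ((norm (Y s x))\<^sup>2) \<partial>lborel)"
        using k True by (intro nn_integral_cong)
          (simp add: b_def ennreal_power ennreal_mult[symmetric] power_divide)
      also have "\<dots> = ennreal (1 / \<kappa> s) * ennreal ((l2norm (Y s))\<^sup>2)"
        using m by (subst nn_integral_cmult) (auto simp: L2_nn_integral[OF Y2(1)[OF True]])
      also have "\<dots> \<le> ennreal (1 / \<kappa> s) * ennreal ((\<kappa> s)\<^sup>2)"
        using Y2(2)[OF True] by (intro mult_left_mono ennreal_leI power_mono) auto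
      also have "\<dots> = ennreal (indicator A s * \<kappa> s)"
        using k True by (simp add: ennreal_mult[symmetric] power2_eq_square)
      finally show ?thesis .
    qed (simp add: b_def)
  qed
  also have "\<dots> = ennreal J" by (rule kint)
  finally have *: "(\<integral>\<^sup>+x. ennreal ((norm (LINT s:A|lborel. Y s x))\<^sup>2) \<partial>lborel) \<le> ennreal (J\<^sup>2)"
    using J0 by (simp add: ennreal_mult[symmetric] power2_eq_square mult_left_mono)
  show "(\<lambda>x. LINT s:A|lborel. Y s x) \<in> L2"
    and "l2norm (\<lambda>x. LINT s:A|lborel. Y s x) \<le> (LINT s:A|lborel. \<kappa> s)"
    using L2_nn_integralI[OF _ * J0] meas by (auto simp: J_def)
qed

text \<open>Riesz-Fischer by a fast subsequence: consecutive differences of norm at most 2^-k force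
  convergence almost everywhere, and Fatou applied to \<open>f n - f (r k)\<close> turns the Cauchy
  estimate into a bound on \<open>f n - g\<close>.\<close>

lemma L2_complete:
  fixes f :: "nat \<Rightarrow> real \<Rightarrow> real \<times> real"
  assumes f: "\<And>n. f n \<in> L2"
    and Cauchy: "\<And>e. 0 < e \<Longrightarrow> \<exists>K. \<forall>m\<ge>K. \<forall>n\<ge>K. l2norm (\<lambda>x. f m x - f n x) < e"
  shows "\<exists>g\<in>L2. (\<lambda>n. l2norm (\<lambda>x. f n x - g x)) \<longlonglongrightarrow> 0"
proof -
  have [measurable]: "f n \<in> borel_measurable borel" for n using f by (rule L2_measurable)
  have "\<forall>k. \<exists>K. \<forall>m\<ge>K. \<forall>n\<ge>K. l2norm (\<lambda>x. f m x - f n x) < (1/2::real)^k"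
    using Cauchy by simp
  then obtain M where M: "\<And>k m n. m \<ge> M k \<Longrightarrow> n \<ge> M k \<Longrightarrow> l2norm (\<lambda>x. f m x - f n x) < (1/2::real)^k"
    by metis
  \<comment> \<open>\<open>M\<close> need not be monotone; adding all earlier thresholds makes both
    \<open>r k\<close> and \<open>r (Suc k)\<close> exceed \<open>M k\<close>, and the summand k
    makes \<open>r k\<close> tend to infinity.\<close>
  define r where "r k = k + (\<Sum>i\<le>k. M i)" for k
  have Mk: "M k \<le> (\<Sum>i\<le>n. M i)" if "k \<le> n" for k n
    by (rule member_le_sum) (use that in auto)
  have rk: "r k \<ge> k" "r k \<ge> M k" "r (Suc k) \<ge> M k" for k
    unfolding r_def using Mk[of k k] Mk[of k "Suc k"] by linarith+
  define d where "d k x = f (r (Suc k)) x - f (r k) x" for k x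
  have d: "d k \<in> L2" "l2norm (d k) \<le> (1/2)^k" for k
    unfolding d_def using f M[of k, OF rk(3) rk(2)] by auto
  have [measurable]: "d k \<in> borel_measurable borel" for k unfolding d_def by measurable
  \<comment> \<open>The weight 2^k is a compromise: the squared norms are at most 4^-k, so the
    weighted sum is still integrable, while its finiteness at x forces \<open>norm (d k x)\<close>
    to decay like 2^(-k/2).\<close>
  have "(\<integral>\<^sup>+x. (\<Sum>k. ennreal (2^k * (norm (d k x))\<^sup>2)) \<partial>lborel)
      = (\<Sum>k. \<integral>\<^sup>+x. ennreal (2^k * (norm (d k x))\<^sup>2) \<partial>lborel)"
    by (rule nn_integral_suminf) measurable
  also have "\<dots> \<le> (\<Sum>k. ennreal ((1/2)^k))"
  proof (intro suminf_le allI)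
    fix k
    have "(\<integral>\<^sup>+x. ennreal (2^k * (norm (d k x))\<^sup>2) \<partial>lborel) = ennreal (2^k) * ennreal ((l2norm (d k))\<^sup>2)"
      by (simp add: ennreal_mult nn_integral_cmult L2_nn_integral d)
    also have "\<dots> \<le> ennreal (2^k) * ennreal (((1/2)^k)\<^sup>2)"
      using d(2) by (intro mult_left_mono ennreal_leI power_mono) auto
    also have "\<dots> = ennreal ((1/2)^k)"
      by (simp add: ennreal_mult[symmetric] power2_eq_square power_divide)
    finally show "(\<integral>\<^sup>+x. ennreal (2^k * (norm (d k x))\<^sup>2) \<partial>lborel) \<le> ennreal ((1/2)^k)" .
  qed auto
  also have "\<dots> = ennreal (\<Sum>k. (1/2)^k)"
    by (rule suminf_ennreal2) (auto intro: summable_geometric)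
  also have "\<dots> < \<infinity>" by simp
  finally have "AE x in lborel. (\<Sum>k. ennreal (2^k * (norm (d k x))\<^sup>2)) \<noteq> \<infinity>"
    by (intro nn_integral_PInf_AE) auto
  then have conv: "AE x in lborel. convergent (\<lambda>k. f (r k) x)"
  proof eventually_elim
    fix x assume *: "(\<Sum>k. ennreal (2^k * (norm (d k x))\<^sup>2)) \<noteq> \<infinity>"
    define S where "S = enn2real (\<Sum>k. ennreal (2^k * (norm (d k x))\<^sup>2))"
    have S: "0 \<le> S" "(\<Sum>k. ennreal (2^k * (norm (d k x))\<^sup>2)) = ennreal S"
      using * unfolding S_def by (simp_all add: less_top)
    have "norm (d k x) \<le> sqrt S * (sqrt (1/2))^k" for k
    proof -
      have "ennreal (2^k * (norm (d k x))\<^sup>2) \<le> ennreal S"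
        unfolding S(2)[symmetric]
        by (rule order_trans[OF _ sum_le_suminf[of _ "{k}"]]) (auto simp del: suminf_ennreal_eq)
      then have "2^k * (norm (d k x))\<^sup>2 \<le> S" using ennreal_le_iff[OF S(1)] by blast
      then have "(norm (d k x))\<^sup>2 \<le> S / 2^k" by (subst pos_le_divide_eq) (simp_all add: mult.commute)
      then have "(norm (d k x))\<^sup>2 \<le> S * (1/2)^k" by (simp only: power_inverse divide_inverse mult_1)
      then have "sqrt ((norm (d k x))\<^sup>2) \<le> sqrt (S * (1/2)^k)" by (rule real_sqrt_le_mono)
      then show ?thesis by (simp add: real_sqrt_mult real_sqrt_power)
    qed
    moreover have "summable (\<lambda>k. sqrt S * (sqrt (1/2))^k)"
      by (intro summable_mult summable_geometric) (simp add: real_sqrt_divide)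
    ultimately have "summable (\<lambda>k. d k x)" by (rule summable_comparison_test'[rotated])
    then have "convergent (\<lambda>n. \<Sum>k<n. d k x)" by (simp add: summable_iff_convergent)
    moreover have "(\<Sum>k<n. d k x) = f (r n) x - f (r 0) x" for n
      unfolding d_def by (rule sum_lessThan_telescope)
    ultimately have "convergent (\<lambda>n. f (r n) x - f (r 0) x)" by simp
    then show "convergent (\<lambda>k. f (r k) x)" by (simp add: convergent_diff_const_right_iff)
  qed
  define g where "g x = lim (\<lambda>k. f (r k) x)" for x
  have [measurable]: "g \<in> borel_measurable borel"
    unfolding g_def by (rule borel_measurable_lim_metric) measurable
  have lim: "AE x in lborel. (\<lambda>k. f (r k) x) \<longlonglongrightarrow> g x"
    using conv by eventually_elim (simp add: g_def convergent_LIMSEQ_iff)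
  have bd: "(\<lambda>x. f n x - g x) \<in> L2 \<and> l2norm (\<lambda>x. f n x - g x) \<le> e"
    if K: "\<forall>m\<ge>K. \<forall>n\<ge>K. l2norm (\<lambda>x. f m x - f n x) < e" and n: "n \<ge> K" for K n e
  proof -
    let ?h = "\<lambda>k x. f n x - f (r (k + K)) x"
    have le: "l2norm (?h k) \<le> e" for k
    proof -
      have "K \<le> r (k + K)" using rk(1)[of "k + K"] by linarith
      then show ?thesis using K n by (simp add: less_imp_le)
    qed
    have "AE x in lborel. (\<lambda>k. ?h k x) \<longlonglongrightarrow> f n x - g x"
      using lim by eventually_elim (intro tendsto_intros LIMSEQ_ignore_initial_segment)
    then show ?thesis using L2_Fatou[of ?h e "\<lambda>x. f n x - g x"] le f by auto
  qed
  obtain K where K: "\<forall>m\<ge>K. \<forall>n\<ge>K. l2norm (\<lambda>x. f m x - f n x) < 1" using Cauchy[of 1] by auto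
  have "(\<lambda>x. f K x - (f K x - g x)) \<in> L2" by (rule L2_diff) (use f bd[OF K order_refl] in auto)
  then have "g \<in> L2" by simp
  moreover have "(\<lambda>n. l2norm (\<lambda>x. f n x - g x)) \<longlonglongrightarrow> 0"
  proof (rule LIMSEQ_I)
    fix e :: real assume "0 < e"
    then obtain K where K: "\<forall>m\<ge>K. \<forall>n\<ge>K. l2norm (\<lambda>x. f m x - f n x) < e/2" using Cauchy[of "e/2"] by auto
    have "norm (l2norm (\<lambda>x. f n x - g x) - 0) < e" if "n \<ge> K" for n
      using bd[OF K that] \<open>0 < e\<close> by simp
    then show "\<exists>K. \<forall>n\<ge>K. norm (l2norm (\<lambda>x. f n x - g x) - 0) < e" by blast
  qed
  ultimately show ?thesis by blast
qed

lemma L2_dominated_convergence: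
  fixes f :: "nat \<Rightarrow> real \<Rightarrow> real \<times> real"
  assumes [measurable]: "\<And>n. f n \<in> borel_measurable borel" "g \<in> borel_measurable borel"
    and w: "integrable lborel (\<lambda>x. (w x)\<^sup>2)"
    and le: "\<And>n. AE x in lborel. norm (f n x) \<le> w x"
    and lim: "AE x in lborel. (\<lambda>n. f n x) \<longlonglongrightarrow> g x"
  shows "\<And>n. f n \<in> L2" and "g \<in> L2" and "(\<lambda>n. l2norm (\<lambda>x. f n x - g x)) \<longlonglongrightarrow> 0"
proof -
  have gle: "AE x in lborel. norm (g x) \<le> w x"
  proof -
    have "AE x in lborel. \<forall>n. norm (f n x) \<le> w x" using le by (simp add: AE_all_countable)
    with lim show ?thesis by eventually_elim (auto intro: LIMSEQ_le_const2[OF tendsto_norm])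
  qed
  have *: "h \<in> L2" if [measurable]: "h \<in> borel_measurable borel" and h: "AE x in lborel. norm (h x) \<le> w x" for h
  proof -
    have "integrable lborel (\<lambda>x. (norm (h x))\<^sup>2)"
      by (rule Bochner_Integration.integrable_bound[OF w], measurable)
         (use h in \<open>eventually_elim, auto intro: power_mono\<close>)
    then show ?thesis by (simp add: L2_def)
  qed
  show "f n \<in> L2" for n using le by (intro *) auto
  show "g \<in> L2" using gle by (intro *) auto
  have "(\<lambda>n. \<integral>x. (norm (f n x - g x))\<^sup>2 \<partial>lborel) \<longlonglongrightarrow> (\<integral>x. 0 \<partial>(lborel :: real measure))"
  proof (rule integral_dominated_convergence[where w="\<lambda>x. 4 * (w x)\<^sup>2"])
    show "integrable lborel (\<lambda>x. 4 * (w x)\<^sup>2)" using w by simp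
    show "AE x in lborel. (\<lambda>n. (norm (f n x - g x))\<^sup>2) \<longlonglongrightarrow> 0"
      using lim by eventually_elim (auto intro!: tendsto_eq_intros simp: LIM_zero_iff)
    show "AE x in lborel. norm ((norm (f n x - g x))\<^sup>2) \<le> 4 * (w x)\<^sup>2" for n
      using le[of n] gle
    proof eventually_elim
      fix x assume "norm (f n x) \<le> w x" "norm (g x) \<le> w x"
      then have "norm (f n x - g x) \<le> 2 * w x"
        using norm_triangle_ineq4[of "f n x" "g x"] by linarith
      then have "(norm (f n x - g x))\<^sup>2 \<le> (2 * w x)\<^sup>2" by (intro power_mono) auto
      then show "norm ((norm (f n x - g x))\<^sup>2) \<le> 4 * (w x)\<^sup>2" by (simp add: power_mult_distrib)
    qed
  qed measurable
  then show "(\<lambda>n. l2norm (\<lambda>x. f n x - g x)) \<longlonglongrightarrow> 0"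
    unfolding l2norm_def using tendsto_real_sqrt by fastforce
qed

section \<open>Density of compactly supported continuous functions and continuity of
  translations\<close>

lemma integrable_indicator_power2: "integrable lborel (\<lambda>x. (K * indicator {a..b::real} x)\<^sup>2 :: real)"
proof -
  have "(\<lambda>x. (K * indicator {a..b} x)\<^sup>2) = (\<lambda>x. K\<^sup>2 * indicator {a..b} x :: real)"
    by (auto simp: indicator_def)
  moreover have "integrable lborel (\<lambda>x. K\<^sup>2 * indicator {a..b} x :: real)"
    by (intro integrable_mult_right integrable_real_indicator) (auto simp: emeasure_lborel_Icc_eq)
  ultimately show ?thesis by simp
qed

text \<open>Radial retraction onto the closed ball of radius \<open>R\<close> when
  \<open>0 < R\<close>; the \<open>max\<close> in the denominator keeps it continuous at 0 and
  across the sphere.\<close>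

definition clamp_norm :: "real \<Rightarrow> 'a::real_normed_vector \<Rightarrow> 'a" where
  "clamp_norm R y = (R / max R (norm y)) *\<^sub>R y"

lemma norm_clamp_norm: "0 < R \<Longrightarrow> norm (clamp_norm R y) \<le> R"
  and norm_clamp_norm': "0 < R \<Longrightarrow> norm (clamp_norm R y) \<le> norm y"
  and clamp_norm_id: "0 < R \<Longrightarrow> norm y \<le> R \<Longrightarrow> clamp_norm R y = y"
  by (auto simp: clamp_norm_def max_def field_simps mult_left_le_one_le)

lemma continuous_on_clamp_norm: "0 < R \<Longrightarrow> continuous_on UNIV (clamp_norm R)"
  unfolding clamp_norm_def by (intro continuous_intros) auto

text \<open>Truncating in space and in range comes first, so that the approximants share one bounded
  majorant of compact support. Almost everywhere approximation by continuous functions gives no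
  control of their size; clamping and a tent cutoff restore it without moving the limit, and
  dominated convergence finishes.\<close>

lemma L2_dense_continuous:
  assumes f: "f \<in> L2" and "0 < e"
  obtains g R where "continuous_on UNIV g" "g \<in> L2" "\<And>x. R < \<bar>x\<bar> \<Longrightarrow> g x = 0" "l2norm (\<lambda>x. f x - g x) < e"
proof -
  have [measurable]: "f \<in> borel_measurable borel" using f by (rule L2_measurable)
  define F where "F n x = indicator {-(real n)..real n} x *\<^sub>R clamp_norm (real n + 1) (f x)" for n x
  have cm[measurable]: "clamp_norm (real n + 1) \<in> borel_measurable (borel :: (real \<times> real) measure)" for n
    by (intro borel_measurable_continuous_onI continuous_on_clamp_norm) simp
  have Fm[measurable]: "F n \<in> borel_measurable borel" for n unfolding F_def by measurable
  have Flim: "(\<lambda>n. F n x) \<longlonglongrightarrow> f x" for x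
  proof (rule tendsto_eventually)
    obtain n0 :: nat where n0: "max \<bar>x\<bar> (norm (f x)) \<le> real n0" using real_arch_simple by blast
    have "F n x = f x" if "n \<ge> n0" for n
    proof -
      have "real n0 \<le> real n" using that by simp
      then have "\<bar>x\<bar> \<le> real n" "norm (f x) \<le> real n" using n0 by linarith+
      then show ?thesis unfolding F_def by (subst clamp_norm_id) (auto simp: abs_le_iff)
    qed
    then show "\<forall>\<^sub>F n in sequentially. F n x = f x" by (auto simp: eventually_sequentially)
  qed
  have Fle: "norm (F n x) \<le> norm (f x)" for n x
    by (auto simp: F_def indicator_def norm_clamp_norm')
  have "(\<lambda>n. l2norm (\<lambda>x. F n x - f x)) \<longlonglongrightarrow> 0"
    by (rule L2_dominated_convergence(3)[where w="\<lambda>x. norm (f x)"])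
       (use Flim Fle f in \<open>auto simp: L2_def\<close>)
  from LIMSEQ_D[OF this, of "e/2"] obtain n where n: "l2norm (\<lambda>x. F n x - f x) < e/2"
    using \<open>0 < e\<close> by auto
  \<comment> \<open>Measurability in the sense of \<open>measurable_on\<close> hands over continuous
    functions \<open>G k\<close> that converge to \<open>F n\<close> off a negligible set.\<close>
  have "F n measurable_on UNIV"
    by (rule lebesgue_measurable_imp_measurable_on) (auto intro: measurable_completion)
  then obtain N G where N: "negligible N" and G: "\<And>k. continuous_on UNIV (G k)"
    "\<And>x. x \<notin> N \<Longrightarrow> (\<lambda>k. G k x) \<longlonglongrightarrow> F n x" by (auto simp: measurable_on_def)
  define R where "R = real n + 1"
  have R: "0 < R" by (simp add: R_def)
  \<comment> \<open>With \<open>R = n + 1\<close> the tent equals 1 where \<open>F n\<close> may be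
    nonzero and the clamp does not act on the values of \<open>F n\<close>, so \<open>H k\<close>
    has the same limit as \<open>G k\<close>.\<close>
  define H where "H k x = max 0 (min 1 (R - \<bar>x\<bar>)) *\<^sub>R clamp_norm R (G k x)" for k x
  have Hc: "continuous_on UNIV (H k)" for k
    unfolding H_def
    by (intro continuous_intros continuous_on_compose2[OF continuous_on_clamp_norm[OF R] G(1)]) auto
  have Hm: "H k \<in> borel_measurable borel" for k
    by (rule borel_measurable_continuous_onI[OF Hc])
  have Hlim: "(\<lambda>k. H k x) \<longlonglongrightarrow> F n x" if "x \<notin> N" for x
  proof -
    have Fx: "clamp_norm R (F n x) = F n x"
      by (rule clamp_norm_id[OF R]) (auto simp: F_def R_def indicator_def norm_clamp_norm)
    have "(\<lambda>k. clamp_norm R (G k x)) \<longlonglongrightarrow> clamp_norm R (F n x)"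
      by (rule continuous_on_tendsto_compose[OF continuous_on_clamp_norm[OF R] G(2)[OF that]]) auto
    then have "(\<lambda>k. H k x) \<longlonglongrightarrow> max 0 (min 1 (R - \<bar>x\<bar>)) *\<^sub>R F n x"
      unfolding H_def Fx by (intro tendsto_intros)
    moreover have "max 0 (min 1 (R - \<bar>x\<bar>)) *\<^sub>R F n x = F n x"
      by (auto simp: F_def R_def indicator_def)
    ultimately show ?thesis by simp
  qed
  have Hle: "norm (H k x) \<le> R * indicator {-R..R} x" for k x
    using norm_clamp_norm[OF R, of "G k x"] 
    by (auto simp: H_def indicator_def intro: order_trans[OF mult_left_le_one_le])
  have "AE x in lborel. x \<notin> N"
    using N AE_not_in[of N lebesgue] by (simp add: negligible_iff_null_sets AE_completion_iff)
  then have lim: "AE x in lborel. (\<lambda>k. H k x) \<longlonglongrightarrow> F n x"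
    by eventually_elim (rule Hlim)
  note dom = L2_dominated_convergence[OF Hm Fm integrable_indicator_power2 AE_I2[OF Hle] lim]
  then obtain k where k: "l2norm (\<lambda>x. H k x - F n x) < e/2"
    using LIMSEQ_D[OF dom(3), of "e/2"] \<open>0 < e\<close> by auto
  have F2: "F n \<in> L2" by (rule dom(2))
  have "l2norm (\<lambda>x. f x - H k x) < e"
    using l2norm_dist_triangle[OF f F2 dom(1)[of k]] n k
    by (simp add: l2norm_minus_commute[of f "F n"] l2norm_minus_commute[of "F n" "H k"])
  moreover have "H k x = 0" if "R < \<bar>x\<bar>" for x using that by (auto simp: H_def)
  ultimately show thesis using that[of "H k" R] Hc dom(1) by blast
qed

text \<open>Three-epsilon argument: translations are isometries, so it suffices to treat a
  continuous function of compact support, for which bounded translates live on one common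
  interval.\<close>

lemma L2_translation_continuous:
  assumes f: "f \<in> L2"
  shows "((\<lambda>s. l2norm (\<lambda>x. f (x + s) - f x)) \<longlongrightarrow> 0) (at 0)"
proof (rule LIM_I)
  fix e :: real assume "0 < e"
  obtain g R where g: "continuous_on UNIV g" "g \<in> L2" "\<And>x. R < \<bar>x\<bar> \<Longrightarrow> g x = 0"
    "l2norm (\<lambda>x. f x - g x) < e/3"
    using L2_dense_continuous[OF f, of "e/3"] \<open>0 < e\<close> by auto
  have gm[measurable]: "g \<in> borel_measurable borel" using g(2) by (rule L2_measurable)
  have "compact (g ` {-R..R})"
    by (intro compact_continuous_image continuous_on_subset[OF g(1)]) auto
  then obtain K where K: "\<And>y. y \<in> g ` {-R..R} \<Longrightarrow> norm y \<le> K" using compact_imp_bounded bounded_iff by metis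
  have gK: "norm (g x) \<le> \<bar>K\<bar>" for x
  proof (cases "\<bar>x\<bar> \<le> R")
    case True
    then have "norm (g x) \<le> K" by (intro K imageI) (simp add: abs_le_iff)
    then show ?thesis by linarith
  next
    case False
    then show ?thesis using g(3)[of x] by simp
  qed
  have "((\<lambda>s. l2norm (\<lambda>x. g (x + s) - g x)) \<longlongrightarrow> 0) (at 0)"
    unfolding tendsto_at_iff_sequentially comp_def
  proof (intro allI impI)
    fix X :: "nat \<Rightarrow> real" assume "X \<longlonglongrightarrow> 0"
    then have "Bseq X" by (intro convergent_imp_Bseq) (auto simp: convergent_def)
    then obtain b where b: "\<And>n. \<bar>X n\<bar> \<le> b" by (auto simp: Bseq_def)
    show "(\<lambda>n. l2norm (\<lambda>x. g (x + X n) - g x)) \<longlonglongrightarrow> 0"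
    proof (rule L2_dominated_convergence(3)[where w="\<lambda>x. \<bar>K\<bar> * indicator {-(R+b)..R+b} x"])
      show "integrable lborel (\<lambda>x. (\<bar>K\<bar> * indicator {-(R+b)..R+b} x)\<^sup>2)"
        by (rule integrable_indicator_power2)
      show "AE x in lborel. norm (g (x + X n)) \<le> \<bar>K\<bar> * indicator {-(R+b)..R+b} x" for n
      proof (rule AE_I2)
        fix x show "norm (g (x + X n)) \<le> \<bar>K\<bar> * indicator {-(R+b)..R+b} x"
          using gK[of "x + X n"] g(3)[of "x + X n"] b[of n] by (auto simp: indicator_def abs_le_iff)
      qed
      show "AE x in lborel. (\<lambda>n. g (x + X n)) \<longlonglongrightarrow> g x"
      proof (rule AE_I2)
        fix x
        have "(\<lambda>n. x + X n) \<longlonglongrightarrow> x + 0" using \<open>X \<longlonglongrightarrow> 0\<close> by (intro tendsto_intros)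
        then show "(\<lambda>n. g (x + X n)) \<longlonglongrightarrow> g x"
          using continuous_on_tendsto_compose[OF g(1)] by force
      qed
    qed measurable
  qed
  from LIM_D[OF this, of "e/3"] \<open>0 < e\<close> obtain d where d: "0 < d"
    "\<And>s. s \<noteq> 0 \<Longrightarrow> \<bar>s\<bar> < d \<Longrightarrow> l2norm (\<lambda>x. g (x + s) - g x) < e/3" by auto
  have "l2norm (\<lambda>x. f (x + s) - f x) < e" if "s \<noteq> 0" "\<bar>s\<bar> < d" for s
  proof -
    have "l2norm (\<lambda>x. f (x + s) - g (x + s)) = l2norm (\<lambda>x. f x - g x)"
      by (rule L2_translate(2)[OF L2_diff[OF f g(2)]])
    then show ?thesis
      using l2norm_dist_triangle[OF L2_translate(1)[OF f, of s] L2_translate(1)[OF g(2), of s] f]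
        l2norm_dist_triangle[OF L2_translate(1)[OF g(2), of s] g(2) f]
        d(2)[OF that] g(4) l2norm_minus_commute[of f g] by simp
  qed
  then show "\<exists>d>0. \<forall>s. s \<noteq> 0 \<and> norm (s - 0) < d \<longrightarrow> norm (l2norm (\<lambda>x. f (x + s) - f x) - 0) < e"
    using d(1) by (intro exI[of _ d]) auto
qed

lemma L2_translation_continuousE:
  assumes "f \<in> L2" "0 < e"
  obtains d where "0 < d" "\<And>s. \<bar>s\<bar> < d \<Longrightarrow> l2norm (\<lambda>x. f (x + s) - f x) < e"
proof -
  from LIM_D[OF L2_translation_continuous[OF assms(1)] assms(2)]
  obtain d where "0 < d" "\<And>s. s \<noteq> 0 \<Longrightarrow> \<bar>s\<bar> < d \<Longrightarrow> l2norm (\<lambda>x. f (x + s) - f x) < e" by auto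
  then have "l2norm (\<lambda>x. f (x + s) - f x) < e" if "\<bar>s\<bar> < d" for s
    using that assms(2) by (cases "s = 0") auto
  then show thesis using that \<open>0 < d\<close> by blast
qed

section \<open>Weak derivatives and test functions\<close>

text \<open>The powers of 1/x close the family under differentiation up to linear combinations;
  \<open>i = 0\<close> is the classical smooth function that is flat at 0.\<close>

definition exp_flat :: "nat \<Rightarrow> real \<Rightarrow> real" where
  "exp_flat i x = (if 0 < x then (1 / x) ^ i * exp (- (1 / x)) else 0)"

lemma exp_flat_deriv: "(exp_flat i has_real_derivative exp_flat (i + 2) x - real i * exp_flat (i + 1) x) (at x)"
proof -
  consider "0 < x" | "x < 0" | "x = 0" by linarith
  then show ?thesis
  proof cases
    case 1
    have "((\<lambda>x. (1 / x) ^ i * exp (- (1 / x))) has_real_derivative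
        exp_flat (i + 2) x - real i * exp_flat (i + 1) x) (at x)"
    proof -
      have "real i * ((1 / x) ^ (i - Suc 0) * - (1 / x\<^sup>2)) = - (real i * (1 / x) ^ (i + 1))"
        using 1 by (cases i) (auto simp: power2_eq_square)
      then show ?thesis using 1
        by (auto intro!: derivative_eq_intros simp: exp_flat_def power2_eq_square algebra_simps)
    qed
    moreover have "\<forall>\<^sub>F y in nhds x. 0 < y" using 1 by (rule eventually_nhds_in_open[OF open_greaterThan, simplified])
    ultimately show ?thesis
      by (subst DERIV_cong_ev[OF refl _ refl]) (auto elim!: eventually_mono simp: exp_flat_def)
  next
    case 2
    have "\<forall>\<^sub>F y in nhds x. y < 0" using 2 by (rule eventually_nhds_in_open[OF open_lessThan, simplified])
    then show ?thesis using 2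
      by (subst DERIV_cong_ev[OF refl _ refl, where g="\<lambda>_. 0"]) (auto elim!: eventually_mono simp: exp_flat_def)
  next
    case 3
    \<comment> \<open>Only the right side matters: with y = 1/h the quotient is y^(i+1) / exp y, and
      exponential growth wins.\<close>
    have lim: "((\<lambda>h. exp_flat i h / h) \<longlongrightarrow> 0) (at 0)"
    proof (rule filterlim_split_at)
      show "((\<lambda>h. exp_flat i h / h) \<longlongrightarrow> 0) (at_left 0)"
        by (rule tendsto_eventually) (auto simp: eventually_at_filter exp_flat_def)
      have "((\<lambda>y::real. y ^ (i + 1) / exp y) \<longlongrightarrow> 0) at_top" by (rule tendsto_power_div_exp_0)
      then have "((\<lambda>h::real. inverse h ^ (i + 1) / exp (inverse h)) \<longlongrightarrow> 0) (at_right 0)"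
        by (rule filterlim_compose[OF _ filterlim_inverse_at_top_right])
      then show "((\<lambda>h. exp_flat i h / h) \<longlongrightarrow> 0) (at_right 0)"
      proof (rule Lim_transform_eventually)
        show "\<forall>\<^sub>F h in at_right 0. inverse h ^ (i + 1) / exp (inverse h) = exp_flat i h / h"
          using eventually_at_right_less[of "0::real"]
          by eventually_elim (simp add: exp_flat_def exp_minus divide_inverse mult_ac)
      qed
    qed
    then show ?thesis using 3 by (simp add: DERIV_def exp_flat_def)
  qed
qed

text \<open>\<open>test_fun\<close> asks for a whole sequence of derivatives. An algebra closed
  under differentiation supplies it by iterating one chosen derivative operator, with no formulas
  for higher derivatives of products.\<close>

inductive_set smooth_alg :: "(real \<Rightarrow> real) set" where
  flat: "(\<lambda>x. exp_flat i (a * x + b)) \<in> smooth_alg"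
| const: "(\<lambda>x. c) \<in> smooth_alg"
| add: "f \<in> smooth_alg \<Longrightarrow> g \<in> smooth_alg \<Longrightarrow> (\<lambda>x. f x + g x) \<in> smooth_alg"
| mult: "f \<in> smooth_alg \<Longrightarrow> g \<in> smooth_alg \<Longrightarrow> (\<lambda>x. f x * g x) \<in> smooth_alg"

lemma smooth_alg_deriv: "f \<in> smooth_alg \<Longrightarrow> \<exists>f'\<in>smooth_alg. \<forall>x. (f has_real_derivative f' x) (at x)"
proof (induction rule: smooth_alg.induct)
  case (flat i a b)
  have "(\<lambda>x. a * (exp_flat (i + 2) (a * x + b) + (- real i) * exp_flat (i + 1) (a * x + b))) \<in> smooth_alg"
    by (intro smooth_alg.intros)
  note m = this
  have d: "((\<lambda>x. exp_flat i (a * x + b)) has_real_derivative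
      a * (exp_flat (i + 2) (a * x + b) + (- real i) * exp_flat (i + 1) (a * x + b))) (at x)" for x
  proof -
    have "((\<lambda>x. a * x + b) has_real_derivative a) (at x)" by (auto intro!: derivative_eq_intros)
    from DERIV_chain2[OF exp_flat_deriv this, of i] show ?thesis by (simp add: mult.commute)
  qed
  show ?case
    by (rule bexI[OF _ m]) (use d in simp)
next
  case (const c)
  show ?case by (rule bexI[OF _ smooth_alg.const[of 0]]) auto
next
  case (add f g)
  then obtain f' g' where "f' \<in> smooth_alg" "g' \<in> smooth_alg"
    and "\<And>x. (f has_real_derivative f' x) (at x)" "\<And>x. (g has_real_derivative g' x) (at x)" by blast
  then show ?case
    by (intro bexI[of _ "\<lambda>x. f' x + g' x"]) (auto intro: smooth_alg.intros derivative_intros)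
next
  case (mult f g)
  then obtain f' g' where "f' \<in> smooth_alg" "g' \<in> smooth_alg"
    and "\<And>x. (f has_real_derivative f' x) (at x)" "\<And>x. (g has_real_derivative g' x) (at x)" by blast
  with mult.hyps show ?case
    by (intro bexI[of _ "\<lambda>x. f' x * g x + g' x * f x"]) (auto intro: smooth_alg.intros DERIV_mult)
qed

lemma smooth_alg_smooth:
  assumes "f \<in> smooth_alg"
  shows "\<exists>D :: nat \<Rightarrow> real \<Rightarrow> real. D 0 = f \<and> (\<forall>k x. (D k has_real_derivative D (Suc k) x) (at x))"
proof -
  obtain d where d: "\<And>f. f \<in> smooth_alg \<Longrightarrow> d f \<in> smooth_alg \<and> (\<forall>x. (f has_real_derivative d f x) (at x))"
    using smooth_alg_deriv by metis
  have "(d ^^ k) f \<in> smooth_alg" for k by (induction k) (use assms d in auto)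
  then show ?thesis using d by (intro exI[of _ "\<lambda>k. (d ^^ k) f"]) auto
qed

text \<open>Stays between 0 and the indicator of [a, b] and converges pointwise to the indicator of
  the open interval, because exp (-1/(n y)) tends to 1 for every y > 0.\<close>

definition bump :: "real \<Rightarrow> real \<Rightarrow> nat \<Rightarrow> real \<Rightarrow> real" where
  "bump a b n x = exp_flat 0 (real n * (x - a)) * exp_flat 0 (real n * (b - x))"

lemma exp_flat_0_bounds: "0 \<le> exp_flat 0 x" "exp_flat 0 x \<le> 1"
  by (auto simp: exp_flat_def)

lemma test_fun_bump: "test_fun (bump a b n)"
proof -
  have "(\<lambda>x. exp_flat 0 (real n * x + - (real n * a)) * exp_flat 0 (- real n * x + real n * b)) \<in> smooth_alg"
    by (intro smooth_alg.intros)
  moreover have "(\<lambda>x. exp_flat 0 (real n * x + - (real n * a)) * exp_flat 0 (- real n * x + real n * b)) = bump a b n"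
    by (auto simp: bump_def algebra_simps)
  ultimately have "\<exists>D. D 0 = bump a b n \<and> (\<forall>k x. (D k has_real_derivative D (Suc k) x) (at x))"
    using smooth_alg_smooth by metis
  moreover have "bump a b n x = 0" if "\<bar>x\<bar> > \<bar>a\<bar> + \<bar>b\<bar>" for x
  proof -
    have "x - a \<le> 0 \<or> b - x \<le> 0" using that by linarith
    then have "real n * (x - a) \<le> 0 \<or> real n * (b - x) \<le> 0" by (metis mult_nonneg_nonpos of_nat_0_le_iff)
    then show ?thesis by (auto simp: bump_def exp_flat_def)
  qed
  ultimately show ?thesis unfolding test_fun_def by blast
qed

lemma bump_bounds: "\<bar>bump a b n x\<bar> \<le> indicator {a..b} x"
proof (cases "x \<in> {a..b}")
  case True
  then show ?thesis
    using exp_flat_0_bounds[of "real n * (x - a)"] exp_flat_0_bounds[of "real n * (b - x)"]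
    by (auto simp: bump_def abs_mult intro: mult_le_one)
next
  case False
  then have "x - a \<le> 0 \<or> b - x \<le> 0" by auto
  then have "real n * (x - a) \<le> 0 \<or> real n * (b - x) \<le> 0" by (metis mult_nonneg_nonpos of_nat_0_le_iff)
  with False show ?thesis by (auto simp: bump_def exp_flat_def)
qed

lemma bump_tendsto: "(\<lambda>n. bump a b n x) \<longlonglongrightarrow> indicator {a<..<b} x"
proof (cases "x \<in> {a<..<b}")
  case True
  have "(\<lambda>n. exp_flat 0 (real n * y)) \<longlonglongrightarrow> 1" if "0 < y" for y
  proof -
    have "(\<lambda>n. exp (- (1 / y * inverse (real n)))) \<longlonglongrightarrow> exp (- (1 / y * 0))"
      by (intro tendsto_intros lim_inverse_n)
    then have "(\<lambda>n. exp (- (1 / y * inverse (real n)))) \<longlonglongrightarrow> 1" by simp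
    moreover have "\<forall>\<^sub>F n in sequentially. exp (- (1 / y * inverse (real n))) = exp_flat 0 (real n * y)"
      using eventually_gt_at_top[of 0] by eventually_elim (use that in \<open>simp add: exp_flat_def field_simps\<close>)
    ultimately show ?thesis by (rule Lim_transform_eventually)
  qed
  from tendsto_mult[OF this[of "x - a"] this[of "b - x"]] True show ?thesis
    unfolding bump_def by simp
next
  case False
  then have "x - a \<le> 0 \<or> b - x \<le> 0" by auto
  then have neg: "real n * (x - a) \<le> 0 \<or> real n * (b - x) \<le> 0" for n by (metis mult_nonneg_nonpos of_nat_0_le_iff)
  have "bump a b n x = 0" for n using neg[of n] by (auto simp: bump_def exp_flat_def)
  with False show ?thesis by simp
qed

lemma test_funD:
  assumes "test_fun \<phi>"
  obtains R where "0 < R" "continuous_on UNIV \<phi>" "continuous_on UNIV (deriv \<phi>)"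
    "\<And>x. (\<phi> has_real_derivative deriv \<phi> x) (at x)"
    "\<And>x. R < \<bar>x\<bar> \<Longrightarrow> \<phi> x = 0" "\<And>x. R < \<bar>x\<bar> \<Longrightarrow> deriv \<phi> x = 0"
proof -
  obtain D R where D: "D 0 = \<phi>" "\<And>k x. (D k has_real_derivative D (Suc k) x) (at x)"
    and R: "\<And>x. \<bar>x\<bar> > R \<Longrightarrow> \<phi> x = 0"
    using assms unfolding test_fun_def by blast
  have d: "deriv \<phi> = D 1" using D(2)[of 0] by (auto simp: D(1) intro: DERIV_imp_deriv)
  have c: "continuous_on UNIV (D k)" for k
    using D(2)[of k] DERIV_isCont by (auto simp: continuous_on_eq_continuous_at)
  have 0: "deriv \<phi> x = 0" if "\<bar>x\<bar> > max R 1" for x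
  proof (rule DERIV_imp_deriv)
    have "open {y. \<bar>y\<bar> > max R 1}" by (intro open_Collect_less continuous_intros)
    then have "\<forall>\<^sub>F y in nhds x. \<bar>y\<bar> > max R 1" using eventually_nhds_in_open[of "{y. \<bar>y\<bar> > max R 1}" x] that by simp
    then have "\<forall>\<^sub>F y in nhds x. \<phi> y = 0" by eventually_elim (simp add: R)
    then show "(\<phi> has_real_derivative 0) (at x)" by (subst DERIV_cong_ev[OF refl _ refl, where g="\<lambda>_. 0"]) auto
  qed
  show thesis
    by (rule that[of "max R 1"]) (use c[of 0] c[of 1] D(2)[of 0] R 0 in \<open>auto simp: D(1) d\<close>)
qed

section \<open>Pairings of L2 functions with functions of compact support\<close>

lemma compact_support_bounded:
  fixes \<phi> :: "real \<Rightarrow> real"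
  assumes "continuous_on UNIV \<phi>" "\<And>x. R < \<bar>x\<bar> \<Longrightarrow> \<phi> x = 0"
  obtains K where "0 < K" "\<And>x. \<bar>\<phi> x\<bar> \<le> K * indicator {-R..R} x"
proof -
  have "compact (\<phi> ` {-R..R})"
    by (intro compact_continuous_image continuous_on_subset[OF assms(1)]) auto
  then obtain K where K: "\<And>y. y \<in> \<phi> ` {-R..R} \<Longrightarrow> norm y \<le> K" using compact_imp_bounded bounded_iff by metis
  show thesis
  proof (rule that[of "\<bar>K\<bar> + 1"])
    fix x show "\<bar>\<phi> x\<bar> \<le> (\<bar>K\<bar> + 1) * indicator {-R..R} x"
    proof (cases "x \<in> {-R..R}")
      case True
      then have "norm (\<phi> x) \<le> K" by (intro K) auto
      with True show ?thesis by simp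
    next
      case False
      then show ?thesis using assms(2)[of x] by (auto simp: abs_le_iff not_le)
    qed
  qed simp
qed

text \<open>The scalar factor is embedded as \<open>(\<phi> x, 0)\<close>, so that Cauchy-Schwarz
  for plane-valued functions covers a scalar times a vector.\<close>

lemma L2_mult_integrable:
  assumes f: "f \<in> L2" and [measurable]: "\<phi> \<in> borel_measurable borel"
    and le: "\<And>x. \<bar>\<phi> x\<bar> \<le> K * indicator {a..b::real} x"
  shows "integrable lborel (\<lambda>x. \<phi> x *\<^sub>R f x)"
    and "(\<lambda>x. (\<phi> x, 0::real)) \<in> L2"
    and "norm (\<integral>x. \<phi> x *\<^sub>R f x \<partial>lborel) \<le> l2norm (\<lambda>x. (\<phi> x, 0::real)) * l2norm f"
proof -
  have [measurable]: "f \<in> borel_measurable borel" using f by (rule L2_measurable)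
  show phi: "(\<lambda>x. (\<phi> x, 0::real)) \<in> L2"
    unfolding L2_def
  proof (safe intro!: Bochner_Integration.integrable_bound[OF integrable_indicator_power2[of K a b]])
    show "AE x in lborel. norm ((norm (\<phi> x, 0::real))\<^sup>2) \<le> norm ((K * indicat_real {a..b} x)\<^sup>2)"
      using le by (auto intro!: AE_I2 power2_le_iff_abs_le[THEN iffD2] abs_le_square_iff[THEN iffD1] order_trans[OF le abs_ge_self])
  qed measurable
  note int = L2_norm_mult_integrable[OF phi f]
  show "integrable lborel (\<lambda>x. \<phi> x *\<^sub>R f x)"
    by (rule Bochner_Integration.integrable_bound[OF int]) auto
  have "norm (\<integral>x. \<phi> x *\<^sub>R f x \<partial>lborel) \<le> (\<integral>x. norm (\<phi> x *\<^sub>R f x) \<partial>lborel)" by (rule integral_norm_bound)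
  also have "\<dots> = (\<integral>x. norm (\<phi> x, 0::real) * norm (f x) \<partial>lborel)" by simp
  finally show "norm (\<integral>x. \<phi> x *\<^sub>R f x \<partial>lborel) \<le> l2norm (\<lambda>x. (\<phi> x, 0::real)) * l2norm f"
    using L2_norm_mult_le[OF phi f] by linarith
qed

lemma test_fun_integrable:
  assumes "test_fun \<phi>" "f \<in> L2"
  shows "integrable lborel (\<lambda>x. \<phi> x *\<^sub>R f x)" "integrable lborel (\<lambda>x. deriv \<phi> x *\<^sub>R f x)"
proof -
  obtain R where R: "0 < R" "continuous_on UNIV \<phi>" "continuous_on UNIV (deriv \<phi>)"
    "\<And>x. R < \<bar>x\<bar> \<Longrightarrow> \<phi> x = 0" "\<And>x. R < \<bar>x\<bar> \<Longrightarrow> deriv \<phi> x = 0"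
    using test_funD[OF assms(1)] by metis
  obtain K where "\<And>x. \<bar>\<phi> x\<bar> \<le> K * indicator {-R..R} x" using compact_support_bounded[OF R(2,4)] by blast
  then show "integrable lborel (\<lambda>x. \<phi> x *\<^sub>R f x)"
    by (rule L2_mult_integrable(1)[OF assms(2) borel_measurable_continuous_onI[OF R(2)]])
  obtain K where "\<And>x. \<bar>deriv \<phi> x\<bar> \<le> K * indicator {-R..R} x" using compact_support_bounded[OF R(3,5)] by blast
  then show "integrable lborel (\<lambda>x. deriv \<phi> x *\<^sub>R f x)"
    by (rule L2_mult_integrable(1)[OF assms(2) borel_measurable_continuous_onI[OF R(3)]])
qed

lemma L2_interval_integrable:
  assumes "f \<in> L2"
  shows "set_integrable lborel {a..b::real} f"
  unfolding set_integrable_def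
  by (rule L2_mult_integrable(1)[OF assms, where K=1]) auto

text \<open>Dominated convergence along bumps shows that \<open>h\<close> has integral 0 over every
  compact interval; Lebesgue differentiation of these averages then gives \<open>h x = 0\<close> off
  a negligible set.\<close>

lemma fundamental_lemma:
  assumes loc: "\<And>a b. set_integrable lborel {a..b} h" and [measurable]: "h \<in> borel_measurable borel"
    and zero: "\<And>\<phi>. test_fun \<phi> \<Longrightarrow> (\<integral>x. \<phi> x *\<^sub>R h x \<partial>lborel) = 0"
  shows "AE x in lborel. h x = (0 :: 'a :: euclidean_space)"
proof -
  have bm[measurable]: "bump a b n \<in> borel_measurable borel" for a b n
  proof -
    obtain D where D: "D 0 = bump a b n" "\<And>k x. (D k has_real_derivative D (Suc k) x) (at x)"
      using test_fun_bump unfolding test_fun_def by metis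
    have "continuous_on UNIV (bump a b n)"
      using D(2)[of 0] DERIV_isCont by (auto simp: continuous_on_eq_continuous_at D(1))
    then show ?thesis by (rule borel_measurable_continuous_onI)
  qed
  have int0: "integral {a..b} h = 0" for a b
  proof -
    have "(\<lambda>n. \<integral>x. bump a b n x *\<^sub>R h x \<partial>lborel) \<longlonglongrightarrow> (\<integral>x. indicator {a<..<b} x *\<^sub>R h x \<partial>lborel)"
    proof (rule integral_dominated_convergence[where w="\<lambda>x. norm (indicator {a..b} x *\<^sub>R h x)"])
      show "integrable lborel (\<lambda>x. norm (indicator {a..b} x *\<^sub>R h x))"
        using loc[of a b] unfolding set_integrable_def by (rule integrable_norm)
      show "AE x in lborel. (\<lambda>n. bump a b n x *\<^sub>R h x) \<longlonglongrightarrow> indicator {a<..<b} x *\<^sub>R h x"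
        by (intro AE_I2 tendsto_intros bump_tendsto)
      show "AE x in lborel. norm (bump a b n x *\<^sub>R h x) \<le> norm (indicator {a..b} x *\<^sub>R h x)" for n
      proof (rule AE_I2)
        fix x show "norm (bump a b n x *\<^sub>R h x) \<le> norm (indicator {a..b} x *\<^sub>R h x)"
          using bump_bounds[of a b n x] by (auto intro: mult_right_mono)
      qed
    qed measurable
    moreover have "(\<integral>x. bump a b n x *\<^sub>R h x \<partial>lborel) = 0" for n by (rule zero[OF test_fun_bump])
    ultimately have "(\<integral>x. indicator {a<..<b} x *\<^sub>R h x \<partial>lborel) = 0"
      using LIMSEQ_unique[OF _ tendsto_const] by (simp add: LIMSEQ_const_iff)
    moreover have "(\<integral>x. indicator {a<..<b} x *\<^sub>R h x \<partial>lborel) = (\<integral>x. indicator {a..b} x *\<^sub>R h x \<partial>lborel)"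
    proof (rule integral_cong_AE)
      show "AE x in lborel. indicator {a<..<b} x *\<^sub>R h x = indicator {a..b} x *\<^sub>R h x"
        using AE_lborel_singleton[of a] AE_lborel_singleton[of b]
        by eventually_elim (auto simp: indicator_def)
    qed measurable
    ultimately show ?thesis
      using set_borel_integral_eq_integral(2)[OF loc[of a b]] by (simp add: set_lebesgue_integral_def)
  qed
  have "\<exists>N. negligible N \<and> (\<forall>x e. x \<notin> N \<and> 0 < e \<longrightarrow> (\<exists>d>0. \<forall>s. 0 < s \<and> s < d \<longrightarrow>
      norm (integral (cbox x (x + s *\<^sub>R One)) h /\<^sub>R s ^ DIM(real) - h x) < e))"
  proof (rule integrable_ccontinuous_explicit[of h])
    show "h integrable_on cbox a b" for a b
      using set_borel_integral_eq_integral(1)[OF loc[of a b]] by simp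
    fix N assume "negligible N" "\<And>x e. \<lbrakk>x \<notin> N; 0 < e\<rbrakk> \<Longrightarrow> \<exists>d>0. \<forall>s. 0 < s \<and> s < d \<longrightarrow>
      norm (integral (cbox x (x + s *\<^sub>R One)) h /\<^sub>R s ^ DIM(real) - h x) < e"
    then show ?thesis by blast
  qed
  then obtain N where N: "negligible N"
    "\<And>x e. \<lbrakk>x \<notin> N; 0 < e\<rbrakk> \<Longrightarrow> \<exists>d>0. \<forall>s. 0 < s \<and> s < d \<longrightarrow>
      norm (integral (cbox x (x + s *\<^sub>R One)) h /\<^sub>R s ^ DIM(real) - h x) < e"
    by blast
  have "h x = 0" if xN: "x \<notin> N" for x
  proof (rule ccontr)
    assume "h x \<noteq> 0"
    then obtain d where d: "d > 0" "\<forall>s. 0 < s \<and> s < d \<longrightarrow>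
        norm (integral (cbox x (x + s *\<^sub>R One)) h /\<^sub>R s ^ DIM(real) - h x) < norm (h x)"
      using N(2)[OF xN, of "norm (h x)"] \<open>h x \<noteq> 0\<close>[folded zero_less_norm_iff] by blast
    have "norm (integral (cbox x (x + (d / 2) *\<^sub>R One)) h /\<^sub>R (d / 2) ^ DIM(real) - h x) < norm (h x)"
      using d(1) by (intro d(2)[rule_format]) auto
    then show False unfolding int0[folded cbox_interval] by simp
  qed
  moreover have "AE x in lborel. x \<notin> N"
    using N(1) AE_not_in[of N lebesgue] by (simp add: negligible_iff_null_sets AE_completion_iff)
  ultimately show ?thesis by (auto elim!: eventually_mono)
qed

section \<open>Algebra and uniqueness of weak derivatives\<close>

lemma weak_deriv_add:
  assumes "weak_deriv f1 g1" "weak_deriv f2 g2" "f1 \<in> L2" "f2 \<in> L2" "g1 \<in> L2" "g2 \<in> L2"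
  shows "weak_deriv (\<lambda>x. f1 x + f2 x) (\<lambda>x. g1 x + g2 x)"
  using assms by (auto simp: weak_deriv_def scaleR_add_right test_fun_integrable)

lemma weak_deriv_diff:
  assumes "weak_deriv f1 g1" "weak_deriv f2 g2" "f1 \<in> L2" "f2 \<in> L2" "g1 \<in> L2" "g2 \<in> L2"
  shows "weak_deriv (\<lambda>x. f1 x - f2 x) (\<lambda>x. g1 x - g2 x)"
  using assms by (auto simp: weak_deriv_def scaleR_diff_right test_fun_integrable)

lemma weak_deriv_unique:
  assumes "weak_deriv f g1" "weak_deriv f g2" "g1 \<in> L2" "g2 \<in> L2"
  shows "AE x in lborel. g1 x = g2 x"
proof -
  have "AE x in lborel. g1 x - g2 x = 0"
  proof (rule fundamental_lemma)
    show "set_integrable lborel {a..b} (\<lambda>x. g1 x - g2 x)" for a b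
      by (intro L2_interval_integrable L2_diff assms)
    show "(\<lambda>x. g1 x - g2 x) \<in> borel_measurable borel" by (intro L2_measurable L2_diff assms)
    fix \<phi> assume "test_fun \<phi>"
    then show "(\<integral>x. \<phi> x *\<^sub>R (g1 x - g2 x) \<partial>lborel) = 0"
      using assms by (simp add: scaleR_diff_right test_fun_integrable weak_deriv_def)
  qed
  then show ?thesis by simp
qed

text \<open>\<open>h1norm\<close> selects a weak derivative by choice; uniqueness almost everywhere
  makes its L2 norm independent of the selection.\<close>

lemma h1norm_eq:
  assumes "g \<in> L2" "weak_deriv f g"
  shows "h1norm f = sqrt ((l2norm f)\<^sup>2 + (l2norm g)\<^sup>2)"
proof -
  define g' where "g' = (SOME g. g \<in> L2 \<and> weak_deriv f g)"
  have g': "g' \<in> L2 \<and> weak_deriv f g'" unfolding g'_def by (rule someI[of _ g]) (use assms in auto)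
  have "l2norm g' = l2norm g"
    by (rule L2_cong_AE(2)) (use assms g' weak_deriv_unique[of f g g'] in \<open>auto intro: L2_measurable\<close>)
  then show ?thesis by (simp add: h1norm_def g'_def)
qed

lemma pair_measurable_lborel:
  assumes "case_prod Y \<in> borel_measurable (borel :: (real \<times> real) measure)"
  shows "case_prod Y \<in> borel_measurable (lborel \<Otimes>\<^sub>M lborel)"
proof -
  have "case_prod Y \<in> borel_measurable (borel \<Otimes>\<^sub>M borel)" using assms by (simp add: borel_prod)
  then show ?thesis by (simp cong: measurable_cong_sets)
qed

text \<open>The hypothesis of Fubini on a strip: Cauchy-Schwarz in x bounds every slice uniformly
  and the s-interval has finite length. It serves the increment formula for weak derivatives and the
  weak Duhamel formula.\<close>

lemma pair_integrable_L2:
  fixes Z :: "real \<Rightarrow> real \<Rightarrow> 'b :: {banach, second_countable_topology}"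
  assumes Z: "case_prod Z \<in> borel_measurable (borel :: (real \<times> real) measure)"
    and le: "\<And>s x. norm (Z s x) \<le> indicator {a..b} s * (norm (Y s x) * norm (\<phi> x))"
    and Y: "\<And>s. s \<in> {a..b} \<Longrightarrow> Y s \<in> L2" "\<And>s. s \<in> {a..b} \<Longrightarrow> l2norm (Y s) \<le> K"
    and \<phi>: "\<phi> \<in> L2"
  shows "integrable (lborel \<Otimes>\<^sub>M lborel) (case_prod Z)"
proof (rule integrableI_bounded)
  note [measurable] = pair_measurable_lborel[OF Z]
  show "case_prod Z \<in> borel_measurable (lborel \<Otimes>\<^sub>M lborel)" by measurable
  have "(\<integral>\<^sup>+p. ennreal (norm (case_prod Z p)) \<partial>(lborel \<Otimes>\<^sub>M lborel))
      = (\<integral>\<^sup>+s. (\<integral>\<^sup>+x. ennreal (norm (Z s x)) \<partial>lborel) \<partial>lborel)"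
    by (subst lborel.nn_integral_fst[symmetric]) simp_all
  also have "\<dots> \<le> (\<integral>\<^sup>+s. ennreal (\<bar>K\<bar> * l2norm \<phi>) * indicator {a..b} s \<partial>lborel)"
  proof (intro nn_integral_mono)
    fix s
    show "(\<integral>\<^sup>+x. ennreal (norm (Z s x)) \<partial>lborel) \<le> ennreal (\<bar>K\<bar> * l2norm \<phi>) * indicator {a..b} s"
    proof (cases "s \<in> {a..b}")
      case True
      have "(\<integral>\<^sup>+x. ennreal (norm (Z s x)) \<partial>lborel) \<le> (\<integral>\<^sup>+x. ennreal (norm (Y s x) * norm (\<phi> x)) \<partial>lborel)"
        using le[of s] True by (intro nn_integral_mono ennreal_leI) simp
      also have "\<dots> = ennreal (\<integral>x. norm (Y s x) * norm (\<phi> x) \<partial>lborel)"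
        by (rule nn_integral_eq_integral) (use L2_norm_mult_integrable[OF Y(1)[OF True] \<phi>] in auto)
      also have "\<dots> \<le> ennreal (\<bar>K\<bar> * l2norm \<phi>)"
      proof (intro ennreal_leI)
        have "l2norm (Y s) * l2norm \<phi> \<le> \<bar>K\<bar> * l2norm \<phi>"
          using Y(2)[OF True] by (intro mult_right_mono) auto
        then show "(\<integral>x. norm (Y s x) * norm (\<phi> x) \<partial>lborel) \<le> \<bar>K\<bar> * l2norm \<phi>"
          using L2_norm_mult_le[OF Y(1)[OF True] \<phi>] by linarith
      qed
      finally show ?thesis using True by simp
    next
      case False
      then have "norm (Z s x) = 0" for x using le[of s x] by (metis indicator_simps(2) mult_zero_left norm_le_zero_iff norm_zero)
      then show ?thesis by simp
    qed
  qed
  also have "\<dots> < \<infinity>"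
    by (simp add: nn_integral_cmult ennreal_mult_less_top emeasure_lborel_Icc_eq)
  finally show "(\<integral>\<^sup>+p. ennreal (norm (case_prod Z p)) \<partial>(lborel \<Otimes>\<^sub>M lborel)) < \<infinity>" .
qed

text \<open>The argument is \<open>x - X n\<close> because a forward shift of \<open>f\<close>
  becomes, after a change of variables, a backward shift of the test function. The mean value
  inequality bounds these quotients uniformly on one compact interval.\<close>

lemma difference_quotient_test_fun:
  assumes t: "test_fun \<phi>" and f: "f \<in> L2" and X: "X \<longlonglongrightarrow> 0" "\<And>n. X n \<noteq> (0::real)"
  shows "(\<lambda>n. \<integral>x. ((\<phi> (x - X n) - \<phi> x) / X n) *\<^sub>R f x \<partial>lborel) \<longlonglongrightarrow> (\<integral>x. - deriv \<phi> x *\<^sub>R f x \<partial>lborel)"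
proof -
  obtain R where R: "0 < R" "continuous_on UNIV \<phi>" "continuous_on UNIV (deriv \<phi>)"
    and d: "\<And>x. (\<phi> has_real_derivative deriv \<phi> x) (at x)"
    and z: "\<And>x. R < \<bar>x\<bar> \<Longrightarrow> \<phi> x = 0" "\<And>x. R < \<bar>x\<bar> \<Longrightarrow> deriv \<phi> x = 0"
    using test_funD[OF t] by metis
  have [measurable]: "f \<in> borel_measurable borel" "\<phi> \<in> borel_measurable borel" "deriv \<phi> \<in> borel_measurable borel"
    using L2_measurable[OF f] R by (auto intro: borel_measurable_continuous_onI)
  obtain K where K: "0 < K" "\<And>x. \<bar>deriv \<phi> x\<bar> \<le> K * indicator {-R..R} x"
    using compact_support_bounded[OF R(3) z(2)] by blast
  have K': "norm (deriv \<phi> x) \<le> K" for x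
    using order_trans[OF K(2)[of x], of K] K(1) by (auto simp: indicator_def split: if_splits)
  have "Bseq X" using X(1) by (intro convergent_imp_Bseq) (auto simp: convergent_def)
  then obtain b where b: "\<And>n. \<bar>X n\<bar> \<le> b" by (auto simp: Bseq_def)
  define \<psi> where "\<psi> n x = (\<phi> (x - X n) - \<phi> x) / X n" for n x
  have [measurable]: "\<psi> n \<in> borel_measurable borel" for n unfolding \<psi>_def by measurable
  have le: "\<bar>\<psi> n x\<bar> \<le> K * indicator {-(R+b)..R+b} x" for n x
  proof (cases "x \<in> {-(R+b)..R+b}")
    case True
    have "norm (\<phi> (x - X n) - \<phi> x) \<le> K * norm (x - X n - x)"
      by (rule field_differentiable_bound[of UNIV \<phi> "deriv \<phi>"]) (use d K' in \<open>auto\<close>)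
    then show ?thesis using True X(2)[of n] by (simp add: \<psi>_def pos_divide_le_eq)
  next
    case False
    then have "R < \<bar>x - X n\<bar>" "R < \<bar>x\<bar>" using b[of n] by (auto simp: abs_if split: if_splits)
    then show ?thesis using z False by (simp add: \<psi>_def)
  qed
  have "(\<lambda>n. \<integral>x. \<psi> n x *\<^sub>R f x \<partial>lborel) \<longlonglongrightarrow> (\<integral>x. - deriv \<phi> x *\<^sub>R f x \<partial>lborel)"
  proof (rule integral_dominated_convergence[where w="\<lambda>x. norm ((K * indicator {-(R+b)..R+b} x) *\<^sub>R f x)"])
    show "integrable lborel (\<lambda>x. norm ((K * indicator {-(R+b)..R+b} x) *\<^sub>R f x))"
      by (intro integrable_norm L2_mult_integrable(1)[OF f, where K=K]) (use K(1) in auto)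
    show "AE x in lborel. (\<lambda>n. \<psi> n x *\<^sub>R f x) \<longlonglongrightarrow> - deriv \<phi> x *\<^sub>R f x"
    proof (intro AE_I2 tendsto_scaleR tendsto_const)
      fix x
      have "((\<lambda>h. (\<phi> (x + h) - \<phi> x) / h) \<longlongrightarrow> deriv \<phi> x) (at 0)" using d[of x] by (simp add: DERIV_def)
      moreover have "filterlim (\<lambda>n. - X n) (at 0) sequentially"
        using X tendsto_minus[OF X(1)] by (auto simp: filterlim_at)
      ultimately have "(\<lambda>n. (\<phi> (x + - X n) - \<phi> x) / (- X n)) \<longlonglongrightarrow> deriv \<phi> x"
        by (rule filterlim_compose)
      from tendsto_minus[OF this] show "(\<lambda>n. \<psi> n x) \<longlonglongrightarrow> - deriv \<phi> x" by (simp add: \<psi>_def)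
    qed
    show "AE x in lborel. norm (\<psi> n x *\<^sub>R f x) \<le> norm ((K * indicator {-(R+b)..R+b} x) *\<^sub>R f x)" for n
    proof (rule AE_I2)
      fix x show "norm (\<psi> n x *\<^sub>R f x) \<le> norm ((K * indicator {-(R+b)..R+b} x) *\<^sub>R f x)"
        using order_trans[OF le abs_ge_self] unfolding norm_scaleR by (intro mult_right_mono) auto
    qed
  qed measurable
  then show ?thesis by (simp add: \<psi>_def)
qed

text \<open>The pairing of the quotients with a test function has two limits that must agree: the
  pairing with \<open>w\<close> by L2 convergence, and minus the pairing of \<open>f\<close> with
  \<open>deriv \<phi>\<close> once the shift is moved onto \<open>\<phi>\<close>.\<close>

lemma weak_deriv_difference_quotients:
  assumes f: "f \<in> L2" and w: "w \<in> L2" and X: "X \<longlonglongrightarrow> 0" "\<And>n. X n \<noteq> (0::real)"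
    and lim: "(\<lambda>n. l2norm (\<lambda>x. (1 / X n) *\<^sub>R (f (x + X n) - f x) - w x)) \<longlonglongrightarrow> 0"
  shows "weak_deriv f w"
  unfolding weak_deriv_def
proof (intro allI impI)
  fix \<phi> assume t: "test_fun \<phi>"
  obtain R where R: "0 < R" "continuous_on UNIV \<phi>" "\<And>x. R < \<bar>x\<bar> \<Longrightarrow> \<phi> x = 0"
    using test_funD[OF t] by metis
  have \<phi>m: "\<phi> \<in> borel_measurable borel" using R by (auto intro: borel_measurable_continuous_onI)
  obtain K where K: "\<And>x. \<bar>\<phi> x\<bar> \<le> K * indicator {-R..R} x"
    using compact_support_bounded[OF R(2,3)] by blast
  note m = L2_mult_integrable[OF _ \<phi>m K]
  define q where "q n x = (1 / X n) *\<^sub>R (f (x + X n) - f x)" for n x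
  have q: "q n \<in> L2" for n unfolding q_def by (intro L2_scaleR L2_diff L2_translate f)
  have eq: "(\<integral>x. \<phi> x *\<^sub>R q n x \<partial>lborel) = (\<integral>x. ((\<phi> (x - X n) - \<phi> x) / X n) *\<^sub>R f x \<partial>lborel)" for n
  proof -
    have i: "integrable lborel (\<lambda>x. \<phi> x *\<^sub>R f (x + X n))" "integrable lborel (\<lambda>x. \<phi> x *\<^sub>R f x)"
      by (intro m(1) L2_translate f)+
    have i': "integrable lborel (\<lambda>x. \<phi> (x - X n) *\<^sub>R f x)"
      using lborel_integrable_real_affine[OF i(1), of 1 "- X n"] by (simp add: algebra_simps)
    have "(\<integral>x. \<phi> x *\<^sub>R q n x \<partial>lborel) = (1 / X n) *\<^sub>R ((\<integral>x. \<phi> x *\<^sub>R f (x + X n) \<partial>lborel) - (\<integral>x. \<phi> x *\<^sub>R f x \<partial>lborel))"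
      unfolding q_def by (subst Bochner_Integration.integral_diff[OF i, symmetric])
        (simp add: scaleR_diff_right mult.commute flip: integral_scaleR_right)
    also have "(\<integral>x. \<phi> x *\<^sub>R f (x + X n) \<partial>lborel) = (\<integral>x. \<phi> (x - X n) *\<^sub>R f x \<partial>lborel)"
      using lborel_integral_real_affine[of 1 "\<lambda>x. \<phi> x *\<^sub>R f (x + X n)" "- X n"] by (simp add: algebra_simps)
    also have "(1 / X n) *\<^sub>R (\<dots> - (\<integral>x. \<phi> x *\<^sub>R f x \<partial>lborel)) = (\<integral>x. ((\<phi> (x - X n) - \<phi> x) / X n) *\<^sub>R f x \<partial>lborel)"
      by (subst Bochner_Integration.integral_diff[OF i' i(2), symmetric])
        (simp add: scaleR_diff_left scaleR_diff_right diff_divide_distrib flip: integral_scaleR_right)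
    finally show ?thesis .
  qed
  have "(\<lambda>n. (\<integral>x. \<phi> x *\<^sub>R q n x \<partial>lborel) - (\<integral>x. \<phi> x *\<^sub>R w x \<partial>lborel)) \<longlonglongrightarrow> 0"
  proof (rule tendsto_0_le[of "\<lambda>n. l2norm (\<lambda>x. q n x - w x)" _ _ "l2norm (\<lambda>x. (\<phi> x, 0::real))"])
    show "(\<lambda>n. l2norm (\<lambda>x. q n x - w x)) \<longlonglongrightarrow> 0" using lim by (simp add: q_def)
    have "(\<integral>x. \<phi> x *\<^sub>R q n x \<partial>lborel) - (\<integral>x. \<phi> x *\<^sub>R w x \<partial>lborel) = (\<integral>x. \<phi> x *\<^sub>R (q n x - w x) \<partial>lborel)" for n
      by (subst Bochner_Integration.integral_diff[symmetric]) (simp_all add: m(1) q w scaleR_diff_right)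
    then show "\<forall>\<^sub>F n in sequentially. norm ((\<integral>x. \<phi> x *\<^sub>R q n x \<partial>lborel) - (\<integral>x. \<phi> x *\<^sub>R w x \<partial>lborel))
        \<le> norm (l2norm (\<lambda>x. q n x - w x)) * l2norm (\<lambda>x. (\<phi> x, 0::real))"
      using m(3)[OF L2_diff[OF q w]] by (simp add: mult.commute)
  qed
  then have "(\<lambda>n. \<integral>x. \<phi> x *\<^sub>R q n x \<partial>lborel) \<longlonglongrightarrow> (\<integral>x. \<phi> x *\<^sub>R w x \<partial>lborel)" by (rule LIM_zero_cancel)
  with difference_quotient_test_fun[OF t f X] have "(\<integral>x. \<phi> x *\<^sub>R w x \<partial>lborel) = (\<integral>x. - deriv \<phi> x *\<^sub>R f x \<partial>lborel)"
    unfolding eq by (rule LIMSEQ_unique[rotated])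
  then show "(\<integral>x. deriv \<phi> x *\<^sub>R f x \<partial>lborel) = - (\<integral>x. \<phi> x *\<^sub>R w x \<partial>lborel)" by simp
qed

text \<open>An antiderivative of a test function need not have compact support, but its difference
  with a translate does. Testing a weak derivative against that difference produces increments of
  the function itself.\<close>

lemma test_fun_shift_primitive:
  assumes t: "test_fun \<psi>"
  obtains \<Phi> where "test_fun \<Phi>" "\<And>x. deriv \<Phi> x = \<psi> x - \<psi> (x - r)"
    "\<And>x. \<Phi> x = (LINT \<theta>:{0..1}|lborel. r * \<psi> (x - r * \<theta>))"
proof -
  obtain D R where D: "D 0 = \<psi>" "\<And>k x. (D k has_real_derivative D (Suc k) x) (at x)"
    and R: "\<And>x. \<bar>x\<bar> > R \<Longrightarrow> \<psi> x = 0"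
    using t unfolding test_fun_def by blast
  have c: "continuous_on S \<psi>" for S
    using D(2)[of 0] DERIV_isCont by (auto simp: D(1) intro!: continuous_at_imp_continuous_on)
  have "\<exists>A. \<forall>x :: real. - \<infinity> < ereal x \<longrightarrow> ereal x < \<infinity> \<longrightarrow> (A has_vector_derivative \<psi> x) (at x)"
    by (rule einterval_antiderivative) (use c[of UNIV] in \<open>auto simp: continuous_on_eq_continuous_at\<close>)
  then obtain A where A: "\<And>x. (A has_real_derivative \<psi> x) (at x)"
    by (auto simp: has_real_derivative_iff_has_vector_derivative)
  define \<Phi> where "\<Phi> x = A x - A (x - r)" for x
  \<comment> \<open>Beyond order 0 the derivatives of \<open>\<Phi>\<close> are those of
    \<open>\<psi>\<close> minus their translates, with the index lowered by one.\<close>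
  define E where "E k = (case k of 0 \<Rightarrow> \<Phi> | Suc j \<Rightarrow> (\<lambda>x. D j x - D j (x - r)))" for k
  have sh: "((\<lambda>x. f (x - r)) has_real_derivative f') (at x)" if "(f has_real_derivative f') (at (x - r))" for f f' x
  proof -
    have "((\<lambda>x. x - r) has_real_derivative 1) (at x)" by (auto intro!: derivative_eq_intros)
    from DERIV_chain2[where f=f and g="\<lambda>x. x - r", OF that this] show ?thesis by simp
  qed
  have E: "(E k has_real_derivative E (Suc k) x) (at x)" for k x
  proof (cases k)
    case 0
    show ?thesis unfolding 0 E_def \<Phi>_def by (auto intro!: derivative_intros A sh simp: D(1))
  next
    case (Suc j)
    show ?thesis unfolding Suc E_def by (auto intro!: derivative_intros D(2) sh)
  qed
  \<comment> \<open>Beyond R + |r| the whole segment from x - r to x misses the support of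
    \<open>\<psi>\<close>, so \<open>A\<close> takes equal values at its ends.\<close>
  have z: "\<Phi> x = 0" if "\<bar>x\<bar> > R + \<bar>r\<bar>" for x
  proof -
    have "\<psi> y = 0" if "y \<in> closed_segment (x - r) x" for y
    proof (rule R)
      from that have "\<bar>x - y\<bar> \<le> \<bar>r\<bar>" by (auto simp: closed_segment_eq_real_ivl split: if_splits)
      then show "R < \<bar>y\<bar>" using \<open>\<bar>x\<bar> > R + \<bar>r\<bar>\<close> by linarith
    qed
    then have "norm (A x - A (x - r)) \<le> 0 * norm (x - (x - r))"
    proof (intro field_differentiable_bound[of "closed_segment (x - r) x" A \<psi>])
      show "(A has_field_derivative \<psi> y) (at y within closed_segment (x - r) x)" for y
        using A by (rule DERIV_subset) simp
    qed auto
    then show ?thesis by (simp add: \<Phi>_def)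
  qed
  have "test_fun \<Phi>"
    unfolding test_fun_def using E z by (intro conjI exI[of _ E] exI[of _ "R + \<bar>r\<bar>"]) (auto simp: E_def)
  moreover have "deriv \<Phi> x = \<psi> x - \<psi> (x - r)" for x
    by (rule DERIV_imp_deriv) (use E[of 0 x] in \<open>simp add: E_def D(1)\<close>)
  moreover have "\<Phi> x = (LINT \<theta>:{0..1}|lborel. r * \<psi> (x - r * \<theta>))" for x
  proof -
    have "((\<lambda>\<theta>. - A (x - r * \<theta>)) has_vector_derivative r * \<psi> (x - r * \<theta>)) (at \<theta> within {0..1})" for \<theta>
      unfolding has_real_derivative_iff_has_vector_derivative[symmetric]
    proof -
      have "((\<lambda>\<theta>. x - r * \<theta>) has_real_derivative - r) (at \<theta> within {0..1})"
        by (auto intro!: derivative_eq_intros)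
      from DERIV_minus[OF DERIV_chain2[where f=A, OF A this]]
      show "((\<lambda>\<theta>. - A (x - r * \<theta>)) has_real_derivative r * \<psi> (x - r * \<theta>)) (at \<theta> within {0..1})"
        by (simp add: mult.commute)
    qed
    then have "(\<integral>\<theta>. indicator {0..1} \<theta> *\<^sub>R (r * \<psi> (x - r * \<theta>)) \<partial>lborel) = - A (x - r * 1) - - A (x - r * 0)"
      by (intro integral_FTC_Icc continuous_intros continuous_on_compose2[OF c]) auto
    moreover have "\<Phi> x = - A (x - r * 1) - - A (x - r * 0)" by (simp add: \<Phi>_def)
    ultimately show ?thesis by (simp only: set_lebesgue_integral_def)
  qed
  ultimately show thesis using that by blast
qed

section \<open>Increments and the continuous representative of an H1 function\<close>

lemma L2_shift_measurable:
  assumes [measurable]: "g \<in> borel_measurable (borel :: real measure)"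
  shows "(\<lambda>(\<theta>, x). r *\<^sub>R g (x + r * \<theta>) :: real \<times> real) \<in> borel_measurable (borel :: (real \<times> real) measure)"
proof -
  have [measurable]: "(\<lambda>p :: real \<times> real. snd p + r * fst p) \<in> borel_measurable borel"
    by (intro borel_measurable_continuous_onI continuous_intros)
  show ?thesis by (simp add: split_beta')
qed

lemma L2_shift_average:
  assumes g: "g \<in> L2"
  shows "(\<lambda>x. LINT \<theta>:{0..1}|lborel. r *\<^sub>R g (x + r * \<theta>)) \<in> L2"
proof -
  note [measurable] = L2_measurable[OF g]
  show ?thesis
    by (rule L2_Minkowski(1)[where \<kappa>="\<lambda>_. \<bar>r\<bar> * l2norm g + 1"])
       (use g in \<open>auto simp: L2_translate l2norm_scaleR add_nonneg_pos intro!: L2_scaleR L2_shift_measurable borel_integrable_atLeastAtMost' continuous_intros\<close>)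
qed

text \<open>Test both sides with \<open>\<psi>\<close>. Fubini and a translation in x turn the right
  side into the pairing of \<open>g\<close> with \<open>\<Phi>\<close>, whose derivative is
  \<open>\<psi> x - \<psi> (x - r)\<close>; the weak derivative moves this onto \<open>f\<close>,
  where it becomes the increment tested with \<open>\<psi>\<close>.\<close>

lemma weak_deriv_increment:
  assumes f: "f \<in> L2" and g: "g \<in> L2" and w: "weak_deriv f g"
  shows "AE x in lborel. f (x + r) - f x = (LINT \<theta>:{0..1}|lborel. r *\<^sub>R g (x + r * \<theta>))"
proof -
  define G where "G x = (LINT \<theta>:{0..1}|lborel. r *\<^sub>R g (x + r * \<theta>))" for x
  have G: "G \<in> L2" unfolding G_def by (rule L2_shift_average[OF g])
  have fr: "(\<lambda>x. f (x + r) - f x) \<in> L2" by (intro L2_diff L2_translate f)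
  note [measurable] = L2_measurable[OF f] L2_measurable[OF g]
  have "AE x in lborel. f (x + r) - f x - G x = 0"
  proof (rule fundamental_lemma)
    show "set_integrable lborel {a..b} (\<lambda>x. f (x + r) - f x - G x)" for a b
      by (intro L2_interval_integrable L2_diff[OF fr G])
    show "(\<lambda>x. f (x + r) - f x - G x) \<in> borel_measurable borel"
      by (rule L2_measurable[OF L2_diff[OF fr G]])
    fix \<psi> assume t: "test_fun \<psi>"
    obtain \<Phi> where \<Phi>: "test_fun \<Phi>" "\<And>x. deriv \<Phi> x = \<psi> x - \<psi> (x - r)"
      "\<And>x. \<Phi> x = (LINT \<theta>:{0..1}|lborel. r * \<psi> (x - r * \<theta>))"
      using test_fun_shift_primitive[OF t] by metis
    obtain R where R: "0 < R" "continuous_on UNIV \<psi>" "\<And>x. R < \<bar>x\<bar> \<Longrightarrow> \<psi> x = 0"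
      using test_funD[OF t] by metis
    obtain K where K: "\<And>x. \<bar>\<psi> x\<bar> \<le> K * indicator {-R..R} x"
      using compact_support_bounded[OF R(2,3)] by blast
    have \<psi>m[measurable]: "\<psi> \<in> borel_measurable borel" by (rule borel_measurable_continuous_onI[OF R(2)])
    note \<psi>2 = L2_mult_integrable(2)[OF f \<psi>m K]
    have c1: "(\<lambda>p :: real \<times> real. snd p + r * fst p) \<in> borel_measurable borel"
      and c2: "(\<lambda>p :: real \<times> real. snd p - r * fst p) \<in> borel_measurable borel"
      and c3: "(\<lambda>p :: real \<times> real. snd p) \<in> borel_measurable borel"
      and c4: "(\<lambda>p :: real \<times> real. fst p) \<in> borel_measurable borel"
      by (intro borel_measurable_continuous_onI continuous_intros)+
    note [measurable] = c1 c2 c3 c4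
    define Z1 where "Z1 \<theta> x = indicator {0..1} \<theta> *\<^sub>R (\<psi> x *\<^sub>R (r *\<^sub>R g (x + r * \<theta>)))" for \<theta> x
    define Z2 where "Z2 \<theta> x = indicator {0..1} \<theta> *\<^sub>R ((r * \<psi> (x - r * \<theta>)) *\<^sub>R g x)" for \<theta> x
    have Z1: "integrable (lborel \<Otimes>\<^sub>M lborel) (case_prod Z1)"
    proof (rule pair_integrable_L2[where Y="\<lambda>\<theta> x. r *\<^sub>R g (x + r * \<theta>)" and \<phi>="\<lambda>x. (\<psi> x, 0::real)" and K="\<bar>r\<bar> * l2norm g" and a=0 and b=1])
      show "case_prod Z1 \<in> borel_measurable borel"
        unfolding Z1_def split_beta' by measurable
    qed (use g \<psi>2 in \<open>auto simp: Z1_def L2_translate l2norm_scaleR abs_mult mult_ac intro!: L2_scaleR\<close>)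
    have Z2: "integrable (lborel \<Otimes>\<^sub>M lborel) (case_prod Z2)"
    proof (rule pair_integrable_L2[where Y="\<lambda>\<theta> x. r *\<^sub>R (\<psi> (x + - (r * \<theta>)), 0::real)" and \<phi>=g and K="\<bar>r\<bar> * l2norm (\<lambda>x. (\<psi> x, 0::real))" and a=0 and b=1])
      show "case_prod Z2 \<in> borel_measurable borel"
        unfolding Z2_def split_beta' by measurable
      show "(\<lambda>x. r *\<^sub>R (\<psi> (x + - (r * \<theta>)), 0::real)) \<in> L2" for \<theta>
        by (intro L2_scaleR L2_translate(1)[OF \<psi>2])
      show "l2norm (\<lambda>x. r *\<^sub>R (\<psi> (x + - (r * \<theta>)), 0::real)) \<le> \<bar>r\<bar> * l2norm (\<lambda>x. (\<psi> x, 0::real))" for \<theta>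
        unfolding l2norm_scaleR using L2_translate(2)[OF \<psi>2, of "- (r * \<theta>)"] by simp
    qed (use g in \<open>auto simp: Z2_def abs_mult\<close>)
    have "(\<integral>x. \<psi> x *\<^sub>R G x \<partial>lborel) = (\<integral>x. (\<integral>\<theta>. Z1 \<theta> x \<partial>lborel) \<partial>lborel)"
      by (rule Bochner_Integration.integral_cong)
         (auto simp: G_def Z1_def set_lebesgue_integral_def mult_ac simp flip: integral_scaleR_right)
    also have "\<dots> = (\<integral>\<theta>. (\<integral>x. Z1 \<theta> x \<partial>lborel) \<partial>lborel)"
      by (rule lborel_pair.Fubini_integral[OF Z1])
    also have "\<dots> = (\<integral>\<theta>. (\<integral>x. Z2 \<theta> x \<partial>lborel) \<partial>lborel)"
    proof (rule Bochner_Integration.integral_cong[OF refl])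
      fix \<theta> show "(\<integral>x. Z1 \<theta> x \<partial>lborel) = (\<integral>x. Z2 \<theta> x \<partial>lborel)"
        using lborel_integral_real_affine[of 1 "Z1 \<theta>" "- (r * \<theta>)"]
        by (simp add: Z1_def Z2_def algebra_simps)
    qed
    also have "\<dots> = (\<integral>x. (\<integral>\<theta>. Z2 \<theta> x \<partial>lborel) \<partial>lborel)"
      by (rule lborel_pair.Fubini_integral[OF Z2, symmetric])
    also have "\<dots> = (\<integral>x. \<Phi> x *\<^sub>R g x \<partial>lborel)"
    proof (rule Bochner_Integration.integral_cong[OF refl])
      fix x
      have "integrable lborel (\<lambda>\<theta>. indicator {0..1} \<theta> *\<^sub>R (r * \<psi> (x - r * \<theta>)))"
        unfolding set_integrable_def[symmetric]
        by (intro borel_integrable_atLeastAtMost' continuous_intros continuous_on_compose2[OF R(2)]) auto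
      from integral_scaleR_left[OF this, of "g x"]
      show "(\<integral>\<theta>. Z2 \<theta> x \<partial>lborel) = \<Phi> x *\<^sub>R g x"
        by (simp only: Z2_def \<Phi>(3) set_lebesgue_integral_def real_scaleR_def scaleR_scaleR)
    qed
    also have "\<dots> = - (\<integral>x. deriv \<Phi> x *\<^sub>R f x \<partial>lborel)"
      using w \<Phi>(1) by (simp add: weak_deriv_def)
    also have "(\<integral>x. deriv \<Phi> x *\<^sub>R f x \<partial>lborel) = (\<integral>x. \<psi> x *\<^sub>R f x \<partial>lborel) - (\<integral>x. \<psi> x *\<^sub>R f (x + r) \<partial>lborel)"
    proof -
      have i: "integrable lborel (\<lambda>x. \<psi> x *\<^sub>R f (x + r))" "integrable lborel (\<lambda>x. \<psi> x *\<^sub>R f x)"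
        by (intro test_fun_integrable[OF t] L2_translate f)+
      have i': "integrable lborel (\<lambda>x. \<psi> (x - r) *\<^sub>R f x)"
        using lborel_integrable_real_affine[OF i(1), of 1 "- r"] by (simp add: algebra_simps)
      have "(\<integral>x. \<psi> x *\<^sub>R f (x + r) \<partial>lborel) = (\<integral>x. \<psi> (x - r) *\<^sub>R f x \<partial>lborel)"
        using lborel_integral_real_affine[of 1 "\<lambda>x. \<psi> x *\<^sub>R f (x + r)" "- r"] by (simp add: algebra_simps)
      then show ?thesis by (simp add: \<Phi>(2) scaleR_diff_left i i')
    qed
    finally have "(\<integral>x. \<psi> x *\<^sub>R G x \<partial>lborel) = (\<integral>x. \<psi> x *\<^sub>R f (x + r) \<partial>lborel) - (\<integral>x. \<psi> x *\<^sub>R f x \<partial>lborel)"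
      by simp
    then show "(\<integral>x. \<psi> x *\<^sub>R (f (x + r) - f x - G x) \<partial>lborel) = 0"
      by (simp add: scaleR_diff_right test_fun_integrable[OF t] L2_translate f G)
  qed
  then show ?thesis unfolding G_def by simp
qed

lemma L2_interval_lebesgue_integrable:
  "g \<in> L2 \<Longrightarrow> interval_lebesgue_integrable lborel (ereal a) (ereal b) g"
  unfolding interval_lebesgue_integrable_def
  by (auto intro!: set_integrable_subset[OF L2_interval_integrable[of g "min a b" "max a b"]])

text \<open>The average over [0, 1] treats every sign of \<open>r\<close> alike and has a fixed
  domain, which suits Minkowski and parameter integrals; the oriented integral is additive in its
  endpoints. The identity allows switching between the two.\<close>

lemma shift_average_eq_interval_integral:
  fixes g :: "real \<Rightarrow> real \<times> real" and x r :: real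
  shows "(LINT \<theta>:{0..1}|lborel. r *\<^sub>R g (x + r * \<theta>)) = (LBINT u=x..ereal (x + r). g u)"
proof -
  consider "r = 0" | "0 < r" | "r < 0" by linarith
  then show ?thesis
  proof cases
    case 1 then show ?thesis by (simp add: set_lebesgue_integral_def)
  next
    case 2
    have *: "indicator {x..x + r} (x + r * \<theta>) = (indicator {0..1} \<theta> :: real)" for \<theta>
      using 2 by (auto simp: indicator_def zero_le_mult_iff)
    show ?thesis
      using 2 lborel_integral_real_affine[of r "\<lambda>u. indicator {x..x + r} u *\<^sub>R g u" x]
      by (simp add: interval_integral_Icc set_lebesgue_integral_def * scaleR_left_commute flip: integral_scaleR_right)
  next
    case 3
    have *: "indicator {x + r..x} (x + r * \<theta>) = (indicator {0..1} \<theta> :: real)" for \<theta>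
      using 3 by (auto simp: indicator_def mult_le_cancel_left1 mult_le_0_iff)
    have "(LBINT u=x..ereal (x + r). g u) = - (LBINT u=ereal (x + r)..x. g u)" by (rule interval_integral_endpoints_reverse)
    then show ?thesis
      using 3 lborel_integral_real_affine[of r "\<lambda>u. indicator {x + r..x} u *\<^sub>R g u" x]
      by (simp add: interval_integral_Icc set_lebesgue_integral_def * scaleR_left_commute flip: integral_scaleR_right)
  qed
qed

lemma L2_interval_integral_add:
  fixes a b c :: real
  assumes "g \<in> L2"
  shows "(LBINT u=a..b. g u) + (LBINT u=b..c. g u) = (LBINT u=a..c. g u)"
  using interval_integral_sum[of "ereal a" "ereal b" "ereal c" g] L2_interval_lebesgue_integrable[OF assms]
  by (auto simp: min_def max_def)

text \<open>Cauchy-Schwarz against the indicator of the interval; for \<open>g\<close> a weak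
  derivative this is the Hoelder-1/2 estimate.\<close>

lemma L2_interval_integral_le:
  fixes x r :: real
  assumes g: "g \<in> L2"
  shows "norm (LBINT u=x..ereal (x + r). g u) \<le> sqrt \<bar>r\<bar> * l2norm g"
proof -
  have *: "norm (LBINT u:{a..b}. g u) \<le> sqrt (b - a) * l2norm g" if "a \<le> b" for a b
  proof -
    have "l2norm (\<lambda>x. (indicator {a..b} x, 0::real)) = sqrt (b - a)"
      using that by (simp add: l2norm_def power2_eq_square flip: indicator_inter_arith)
    moreover have "\<bar>indicator {a..b} x :: real\<bar> \<le> 1 * indicator {a..b} x" for x :: real by simp
    ultimately show ?thesis
      using L2_mult_integrable(3)[OF g, of "indicator {a..b}" 1 a b] by (simp add: set_lebesgue_integral_def)
  qed
  show ?thesis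
  proof (cases "0 \<le> r")
    case True
    then show ?thesis using *[of x "x + r"] by (simp add: interval_integral_Icc)
  next
    case False
    then show ?thesis using *[of "x + r" x]
      by (subst interval_integral_endpoints_reverse) (simp add: interval_integral_Icc)
  qed
qed

text \<open>The increment formula holds for almost every \<open>x\<close> and every \<open>r\<close>; Fubini yields a base point
  for which it holds at almost every \<open>r\<close>, and there its right-hand side defines the representative.\<close>

lemma H1_representative:
  assumes f: "f \<in> L2" and g: "g \<in> L2" and w: "weak_deriv f g"
  obtains F where "AE x in lborel. f x = F x"
    and "\<And>x r. F (x + r) - F x = (LINT \<theta>:{0..1}|lborel. r *\<^sub>R g (x + r * \<theta>))"
proof -
  note [measurable] = L2_measurable[OF f] L2_measurable[OF g]
  define G where "G x r = (LINT \<theta>:{0..1}|lborel. r *\<^sub>R g (x + r * \<theta>))" for x r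
  have [measurable]: "(\<lambda>p. G (snd p) (fst p)) \<in> borel_measurable (lborel \<Otimes>\<^sub>M lborel)"
    unfolding G_def set_lebesgue_integral_def
    by (rule lborel.borel_measurable_lebesgue_integral) measurable
  have [measurable]: "G x \<in> borel_measurable borel" for x
    using measurable_Pair1[of "\<lambda>p. G (snd p) (fst p)" lborel lborel borel x] by simp
  have "AE r in lborel. AE x in lborel. f (x + r) - f x = G x r"
    unfolding G_def by (intro AE_I2 weak_deriv_increment f g w)
  then have "AE x in lborel. AE r in lborel. f (x + r) - f x = G x r"
    by (subst (asm) lborel_pair.AE_commute) measurable
  then have "\<exists>x. AE r in lborel. f (x + r) - f x = G x r"
    by (rule eventually_happens'[rotated]) (simp add: trivial_limit_def AE_iff_null null_sets_def)
  then obtain x0 where x0: "AE r in lborel. f (x0 + r) - f x0 = G x0 r" by blast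
  define F where "F x = f x0 + G x0 (x - x0)" for x
  have "AE x in lborel. f (x0 + (- x0 + 1 * x)) - f x0 = G x0 (- x0 + 1 * x)"
    by (rule AE_borel_affine[where P="\<lambda>r. f (x0 + r) - f x0 = G x0 r", OF _ _ x0]) (simp, measurable)
  then have "AE x in lborel. f x = F x"
    by eventually_elim (simp add: F_def algebra_simps)
  moreover have "F (x + r) - F x = G x r" for x r
    using L2_interval_integral_add[OF g, of x0 x "x + r"]
    unfolding F_def G_def shift_average_eq_interval_integral by (simp add: algebra_simps)
  ultimately show thesis using that unfolding G_def by blast
qed

section \<open>The saturable nonlinearity\<close>

text \<open>Compactness bounds \<open>D k\<close> on [0, 1]; for larger s the decay of order
  \<alpha> + k in r = sqrt s absorbs the factor \<open>r ^ k\<close>. That factor is the one met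
  when the radial function N(|y|^2) is differentiated k times.\<close>

lemma saturable_deriv_bound:
  assumes D: "smooth_nonneg N D" and \<alpha>: "0 < \<alpha>"
    and M: "\<And>r. 1 \<le> r \<Longrightarrow> \<bar>D k (r\<^sup>2) - (if k = 0 then Ninf else 0)\<bar> \<le> M * r powr (- (\<alpha> + real k))"
  shows "\<exists>m. \<forall>s\<ge>0. \<bar>D k s\<bar> \<le> m \<and> \<bar>D k s\<bar> * sqrt s ^ k \<le> m"
proof -
  have "continuous_on {0..1} (D k)"
  proof (rule continuous_on_subset)
    show "continuous_on {0..} (D k)"
      using D unfolding smooth_nonneg_def
      by (auto intro!: DERIV_continuous_on)
  qed auto
  then have "compact (D k ` {0..1})" by (rule compact_continuous_image) simp
  then obtain K where K: "\<And>s. s \<in> {0..1} \<Longrightarrow> \<bar>D k s\<bar> \<le> K"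
    using compact_imp_bounded bounded_iff by (metis imageI real_norm_def)
  define m where "m = \<bar>K\<bar> + \<bar>M\<bar> + \<bar>Ninf\<bar>"
  have "\<bar>D k s\<bar> \<le> m \<and> \<bar>D k s\<bar> * sqrt s ^ k \<le> m" if "0 \<le> s" for s
  proof (cases "s \<le> 1")
    case True
    then have "\<bar>D k s\<bar> \<le> \<bar>K\<bar>" using K[of s] that by auto
    moreover have "\<bar>D k s\<bar> * sqrt s ^ k \<le> \<bar>D k s\<bar> * 1"
      using True that by (intro mult_left_mono power_le_one) auto
    ultimately show ?thesis unfolding m_def by linarith
  next
    case False
    define r where "r = sqrt s"
    have r: "1 \<le> r" "r\<^sup>2 = s" using False that by (auto simp: r_def)
    have "\<bar>D k s\<bar> * r ^ k \<le> m"
    proof (cases "k = 0")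
      case True
      have "M * r powr - \<alpha> \<le> \<bar>M\<bar> * 1"
        using \<alpha> r powr_mono[of "-\<alpha>" 0 r] by (intro mult_mono) auto
      then show ?thesis using M[OF r(1)] True r(2) by (simp add: m_def)
    next
      case False
      have "\<bar>D k s\<bar> * r ^ k \<le> M * r powr (- (\<alpha> + real k)) * r ^ k"
        using M[OF r(1)] False r by (intro mult_right_mono) auto
      also have "\<dots> = M * r powr - \<alpha>"
      proof -
        have "r powr (- (\<alpha> + real k)) * r ^ k = r powr (- (\<alpha> + real k) + real k)"
          using r unfolding powr_add using powr_realpow[of r k] by simp
        then show ?thesis by simp
      qed
      also have "\<dots> \<le> \<bar>M\<bar> * 1"
        using \<alpha> r powr_mono[of "-\<alpha>" 0 r] by (intro mult_mono) auto
      finally show ?thesis by (simp add: m_def)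
    qed
    moreover have "\<bar>D k s\<bar> * 1 \<le> \<bar>D k s\<bar> * r ^ k" using r by (intro mult_left_mono) auto
    ultimately show ?thesis by (simp add: r_def)
  qed
  then show ?thesis by blast
qed

text \<open>Exactly the quantities that control the first two derivatives of N(|y|^2): the gradient
  is 2 N' y, and the second derivative in direction w is 4 N'' (y.w)^2 + 2 N' |w|^2.\<close>

lemma saturable_bounds:
  assumes "saturable N"
  obtains D m where "smooth_nonneg N D" "0 < m"
    "\<And>s. 0 \<le> s \<Longrightarrow> \<bar>N s\<bar> \<le> m" "\<And>s. 0 \<le> s \<Longrightarrow> \<bar>D 1 s\<bar> \<le> m"
    "\<And>s. 0 \<le> s \<Longrightarrow> \<bar>D 1 s\<bar> * sqrt s \<le> m" "\<And>s. 0 \<le> s \<Longrightarrow> \<bar>D 2 s\<bar> * s \<le> m"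
proof -
  obtain D Ninf \<alpha> where D: "smooth_nonneg N D" and \<alpha>: "0 < \<alpha>"
    and M: "\<And>k. \<exists>M. \<forall>r\<ge>1. \<bar>D k (r\<^sup>2) - (if k = 0 then Ninf else 0)\<bar> \<le> M * r powr (- (\<alpha> + real k))"
    using assms unfolding saturable_def by blast
  have "\<exists>m. \<forall>s\<ge>0. \<bar>D k s\<bar> \<le> m \<and> \<bar>D k s\<bar> * sqrt s ^ k \<le> m" for k
    using saturable_deriv_bound[OF D \<alpha>, of k Ninf] M[of k] by blast
  then obtain m where m: "\<And>k s. 0 \<le> s \<Longrightarrow> \<bar>D k s\<bar> \<le> m k" "\<And>k s. 0 \<le> s \<Longrightarrow> \<bar>D k s\<bar> * sqrt s ^ k \<le> m k"
    by metis
  have D0: "D 0 = N" using D by (simp add: smooth_nonneg_def)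
  show thesis
  proof (rule that[OF D, of "\<bar>m 0\<bar> + \<bar>m 1\<bar> + \<bar>m 2\<bar> + 1"])
    fix s :: real assume s: "0 \<le> s"
    show "\<bar>N s\<bar> \<le> \<bar>m 0\<bar> + \<bar>m 1\<bar> + \<bar>m 2\<bar> + 1" using m(1)[OF s, of 0] D0 by simp
    show "\<bar>D 1 s\<bar> \<le> \<bar>m 0\<bar> + \<bar>m 1\<bar> + \<bar>m 2\<bar> + 1" using m(1)[OF s, of 1] by simp
    show "\<bar>D 1 s\<bar> * sqrt s \<le> \<bar>m 0\<bar> + \<bar>m 1\<bar> + \<bar>m 2\<bar> + 1" using m(2)[OF s, of 1] by simp
    show "\<bar>D 2 s\<bar> * s \<le> \<bar>m 0\<bar> + \<bar>m 1\<bar> + \<bar>m 2\<bar> + 1" using m(2)[OF s, of 2] s by simp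
  qed simp
qed

text \<open>Mean value estimates along the segment from \<open>y\<close> to \<open>y + w\<close>.
  The two terms of the second derivative along it contribute 4 m and 2 m, whence the constant 6
  m.\<close>

lemma radial_bounds:
  fixes N :: "real \<Rightarrow> real" and y w :: "'a :: real_inner"
  assumes D: "smooth_nonneg N D"
    and m1: "\<And>s. 0 \<le> s \<Longrightarrow> \<bar>D 1 s\<bar> \<le> m"
    and m2: "\<And>s. 0 \<le> s \<Longrightarrow> \<bar>D 1 s\<bar> * sqrt s \<le> m"
    and m3: "\<And>s. 0 \<le> s \<Longrightarrow> \<bar>D 2 s\<bar> * s \<le> m"
  shows "\<bar>N ((norm (y + w))\<^sup>2) - N ((norm y)\<^sup>2)\<bar> \<le> 2 * m * norm w"
    and "\<bar>2 * D 1 ((norm y)\<^sup>2) * inner y w\<bar> \<le> 2 * m * norm w"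
    and "\<bar>N ((norm (y + w))\<^sup>2) - N ((norm y)\<^sup>2) - 2 * D 1 ((norm y)\<^sup>2) * inner y w\<bar> \<le> 6 * m * (norm w)\<^sup>2"
proof -
  define q where "q \<theta> = (norm (y + \<theta> *\<^sub>R w))\<^sup>2" for \<theta>
  define q' where "q' \<theta> = 2 * inner (y + \<theta> *\<^sub>R w) w" for \<theta>
  have q0: "0 \<le> q \<theta>" for \<theta> by (simp add: q_def)
  have q: "(q has_real_derivative q' \<theta>) (at \<theta>)" for \<theta>
    unfolding q_def[abs_def] q'_def power2_norm_eq_inner
    by (auto intro!: derivative_eq_intros has_derivative_imp_has_field_derivative
        simp: inner_commute algebra_simps inner_add_left)
  have q': "(q' has_real_derivative 2 * (norm w)\<^sup>2) (at \<theta>)" for \<theta>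
    unfolding q'_def[abs_def] power2_norm_eq_inner inner_add_left inner_scaleR_left
    by (auto intro!: derivative_eq_intros)
  have Dq: "((\<lambda>\<theta>. D k (q \<theta>)) has_real_derivative D (Suc k) (q \<theta>) * q' \<theta>) (at \<theta>)" for k \<theta>
  proof -
    have "(D k has_real_derivative D (Suc k) (q \<theta>)) (at (q \<theta>) within {0..})"
      using D q0[of \<theta>] by (auto simp: smooth_nonneg_def)
    \<comment> \<open>\<open>D k\<close> is differentiable only from within \<open>{0..}\<close>;
      since \<open>q\<close> never leaves that set, the chain rule still yields a two-sided
      derivative in \<theta>.\<close>
    then have "(D k has_real_derivative D (Suc k) (q \<theta>)) (at (q \<theta>) within range q)"
      by (rule DERIV_subset) (use q0 in auto)
    from DERIV_image_chain[OF this q] show ?thesis by (simp add: o_def)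
  qed
  have q'le: "\<bar>q' \<theta>\<bar> \<le> 2 * (sqrt (q \<theta>) * norm w)" for \<theta>
    using Cauchy_Schwarz_ineq2[of "y + \<theta> *\<^sub>R w" w] by (simp add: q_def q'_def abs_mult)
  have D1: "\<bar>D 1 (q \<theta>) * q' \<theta>\<bar> \<le> 2 * m * norm w" for \<theta>
  proof -
    have "\<bar>D 1 (q \<theta>) * q' \<theta>\<bar> \<le> \<bar>D 1 (q \<theta>)\<bar> * (2 * (sqrt (q \<theta>) * norm w))"
      unfolding abs_mult by (intro mult_left_mono q'le) auto
    also have "\<dots> = 2 * (\<bar>D 1 (q \<theta>)\<bar> * sqrt (q \<theta>)) * norm w" by simp
    also have "\<dots> \<le> 2 * m * norm w" by (intro mult_right_mono mult_left_mono m2 q0) auto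
    finally show ?thesis .
  qed
  have D2: "\<bar>D 2 (q \<theta>) * q' \<theta> * q' \<theta> + D 1 (q \<theta>) * (2 * (norm w)\<^sup>2)\<bar> \<le> 6 * m * (norm w)\<^sup>2" for \<theta>
  proof -
    have "(q' \<theta>)\<^sup>2 \<le> (2 * (sqrt (q \<theta>) * norm w))\<^sup>2"
      using power_mono[OF q'le[of \<theta>] abs_ge_zero, of 2] by simp
    then have "\<bar>D 2 (q \<theta>)\<bar> * (q' \<theta>)\<^sup>2 \<le> \<bar>D 2 (q \<theta>)\<bar> * (2 * (sqrt (q \<theta>) * norm w))\<^sup>2"
      by (intro mult_left_mono) auto
    also have "\<dots> = 4 * (\<bar>D 2 (q \<theta>)\<bar> * q \<theta>) * (norm w)\<^sup>2"
      using q0[of \<theta>] by (simp add: power_mult_distrib)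
    also have "\<dots> \<le> 4 * m * (norm w)\<^sup>2" by (intro mult_right_mono mult_left_mono m3 q0) auto
    finally have 1: "\<bar>D 2 (q \<theta>) * q' \<theta> * q' \<theta>\<bar> \<le> 4 * m * (norm w)\<^sup>2"
      by (simp add: abs_mult power2_eq_square mult.assoc)
    have "\<bar>D 1 (q \<theta>) * (2 * (norm w)\<^sup>2)\<bar> = \<bar>D 1 (q \<theta>)\<bar> * (2 * (norm w)\<^sup>2)" by (simp add: abs_mult)
    also have "\<dots> \<le> m * (2 * (norm w)\<^sup>2)" by (intro mult_right_mono m1 q0) auto
    finally show ?thesis using 1 by (simp only: abs_le_iff) linarith
  qed
  have N: "N = D 0" using D by (simp add: smooth_nonneg_def)
  have "norm (D 0 (q 1) - D 0 (q 0)) \<le> 2 * m * norm w * norm (1 - 0 :: real)"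
    by (rule field_differentiable_bound[of UNIV "\<lambda>\<theta>. D 0 (q \<theta>)" "\<lambda>\<theta>. D (Suc 0) (q \<theta>) * q' \<theta>"])
       (use Dq D1 in auto)
  then show "\<bar>N ((norm (y + w))\<^sup>2) - N ((norm y)\<^sup>2)\<bar> \<le> 2 * m * norm w"
    by (simp add: q_def N)
  show "\<bar>2 * D 1 ((norm y)\<^sup>2) * inner y w\<bar> \<le> 2 * m * norm w"
    using D1[of 0] by (simp add: q_def q'_def mult_ac)
  define r where "r \<theta> = D 1 (q \<theta>) * q' \<theta>" for \<theta>
  have "(r has_real_derivative (D 2 (q \<theta>) * q' \<theta> * q' \<theta> + D 1 (q \<theta>) * (2 * (norm w)\<^sup>2))) (at \<theta>)" for \<theta>
    unfolding r_def[abs_def] using DERIV_mult[OF Dq[of 1] q'] by (simp add: numeral_2_eq_2 mult_ac add.commute)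
  then have rd: "\<bar>r \<theta> - r 0\<bar> \<le> 6 * m * (norm w)\<^sup>2 * \<bar>\<theta> - 0\<bar>" for \<theta>
    using field_differentiable_bound[of UNIV r "\<lambda>\<theta>. D 2 (q \<theta>) * q' \<theta> * q' \<theta> + D 1 (q \<theta>) * (2 * (norm w)\<^sup>2)"
       "6 * m * (norm w)\<^sup>2" \<theta> 0] D2 by auto
  \<comment> \<open>The mean value inequality is applied a second time, to the function minus its
    linear part, instead of Taylor's formula; hence 6 m without a factor 1/2.\<close>
  have "norm ((D 0 (q 1) - r 0 * 1) - (D 0 (q 0) - r 0 * 0)) \<le> 6 * m * (norm w)\<^sup>2 * norm (1 - 0 :: real)"
  proof (rule field_differentiable_bound[of "{0..1}" "\<lambda>\<theta>. D 0 (q \<theta>) - r 0 * \<theta>" "\<lambda>\<theta>. r \<theta> - r 0"])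
    fix \<theta> :: real assume \<theta>: "\<theta> \<in> {0..1}"
    show "((\<lambda>\<theta>. D 0 (q \<theta>) - r 0 * \<theta>) has_real_derivative r \<theta> - r 0) (at \<theta> within {0..1})"
      by (rule DERIV_subset[of _ _ _ UNIV]) (use Dq[of 0 \<theta>] in \<open>auto intro!: derivative_eq_intros simp: r_def\<close>)
    have "0 \<le> 6 * m * (norm w)\<^sup>2" using m1[of 0] by simp
    then have "6 * m * (norm w)\<^sup>2 * \<bar>\<theta>\<bar> \<le> 6 * m * (norm w)\<^sup>2 * 1"
      using \<theta> by (intro mult_left_mono) auto
    then show "norm (r \<theta> - r 0) \<le> 6 * m * (norm w)\<^sup>2" using rd[of \<theta>] by simp
  qed auto
  then show "\<bar>N ((norm (y + w))\<^sup>2) - N ((norm y)\<^sup>2) - 2 * D 1 ((norm y)\<^sup>2) * inner y w\<bar> \<le> 6 * m * (norm w)\<^sup>2"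
    by (simp add: q_def q'_def r_def N algebra_simps)
qed

text \<open>The skew matrix with rows (0, 1) and (-1, 0).\<close>

definition rot :: "real \<times> real \<Rightarrow> real \<times> real" where
  "rot y = (snd y, - fst y)"

lemma norm_rot [simp]: "norm (rot y) = norm y"
  by (simp add: rot_def norm_Pair norm_prod_def add.commute)

lemma bounded_linear_rot: "bounded_linear rot"
  unfolding rot_def by (intro bounded_linear_Pair bounded_linear_snd bounded_linear_minus bounded_linear_fst)

text \<open>The difference of values of \<open>N\<close> multiplies the bounded profile and not
  \<open>B\<close>, so bounds for the radial function turn directly into global bounds for
  \<open>Nstar\<close>.\<close>

lemma Nstar_eq:
  "Nstar N u v x B = N ((norm (u x, v x))\<^sup>2) *\<^sub>R rot B
    + (N ((norm ((u x, v x) + B))\<^sup>2) - N ((norm (u x, v x))\<^sup>2)) *\<^sub>R rot (u x, v x)"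
  by (cases B) (simp add: Nstar_def Let_def rot_def norm_Pair)

lemma Nstar_properties:
  assumes sat: "saturable N" and het: "heteroclinic_profile N c u v"
  obtains L C and A :: "real \<Rightarrow> real \<times> real \<Rightarrow> real \<times> real \<Rightarrow> real \<times> real"
  where "0 < L" "0 < C"
    and "continuous_on UNIV (\<lambda>(x, B). Nstar N u v x B)"
    and "\<And>x. Nstar N u v x 0 = 0"
    and "\<And>x B1 B2. norm (Nstar N u v x B1 - Nstar N u v x B2) \<le> L * norm (B1 - B2)"
    and "\<And>x B. bounded_linear (A x B)"
    and "\<And>x B w. norm (A x B w) \<le> L * norm w"
    and "\<And>x B w. norm (Nstar N u v x (B + w) - Nstar N u v x B - A x B w) \<le> C * (norm w)\<^sup>2"
proof -
  obtain D m where D: "smooth_nonneg N D" and m: "0 < m"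
    "\<And>s. 0 \<le> s \<Longrightarrow> \<bar>N s\<bar> \<le> m" "\<And>s. 0 \<le> s \<Longrightarrow> \<bar>D 1 s\<bar> \<le> m"
    "\<And>s. 0 \<le> s \<Longrightarrow> \<bar>D 1 s\<bar> * sqrt s \<le> m" "\<And>s. 0 \<le> s \<Longrightarrow> \<bar>D 2 s\<bar> * s \<le> m"
    using saturable_bounds[OF sat] by metis
  note rb = radial_bounds[OF D m(3-5)]
  obtain u' v' where uv: "\<And>x. (u has_real_derivative u' x) (at x)" "\<And>x. (v has_real_derivative v' x) (at x)"
    and bdd: "bounded (range u)" "bounded (range v)"
    using het unfolding heteroclinic_profile_def by blast
  have cuv: "continuous_on UNIV u" "continuous_on UNIV v"
    using uv by (auto simp: continuous_on_eq_continuous_at intro!: DERIV_isCont)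
  define b where "b x = (u x, v x)" for x
  obtain \<beta>1 \<beta>2 where "\<And>x. norm (u x) \<le> \<beta>1" "\<And>x. norm (v x) \<le> \<beta>2"
    using bdd unfolding bounded_iff by auto
  then have "norm (b x) \<le> \<beta>1 + \<beta>2" for x
    unfolding b_def by (intro order_trans[OF norm_Pair_le add_mono]) auto
  then obtain \<beta> where \<beta>: "0 < \<beta>" "\<And>x. norm (b x) \<le> \<beta>"
    by (meson less_le_trans max.cobounded1 max.cobounded2 order_trans zero_less_one)
  \<comment> \<open>The first summand bounds \<open>N\<close>; the second is the Lipschitz constant
    2 m of the radial function times the profile bound \<beta>. Likewise \<open>C\<close> is the
    second-order constant 6 m times \<beta>.\<close>
  define L where "L = m + 2 * m * \<beta>"
  define C where "C = 6 * m * \<beta>"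
  \<comment> \<open>The derivative of \<open>Nstar N u v x\<close> at \<open>B\<close> in the
    direction \<open>w\<close>.\<close>
  define A where "A x B w = N ((norm (b x))\<^sup>2) *\<^sub>R rot w
    + (2 * D 1 ((norm (b x + B))\<^sup>2) * inner (b x + B) w) *\<^sub>R rot (b x)" for x B w
  note F = Nstar_eq[of N u v, folded b_def]
  have contN: "continuous_on {0..} N"
    using D unfolding smooth_nonneg_def by (auto intro!: DERIV_continuous_on)
  show thesis
  proof (rule that[of L C A])
    show "0 < L" "0 < C" using m \<beta> by (auto simp: L_def C_def add_pos_pos)
    show "continuous_on UNIV (\<lambda>(x, B). Nstar N u v x B)"
      unfolding split_beta' F rot_def b_def
      by (intro continuous_intros continuous_on_compose2[OF contN] continuous_on_compose2[OF cuv(1)]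
          continuous_on_compose2[OF cuv(2)]) auto
    show "Nstar N u v x 0 = 0" for x unfolding F by (simp add: linear_0[OF bounded_linear.linear[OF bounded_linear_rot]])
    show "norm (Nstar N u v x B1 - Nstar N u v x B2) \<le> L * norm (B1 - B2)" for x B1 B2
    proof -
      have "Nstar N u v x B1 - Nstar N u v x B2 = N ((norm (b x))\<^sup>2) *\<^sub>R rot (B1 - B2)
          + (N ((norm (b x + B2 + (B1 - B2)))\<^sup>2) - N ((norm (b x + B2))\<^sup>2)) *\<^sub>R rot (b x)"
        unfolding F by (simp add: linear_diff[OF bounded_linear.linear[OF bounded_linear_rot]] algebra_simps)
      also have "norm \<dots> \<le> m * norm (B1 - B2) + 2 * m * norm (B1 - B2) * \<beta>"
        by (intro order_trans[OF norm_triangle_ineq] add_mono; unfold norm_scaleR norm_rot real_norm_def)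
           (intro mult_mono m rb \<beta>; use m in simp)+
      also have "\<dots> = L * norm (B1 - B2)" by (simp add: L_def algebra_simps)
      finally show ?thesis .
    qed
    show "bounded_linear (A x B)" for x B
      unfolding A_def
      by (intro bounded_linear_add bounded_linear_const_scaleR bounded_linear_rot
          bounded_linear_scaleR_const bounded_linear_mult_right[THEN bounded_linear_compose]
          bounded_linear_inner_right)
    show "norm (A x B w) \<le> L * norm w" for x B w
    proof -
      have "norm (A x B w) \<le> m * norm w + 2 * m * norm w * \<beta>"
        unfolding A_def
        by (intro order_trans[OF norm_triangle_ineq] add_mono; unfold norm_scaleR norm_rot real_norm_def)
           (intro mult_mono m rb \<beta>; use m in simp)+
      also have "\<dots> = L * norm w" by (simp add: L_def algebra_simps)
      finally show ?thesis .
    qed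
    show "norm (Nstar N u v x (B + w) - Nstar N u v x B - A x B w) \<le> C * (norm w)\<^sup>2" for x B w
    proof -
      have "Nstar N u v x (B + w) - Nstar N u v x B - A x B w
          = (N ((norm (b x + B + w))\<^sup>2) - N ((norm (b x + B))\<^sup>2) - 2 * D 1 ((norm (b x + B))\<^sup>2) * inner (b x + B) w) *\<^sub>R rot (b x)"
        unfolding F A_def by (simp add: linear_add[OF bounded_linear.linear[OF bounded_linear_rot]] algebra_simps)
      also have "norm \<dots> \<le> 6 * m * (norm w)\<^sup>2 * \<beta>"
        unfolding norm_scaleR norm_rot real_norm_def by (intro mult_mono rb \<beta>) (use m in simp_all)
      finally show ?thesis by (simp add: C_def mult_ac)
    qed
  qed
qed

section \<open>The translation group and the Duhamel integral\<close>

text \<open>\<open>dplus\<close> and \<open>dminus\<close> are the orthogonal spectral projections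
  of \<Sigma> onto the lines through (1, 1) and (1, -1), with eigenvalues c + 1 and c - 1; on each
  of them \<open>Tc\<close> is a translation.\<close>

definition dplus :: "real \<times> real \<Rightarrow> real \<times> real" where
  "dplus y = ((fst y + snd y) / 2, (fst y + snd y) / 2)"

definition dminus :: "real \<times> real \<Rightarrow> real \<times> real" where
  "dminus y = ((fst y - snd y) / 2, - ((fst y - snd y) / 2))"

lemma Tc_eq: "Tc c t f x = dplus (f (x + (c + 1) * t)) + dminus (f (x + (c - 1) * t))"
  by (simp add: Tc_def Let_def dplus_def dminus_def field_simps)

lemma bounded_linear_dplus: "bounded_linear dplus"
  unfolding dplus_def
  by (intro bounded_linear_Pair bounded_linear_divide[THEN bounded_linear_compose] bounded_linear_add
      bounded_linear_fst bounded_linear_snd)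

lemma bounded_linear_dminus: "bounded_linear dminus"
  unfolding dminus_def
  by (intro bounded_linear_Pair bounded_linear_minus bounded_linear_divide[THEN bounded_linear_compose] bounded_linear_sub
      bounded_linear_fst bounded_linear_snd)

lemmas dplus_linear = bounded_linear.linear[OF bounded_linear_dplus]
lemmas dminus_linear = bounded_linear.linear[OF bounded_linear_dminus]
lemmas dplus_dminus_add = linear_add[OF dplus_linear] linear_add[OF dminus_linear]
lemmas dplus_dminus_diff = linear_diff[OF dplus_linear] linear_diff[OF dminus_linear]
lemmas dplus_dminus_scale = linear_scale[OF dplus_linear] linear_scale[OF dminus_linear]

lemma dplus_add_dminus [simp]: "dplus y + dminus y = y"
  by (simp add: dplus_def dminus_def prod_eq_iff field_simps)

lemma dplus_dplus [simp]: "dplus (dplus y) = dplus y"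
  and dplus_dminus [simp]: "dplus (dminus y) = 0"
  and dminus_dplus [simp]: "dminus (dplus y) = 0"
  and dminus_dminus [simp]: "dminus (dminus y) = dminus y"
  by (simp_all add: dplus_def dminus_def zero_prod_def)

text \<open>Orthogonality holds for different arguments too, as a group with two speeds requires:
  Pythagoras survives evaluation at two points, and \<open>Tc\<close> is an L2 isometry.\<close>

lemma norm_dplus_dminus: "(norm (dplus y + dminus z))\<^sup>2 = (norm (dplus y))\<^sup>2 + (norm (dminus z))\<^sup>2"
  unfolding power2_norm_eq_inner by (simp add: dplus_def dminus_def inner_prod_def field_simps)

lemma norm_dplus_le: "norm (dplus y) \<le> norm y" and norm_dminus_le: "norm (dminus y) \<le> norm y"
  by (rule power2_le_imp_le; use norm_dplus_dminus[of y y] in simp)+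

lemma dplus_measurable [measurable]: "dplus \<in> borel_measurable borel"
  and dminus_measurable [measurable]: "dminus \<in> borel_measurable borel"
  by (intro borel_measurable_continuous_onI linear_continuous_on bounded_linear_dplus bounded_linear_dminus)+

lemma L2_dplus: "f \<in> L2 \<Longrightarrow> (\<lambda>x. dplus (f x)) \<in> L2" "f \<in> L2 \<Longrightarrow> l2norm (\<lambda>x. dplus (f x)) \<le> l2norm f"
  using l2norm_mono[of f "\<lambda>x. dplus (f x)" 1] norm_dplus_le
  by (auto intro: measurable_compose[OF L2_measurable dplus_measurable])

lemma L2_dminus: "f \<in> L2 \<Longrightarrow> (\<lambda>x. dminus (f x)) \<in> L2" "f \<in> L2 \<Longrightarrow> l2norm (\<lambda>x. dminus (f x)) \<le> l2norm f"
  using l2norm_mono[of f "\<lambda>x. dminus (f x)" 1] norm_dminus_le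
  by (auto intro: measurable_compose[OF L2_measurable dminus_measurable])

lemma Tc_L2:
  assumes f: "f \<in> L2"
  shows "Tc c t f \<in> L2" and "l2norm (Tc c t f) = l2norm f"
proof -
  have T: "Tc c t f = (\<lambda>x. dplus (f (x + (c + 1) * t)) + dminus (f (x + (c - 1) * t)))"
    by (rule ext) (rule Tc_eq)
  show "Tc c t f \<in> L2"
    unfolding T by (intro L2_add L2_dplus L2_dminus L2_translate f)
  have "(l2norm (Tc c t f))\<^sup>2 = (l2norm (\<lambda>x. dplus (f (x + (c + 1) * t))))\<^sup>2 + (l2norm (\<lambda>x. dminus (f (x + (c - 1) * t))))\<^sup>2"
    unfolding T l2norm_power2 norm_dplus_dminus
    by (intro Bochner_Integration.integral_add L2_integrable L2_dplus L2_dminus L2_translate f)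
  also have "\<dots> = (l2norm (\<lambda>x. dplus (f x)))\<^sup>2 + (l2norm (\<lambda>x. dminus (f x)))\<^sup>2"
    by (simp add: L2_translate(2)[OF L2_dplus(1)[OF f]] L2_translate(2)[OF L2_dminus(1)[OF f]])
  also have "\<dots> = (l2norm (\<lambda>x. dplus (f x) + dminus (f x)))\<^sup>2"
    unfolding l2norm_power2 norm_dplus_dminus
    by (intro Bochner_Integration.integral_add[symmetric] L2_integrable L2_dplus L2_dminus f)
  finally show "l2norm (Tc c t f) = l2norm f" by simp
qed

text \<open>The two components are read off at different points, so the sup norm is not preserved;
  the triangle inequality costs the factor 2 that recurs in all sup estimates.\<close>

lemma norm_Tc_le: "(\<And>x. norm (f x) \<le> K) \<Longrightarrow> norm (Tc c t f x) \<le> 2 * K"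
  unfolding Tc_eq
  by (rule order_trans[OF norm_triangle_ineq]) (smt (verit, best) norm_dplus_le norm_dminus_le)

lemma Tc_0 [simp]: "Tc c 0 f = f"
  by (rule ext) (simp add: Tc_eq)

lemma Tc_Tc: "Tc c s (Tc c t f) = Tc c (s + t) f"
  by (rule ext) (simp add: Tc_eq dplus_dminus_add algebra_simps)

lemma Tc_add: "Tc c t (\<lambda>y. f y + g y) x = Tc c t f x + Tc c t g x"
  and Tc_diff: "Tc c t (\<lambda>y. f y - g y) x = Tc c t f x - Tc c t g x"
  and Tc_scaleR: "Tc c t (\<lambda>y. r *\<^sub>R f y) x = r *\<^sub>R Tc c t f x"
  by (simp_all add: Tc_eq dplus_dminus_add
      dplus_dminus_diff
      dplus_dminus_scale algebra_simps)

lemma continuous_on_Tc: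
  assumes G: "continuous_on UNIV (case_prod G)"
    and "continuous_on S \<tau>" "continuous_on S \<sigma>" "continuous_on S \<xi>"
  shows "continuous_on S (\<lambda>p. Tc c (\<tau> p) (G (\<sigma> p)) (\<xi> p))"
proof -
  have *: "continuous_on S (\<lambda>p. G (\<sigma> p) (\<eta> p))" if "continuous_on S \<eta>" for \<eta>
    using continuous_on_compose2[OF G continuous_on_Pair[OF assms(3) that]] by simp
  show ?thesis unfolding Tc_eq
    by (intro continuous_on_add bounded_linear.continuous_on[OF bounded_linear_dplus]
        bounded_linear.continuous_on[OF bounded_linear_dminus] * continuous_intros assms)
qed

text \<open>The integral of \<open>Tc c (t - s) (G s) x\<close> over s from 0 to t after the
  substitution s = t \<theta>. The fixed domain covers negative t and makes continuity in (t, x) a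
  standard statement on parameter integrals.\<close>

definition duhamel :: "real \<Rightarrow> (real \<Rightarrow> real \<Rightarrow> real \<times> real) \<Rightarrow> real \<Rightarrow> real \<Rightarrow> real \<times> real" where
  "duhamel c G t x = (LINT \<theta>:{0..1}|lborel. t *\<^sub>R Tc c (t - t * \<theta>) (G (t * \<theta>)) x)"

lemma duhamel_interval: "duhamel c G t x = (LBINT s=ereal 0..ereal t. Tc c (t - s) (G s) x)"
  unfolding duhamel_def using shift_average_eq_interval_integral[of t "\<lambda>s. Tc c (t - s) (G s) x" 0] by simp

lemma duhamel_Icc: "0 \<le> t \<Longrightarrow> duhamel c G t x = (LINT s:{0..t}|lborel. Tc c (t - s) (G s) x)"
  unfolding duhamel_interval by (rule interval_integral_Icc)

lemma duhamel_0 [simp]: "duhamel c G 0 x = 0"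
  by (simp add: duhamel_def set_lebesgue_integral_def)

lemma duhamel_integrable:
  assumes "continuous_on UNIV (case_prod G)"
  shows "set_integrable lborel {0..1} (\<lambda>\<theta>. t *\<^sub>R Tc c (t - t * \<theta>) (G (t * \<theta>)) x)"
  by (intro borel_integrable_atLeastAtMost' continuous_intros continuous_on_Tc[OF assms])

lemma continuous_on_duhamel:
  assumes G: "continuous_on UNIV (case_prod G)"
  shows "continuous_on UNIV (\<lambda>(t, x). duhamel c G t x)"
proof -
  have "continuous_on UNIV (\<lambda>p. integral (cbox 0 1) (\<lambda>\<theta>. fst p *\<^sub>R Tc c (fst p - fst p * \<theta>) (G (fst p * \<theta>)) (snd p)))"
    by (rule integral_continuous_on_param)
       (auto simp: split_beta' intro!: continuous_intros continuous_on_Tc[OF G])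
  then show ?thesis
    unfolding duhamel_def split_beta' set_borel_integral_eq_integral(2)[OF duhamel_integrable[OF G]]
    by simp
qed

lemma duhamel_diff:
  assumes "continuous_on UNIV (case_prod G)" "continuous_on UNIV (case_prod H)"
  shows "duhamel c (\<lambda>s x. G s x - H s x) t x = duhamel c G t x - duhamel c H t x"
  unfolding duhamel_def Tc_diff scaleR_diff_right
  by (rule set_integral_diff(2)) (intro duhamel_integrable assms)+

lemma duhamel_scaleR: "duhamel c (\<lambda>s x. r *\<^sub>R G s x) t x = r *\<^sub>R duhamel c G t x"
  unfolding duhamel_def Tc_scaleR scaleR_left_commute[of t r] by (rule set_integral_scaleR_right)

lemma interval_integral_add_continuous:
  fixes g :: "real \<Rightarrow> 'a :: {banach, second_countable_topology}" and a b d :: real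
  assumes "continuous_on UNIV g"
  shows "(LBINT s=a..b. g s) + (LBINT s=b..d. g s) = (LBINT s=a..d. g s)"
proof -
  have "interval_lebesgue_integrable lborel (ereal a') (ereal b') g" for a' b'
    using assms by (intro interval_integrable_isCont) (auto simp: continuous_on_eq_continuous_at)
  then show ?thesis using interval_integral_sum[of "ereal a" "ereal b" "ereal d" g]
    by (auto simp: min_def max_def)
qed

text \<open>Cut the integral at time h: on the part from 0 to h the group property lets
  \<open>Tc c t\<close> be pulled out. This is what allows a solution to be restarted at any
  time.\<close>

lemma duhamel_shift:
  assumes G: "continuous_on UNIV (case_prod G)"
  shows "duhamel c G (t + h) x = Tc c t (duhamel c G h) x + duhamel c (\<lambda>s. G (s + h)) t x"
proof -
  let ?g = "\<lambda>s. Tc c (t + h - s) (G s) x"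
  have g: "continuous_on UNIV ?g" by (intro continuous_intros continuous_on_Tc[OF G])
  note bl = bounded_linear_dplus bounded_linear_dminus
  \<comment> \<open>Needed to carry the two projections contained in \<open>Tc\<close> through the
    integral.\<close>
  have lin: "f (LINT \<theta>:{0..1}|lborel. k \<theta>) = (LINT \<theta>:{0..1}|lborel. f (k \<theta>))"
    "set_integrable lborel {0..1} (\<lambda>\<theta>. f (k \<theta>))"
    if "bounded_linear f" "set_integrable lborel {0..1} k" for f and k :: "real \<Rightarrow> real \<times> real"
    using integral_bounded_linear[OF that(1) that(2)[unfolded set_integrable_def]]
      integrable_bounded_linear[OF that(1) that(2)[unfolded set_integrable_def]]
    by (simp_all add: set_lebesgue_integral_def set_integrable_def linear_scale[OF bounded_linear.linear[OF that(1)]])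
  have "Tc c t (duhamel c G h) x = (LINT \<theta>:{0..1}|lborel. h *\<^sub>R ?g (0 + h * \<theta>))"
    unfolding Tc_eq[of c t] duhamel_def
    apply (subst lin(1)[OF bl(1) duhamel_integrable[OF G]])
    apply (subst lin(1)[OF bl(2) duhamel_integrable[OF G]])
    apply (subst set_integral_add(2)[symmetric, OF lin(2)[OF bl(1) duhamel_integrable[OF G]] lin(2)[OF bl(2) duhamel_integrable[OF G]]])
    apply (simp add: dplus_dminus_scale flip: scaleR_add_right)
    apply (simp add: Tc_eq dplus_dminus_add algebra_simps)
    done
  also have "\<dots> = (LBINT s=ereal 0..ereal h. ?g s)"
    using shift_average_eq_interval_integral[of h ?g 0] by simp
  finally have 1: "Tc c t (duhamel c G h) x = (LBINT s=ereal 0..ereal h. ?g s)" .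
  have "duhamel c (\<lambda>s. G (s + h)) t x = (LINT \<theta>:{0..1}|lborel. t *\<^sub>R ?g (h + t * \<theta>))"
    unfolding duhamel_def by (simp add: add.commute)
  also have "\<dots> = (LBINT s=ereal h..ereal (h + t). ?g s)"
    by (rule shift_average_eq_interval_integral)
  finally have 2: "duhamel c (\<lambda>s. G (s + h)) t x = (LBINT s=ereal h..ereal (h + t). ?g s)" .
  show ?thesis
    unfolding 1 2 interval_integral_add_continuous[OF g] by (simp add: duhamel_interval add.commute)
qed

text \<open>The gain 1/\<mu> relative to the weight is what lets a large exponent beat the Lipschitz
  constant.\<close>

lemma exp_average:
  fixes \<mu> t K :: real
  assumes "0 < \<mu>"
  shows "set_integrable lborel {0..1} (\<lambda>\<theta>. \<bar>t\<bar> * (K * exp (\<mu> * \<bar>t * \<theta>\<bar>)))"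
    and "0 \<le> K \<Longrightarrow> (LINT \<theta>:{0..1}|lborel. \<bar>t\<bar> * (K * exp (\<mu> * \<bar>t * \<theta>\<bar>))) \<le> K / \<mu> * exp (\<mu> * \<bar>t\<bar>)"
proof -
  show "set_integrable lborel {0..1} (\<lambda>\<theta>. \<bar>t\<bar> * (K * exp (\<mu> * \<bar>t * \<theta>\<bar>)))"
    by (intro borel_integrable_atLeastAtMost' continuous_intros)
  assume "0 \<le> K"
  have "(LINT \<theta>:{0..1}|lborel. \<bar>t\<bar> * (K * exp (\<mu> * \<bar>t * \<theta>\<bar>)))
      = (\<integral>\<theta>. indicator {0..1} \<theta> *\<^sub>R (\<bar>t\<bar> * (K * exp (\<mu> * (\<bar>t\<bar> * \<theta>)))) \<partial>lborel)"
    unfolding set_lebesgue_integral_def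
    by (intro Bochner_Integration.integral_cong) (auto simp: indicator_def abs_mult)
  also have "\<dots> = K / \<mu> * exp (\<mu> * (\<bar>t\<bar> * 1)) - K / \<mu> * exp (\<mu> * (\<bar>t\<bar> * 0))"
  proof (rule integral_FTC_Icc)
    show "((\<lambda>\<theta>. K / \<mu> * exp (\<mu> * (\<bar>t\<bar> * \<theta>))) has_vector_derivative \<bar>t\<bar> * (K * exp (\<mu> * (\<bar>t\<bar> * \<theta>)))) (at \<theta> within {0..1})" for \<theta>
      unfolding has_real_derivative_iff_has_vector_derivative[symmetric]
      using assms by (auto intro!: derivative_eq_intros)
  qed (auto intro!: continuous_intros)
  also have "\<dots> \<le> K / \<mu> * exp (\<mu> * \<bar>t\<bar>)" using assms \<open>0 \<le> K\<close> by simp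
  finally show "(LINT \<theta>:{0..1}|lborel. \<bar>t\<bar> * (K * exp (\<mu> * \<bar>t * \<theta>\<bar>))) \<le> K / \<mu> * exp (\<mu> * \<bar>t\<bar>)" .
qed

text \<open>A non-integrable \<open>f\<close> has integral 0 by default, so a pointwise majorant
  suffices and callers need not establish measurability of \<open>f\<close>.\<close>

lemma set_integral_norm_le:
  fixes f :: "'a :: euclidean_space \<Rightarrow> 'b :: {banach, second_countable_topology}"
  assumes le: "\<And>s. s \<in> A \<Longrightarrow> norm (f s) \<le> \<kappa> s" and \<kappa>: "set_integrable M A \<kappa>"
  shows "norm (LINT s:A|M. f s) \<le> (LINT s:A|M. \<kappa> s)"
proof (cases "set_integrable M A f")
  case True
  show ?thesis unfolding set_lebesgue_integral_def
    by (rule Bochner_Integration.integral_norm_bound_integral)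
       (use True \<kappa> le in \<open>auto simp: set_integrable_def indicator_def\<close>)
next
  case False
  have "0 \<le> \<kappa> s" if "s \<in> A" for s using le[OF that] norm_ge_zero[of "f s"] by linarith
  then have "0 \<le> (LINT s:A|M. \<kappa> s)"
    unfolding set_lebesgue_integral_def by (intro integral_nonneg_AE AE_I2) (auto simp: indicator_def)
  with False show ?thesis
    by (simp add: set_integrable_def set_lebesgue_integral_def not_integrable_integral_eq)
qed

lemma duhamel_sup:
  assumes G: "\<And>s x. norm (G s x) \<le> K * exp (\<mu> * \<bar>s\<bar>)" and \<mu>: "0 < \<mu>"
  shows "norm (duhamel c G t x) \<le> 2 * K / \<mu> * exp (\<mu> * \<bar>t\<bar>)"
proof -
  have K: "0 \<le> K" using order_trans[OF norm_ge_zero G[of 0 0]] by simp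
  have "norm (duhamel c G t x) \<le> (LINT \<theta>:{0..1}|lborel. \<bar>t\<bar> * (2 * K * exp (\<mu> * \<bar>t * \<theta>\<bar>)))"
    unfolding duhamel_def
  proof (rule set_integral_norm_le[OF _ exp_average(1)[OF \<mu>]])
    fix \<theta> :: real
    have "norm (Tc c (t - t * \<theta>) (G (t * \<theta>)) x) \<le> 2 * (K * exp (\<mu> * \<bar>t * \<theta>\<bar>))"
      by (rule norm_Tc_le) (rule G)
    then show "norm (t *\<^sub>R Tc c (t - t * \<theta>) (G (t * \<theta>)) x) \<le> \<bar>t\<bar> * (2 * K * exp (\<mu> * \<bar>t * \<theta>\<bar>))"
      unfolding norm_scaleR by (intro mult_left_mono) (auto simp: mult_ac)
  qed
  also have "\<dots> \<le> 2 * K / \<mu> * exp (\<mu> * \<bar>t\<bar>)" by (rule exp_average(2)[OF \<mu>]) (use K in simp)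
  finally show ?thesis .
qed

text \<open>Minkowski combined with the isometry of \<open>Tc\<close>, which spares the factor 2 of
  the sup estimate.\<close>

lemma duhamel_L2:
  assumes G: "continuous_on UNIV (case_prod G)" and G2: "\<And>s. G s \<in> L2"
    and le: "\<And>s. l2norm (G s) \<le> K * exp (\<mu> * \<bar>s\<bar>)" and \<mu>: "0 < \<mu>" and K: "0 < K"
  shows "duhamel c G t \<in> L2" and "l2norm (duhamel c G t) \<le> K / \<mu> * exp (\<mu> * \<bar>t\<bar>)"
proof -
  have "duhamel c G t \<in> L2 \<and> l2norm (duhamel c G t) \<le> K / \<mu> * exp (\<mu> * \<bar>t\<bar>)"
  \<comment> \<open>Minkowski wants a strictly positive majorant, which fails only at t = 0; the
    assumption \<open>0 < K\<close> has the same origin.\<close>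
  proof (cases "t = 0")
    case True
    then have "duhamel c G t = (\<lambda>x. 0)" by auto
    then show ?thesis using \<mu> K by simp
  next
    case False
    have m: "(\<lambda>(\<theta>, x). t *\<^sub>R Tc c (t - t * \<theta>) (G (t * \<theta>)) x) \<in> borel_measurable borel"
      unfolding split_beta' by (intro borel_measurable_continuous_onI continuous_intros continuous_on_Tc[OF G])
    have 1: "(\<lambda>x. t *\<^sub>R Tc c (t - t * \<theta>) (G (t * \<theta>)) x) \<in> L2" for \<theta>
      by (intro L2_scaleR Tc_L2 G2)
    have 2: "l2norm (\<lambda>x. t *\<^sub>R Tc c (t - t * \<theta>) (G (t * \<theta>)) x) \<le> \<bar>t\<bar> * (K * exp (\<mu> * \<bar>t * \<theta>\<bar>))" for \<theta>
      unfolding l2norm_scaleR Tc_L2(2)[OF G2] by (intro mult_left_mono le) auto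
    have 3: "0 < \<bar>t\<bar> * (K * exp (\<mu> * \<bar>t * \<theta>\<bar>))" for \<theta> using False K by simp
    have 4: "(\<lambda>\<theta>. \<bar>t\<bar> * (K * exp (\<mu> * \<bar>t * \<theta>\<bar>))) \<in> borel_measurable borel" by measurable
    note M = L2_Minkowski[OF m 4 _ 3 exp_average(1)[OF \<mu>] 1 2]
    have d: "duhamel c G t = (\<lambda>x. LINT \<theta>:{0..1}|lborel. t *\<^sub>R Tc c (t - t * \<theta>) (G (t * \<theta>)) x)"
      by (rule ext) (simp add: duhamel_def)
    show ?thesis unfolding d using M exp_average(2)[OF \<mu>, of K t] K by simp
  qed
  then show "duhamel c G t \<in> L2" and "l2norm (duhamel c G t) \<le> K / \<mu> * exp (\<mu> * \<bar>t\<bar>)" by auto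
qed

text \<open>Replaces Gronwall's inequality: iterating the step from \<open>K\<close> to \<open>m + K / 2\<close> drives any
  finite a priori bound down to the fixed point \<open>2 * m\<close>.\<close>

lemma halving_bound:
  fixes y w :: "'a \<Rightarrow> real"
  assumes w: "\<And>z. 0 \<le> w z" and m: "0 \<le> m" and K: "0 < K" "\<And>z. y z \<le> K * w z"
    and step: "\<And>K. 0 < K \<Longrightarrow> (\<And>z. y z \<le> K * w z) \<Longrightarrow> (\<And>z. y z \<le> (m + K / 2) * w z)"
  shows "y z \<le> 2 * m * w z"
proof -
  have *: "y z \<le> (2 * m + K / 2 ^ n) * w z" for n z
  proof (induction n arbitrary: z)
    case 0
    have "K * w z \<le> (2 * m + K) * w z" using w m by (intro mult_right_mono) auto
    then show ?case using K(2)[of z] by simp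
  next
    case (Suc n)
    have "0 < 2 * m + K / 2 ^ n" using m K by (intro add_nonneg_pos) auto
    from step[OF this Suc.IH] show ?case by (simp add: field_simps)
  qed
  have "(\<lambda>n. (2 * m + K * inverse (2 ^ n)) * w z) \<longlonglongrightarrow> (2 * m + K * 0) * w z"
    by (intro tendsto_intros LIMSEQ_inverse_realpow_zero) simp
  then show ?thesis
    by (intro LIMSEQ_le_const[of "\<lambda>n. (2 * m + K * inverse (2 ^ n)) * w z"]) (use *[of z] in \<open>auto simp: divide_inverse\<close>)
qed

section \<open>Existence of a continuous solution\<close>

lemma exp_weight_cancel: "exp (- a) * (K * exp a) = (K :: real)"
proof -
  have "exp (- a) * (K * exp a) = K * exp (- a + a)" by (simp only: exp_add mult_ac)
  then show ?thesis by simp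
qed

text \<open>\<open>A x B\<close> stands for the derivative of \<open>F x\<close> at
  \<open>B\<close>. The quadratic remainder bound is uniform in \<open>x\<close> and
  \<open>B\<close>, so it can be used pointwise inside L2 norms.\<close>

locale semilinear =
  fixes c L C :: real and F :: "real \<Rightarrow> real \<times> real \<Rightarrow> real \<times> real"
    and A :: "real \<Rightarrow> real \<times> real \<Rightarrow> real \<times> real \<Rightarrow> real \<times> real"
  assumes L_pos: "0 < L" and C_pos: "0 < C"
    and F_cont: "continuous_on UNIV (\<lambda>(x, B). F x B)"
    and F_0: "F x 0 = 0"
    and F_lipschitz: "norm (F x B1 - F x B2) \<le> L * norm (B1 - B2)"
    and A_linear: "bounded_linear (A x B)"
    and A_le: "norm (A x B w) \<le> L * norm w"
    and A_remainder: "norm (F x (B + w) - F x B - A x B w) \<le> C * (norm w)\<^sup>2"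
begin

text \<open>\<open>4 * L \<le> lam\<close> makes the Duhamel term contract by 1/2 even with the
  factor 2 of the sup norm; the summand 1 gives \<open>1 \<le> lam\<close>, which absorbs a forcing
  term divided by the exponent.\<close>

definition lam :: real where "lam = 4 * L + 1"

lemma lam: "0 < lam" "1 \<le> lam" "4 * L \<le> lam"
  using L_pos by (auto simp: lam_def)

lemma F_le: "norm (F x B) \<le> L * norm B"
  using F_lipschitz[of x B 0] by (simp add: F_0)

lemma continuous_on_F:
  assumes "continuous_on S f" "continuous_on S g"
  shows "continuous_on S (\<lambda>p. F (f p) (g p))"
  using continuous_on_compose2[OF F_cont continuous_on_Pair[OF assms]] by simp

lemma F_measurable:
  assumes [measurable]: "f \<in> borel_measurable borel"
  shows "(\<lambda>x. F x (f x)) \<in> borel_measurable borel"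
proof -
  have "(\<lambda>(x, B). F x B) \<in> borel_measurable borel" by (rule borel_measurable_continuous_onI[OF F_cont])
  then have 1: "(\<lambda>(x, B). F x B) \<in> borel_measurable (borel \<Otimes>\<^sub>M borel)" by (simp add: borel_prod)
  have 2: "(\<lambda>x. (x, f x)) \<in> borel \<rightarrow>\<^sub>M borel \<Otimes>\<^sub>M borel" by measurable
  from measurable_compose[OF 2 1] show ?thesis by simp
qed

lemma F_L2:
  assumes "f \<in> L2"
  shows "(\<lambda>x. F x (f x)) \<in> L2" and "l2norm (\<lambda>x. F x (f x)) \<le> L * l2norm f"
  using l2norm_mono[OF assms F_measurable[OF L2_measurable[OF assms]], of L] F_le L_pos by auto

lemma F_L2_diff:
  assumes "f \<in> L2" "g \<in> L2"
  shows "l2norm (\<lambda>x. F x (f x) - F x (g x)) \<le> L * l2norm (\<lambda>x. f x - g x)"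
  by (rule l2norm_mono)
     (use assms F_L2 F_lipschitz L_pos in \<open>auto intro!: L2_measurable L2_diff\<close>)

text \<open>The constant is 2 * 2: one factor from \<open>Tc\<close> in the sup norm, one from the
  fixed point of the halving iteration. The a priori constant \<open>K\<close> only has to be finite
  and does not enter the conclusion.\<close>

lemma sup_estimate:
  assumes eq: "\<And>t x. X t x = Tc c t X0 x + duhamel c G t x"
    and G: "\<And>s x. norm (G s x) \<le> L * norm (X s x)"
    and X0: "\<And>x. norm (X0 x) \<le> m" and K: "\<And>t x. norm (X t x) \<le> K * exp (lam * \<bar>t\<bar>)"
  shows "norm (X t x) \<le> 4 * m * exp (lam * \<bar>t\<bar>)"
proof -
  have m0: "0 \<le> m" using order_trans[OF norm_ge_zero X0[of 0]] .
  have "(\<lambda>(t, x). norm (X t x)) (t, x) \<le> 2 * (2 * m) * (\<lambda>(t, x). exp (lam * \<bar>t\<bar>)) (t, x)"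
  proof (rule halving_bound[where K="\<bar>K\<bar> + 1" and y="\<lambda>(t, x). norm (X t x)"
        and w="\<lambda>(t, x). exp (lam * \<bar>t\<bar>)" and z="(t, x)"])
    fix K :: real and z :: "real \<times> real"
    assume K0: "0 < K" and le: "\<And>z. (\<lambda>(t, x). norm (X t x)) z \<le> K * (\<lambda>(t, x). exp (lam * \<bar>t\<bar>)) z"
    obtain t x where z: "z = (t, x)" by (cases z)
    have "norm (G s x) \<le> L * K * exp (lam * \<bar>s\<bar>)" for s x
      using order_trans[OF G mult_left_mono[of "norm (X s x)" "K * exp (lam * \<bar>s\<bar>)" L]] le[of "(s, x)"] L_pos by simp
    from duhamel_sup[OF this lam(1)]
    have "norm (duhamel c G t x) \<le> 2 * (L * K) / lam * exp (lam * \<bar>t\<bar>)" .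
    also have "\<dots> \<le> K / 2 * exp (lam * \<bar>t\<bar>)"
      using lam K0 mult_right_mono[OF lam(3), of K] by (intro mult_right_mono) (auto simp: field_simps)
    finally have 1: "norm (duhamel c G t x) \<le> K / 2 * exp (lam * \<bar>t\<bar>)" .
    have "norm (Tc c t X0 x) \<le> 2 * m" by (rule norm_Tc_le) (rule X0)
    also have "\<dots> \<le> 2 * m * exp (lam * \<bar>t\<bar>)" using m0 lam by (simp add: mult_le_cancel_left1)
    finally have "norm (X t x) \<le> 2 * m * exp (lam * \<bar>t\<bar>) + K / 2 * exp (lam * \<bar>t\<bar>)"
      unfolding eq using 1 by (intro order_trans[OF norm_triangle_ineq] add_mono)
    then show "(\<lambda>(t, x). norm (X t x)) z \<le> (2 * m + K / 2) * (\<lambda>(t, x). exp (lam * \<bar>t\<bar>)) z"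
      by (simp add: z algebra_simps)
  next
    fix z :: "real \<times> real"
    show "(\<lambda>(t, x). norm (X t x)) z \<le> (\<bar>K\<bar> + 1) * (\<lambda>(t, x). exp (lam * \<bar>t\<bar>)) z"
      by (cases z) (auto intro!: order_trans[OF K] mult_right_mono)
  qed (use m0 in auto)
  then show ?thesis by simp
qed

text \<open>The exponent \<mu> is left free because the difference of two quotients is forced at
  rate \<open>2 * lam\<close>, whereas the solution and a single quotient are measured at rate
  \<open>lam\<close>.\<close>

lemma L2_estimate:
  assumes eq: "\<And>t x. X t x = Tc c t X0 x + duhamel c G t x"
    and G: "continuous_on UNIV (case_prod G)" "\<And>s. G s \<in> L2"
    and le: "\<And>s. l2norm (G s) \<le> L * l2norm (X s) + \<gamma> * exp (\<mu> * \<bar>s\<bar>)"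
    and X0: "X0 \<in> L2" and K: "\<And>t. l2norm (X t) \<le> K * exp (\<mu> * \<bar>t\<bar>)"
    and \<mu>: "lam \<le> \<mu>" and \<gamma>: "0 \<le> \<gamma>"
  shows "l2norm (X t) \<le> 2 * (l2norm X0 + \<gamma>) * exp (\<mu> * \<bar>t\<bar>)"
proof (rule halving_bound[where K="\<bar>K\<bar> + 1" and z=t and y="\<lambda>t. l2norm (X t)"])
  have \<mu>': "0 < \<mu>" "1 \<le> \<mu>" "4 * L \<le> \<mu>" using lam \<mu> by auto
  fix K t :: real assume K0: "0 < K" and K: "\<And>t. l2norm (X t) \<le> K * exp (\<mu> * \<bar>t\<bar>)"
  have "l2norm (G s) \<le> (L * K + \<gamma>) * exp (\<mu> * \<bar>s\<bar>)" for s
    using le[of s] mult_left_mono[OF K[of s], of L] L_pos unfolding distrib_right mult.assoc by linarith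
  note d = duhamel_L2[OF G this \<mu>'(1)]
  have pos: "0 < L * K + \<gamma>" using L_pos K0 \<gamma> by (intro add_pos_nonneg mult_pos_pos)
  have "l2norm (duhamel c G t) \<le> (L * K + \<gamma>) / \<mu> * exp (\<mu> * \<bar>t\<bar>)" by (rule d(2)[OF pos])
  also have "\<dots> \<le> (K / 2 + \<gamma>) * exp (\<mu> * \<bar>t\<bar>)"
  proof (intro mult_right_mono)
    have "L * K * 4 \<le> \<mu> * K" using \<mu>'(3) K0 by simp
    moreover have "\<gamma> \<le> \<gamma> * \<mu>" using \<gamma> \<mu>'(2) by (simp add: mult_le_cancel_left1)
    moreover have "0 \<le> K * \<mu>" using K0 \<mu>' by simp
    ultimately have "L * K + \<gamma> \<le> (K / 2 + \<gamma>) * \<mu>" by (simp add: algebra_simps)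
    then show "(L * K + \<gamma>) / \<mu> \<le> K / 2 + \<gamma>" using \<mu>'(1) by (simp add: divide_le_eq)
  qed simp
  finally have "l2norm (duhamel c G t) \<le> (K / 2 + \<gamma>) * exp (\<mu> * \<bar>t\<bar>)" .
  moreover have "l2norm (Tc c t X0) \<le> l2norm X0 * exp (\<mu> * \<bar>t\<bar>)"
    using \<mu>' leD[OF l2norm_nonneg[of X0]] by (simp add: Tc_L2(2)[OF X0] mult_le_cancel_left1)
  moreover have "l2norm (X t) \<le> l2norm (Tc c t X0) + l2norm (duhamel c G t)"
    unfolding eq[abs_def] by (rule l2norm_triangle[OF Tc_L2(1)[OF X0] d(1)[OF pos]])
  ultimately show "l2norm (X t) \<le> (l2norm X0 + \<gamma> + K / 2) * exp (\<mu> * \<bar>t\<bar>)" by (simp add: algebra_simps)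
next
  show "l2norm (X t) \<le> (\<bar>K\<bar> + 1) * exp (\<mu> * \<bar>t\<bar>)" for t
    by (rule order_trans[OF K]) (auto intro!: mult_right_mono)
qed (use \<gamma> in auto)

text \<open>The contraction is measured in the sup norm, since uniform convergence keeps joint
  continuity in (t, x); membership in L2 is carried along as a closed invariant set.\<close>

lemma picard_solution:
  assumes B0: "continuous_on UNIV B0" "\<And>x. norm (B0 x) \<le> m" "B0 \<in> L2"
  obtains B K where "continuous_on UNIV (case_prod B)"
    and "\<And>t x. B t x = Tc c t B0 x + duhamel c (\<lambda>s x. F x (B s x)) t x"
    and "\<And>t x. norm (B t x) \<le> K * exp (lam * \<bar>t\<bar>)"
    and "\<And>t. B t \<in> L2" and "\<And>t. l2norm (B t) \<le> 2 * l2norm B0 * exp (lam * \<bar>t\<bar>)"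
proof -
  \<comment> \<open>\<open>Z\<close> is the weighted unknown, bounded on the whole (t, x) plane;
    \<open>U Z\<close> removes the weight, and \<open>P\<close> is the Duhamel map in the weighted
    variable.\<close>
  define U where "U Z s x = exp (lam * \<bar>s\<bar>) *\<^sub>R apply_bcontfun Z (s, x)" for Z :: "(real \<times> real) \<Rightarrow>\<^sub>C (real \<times> real)" and s x
  define P where "P Z = (\<lambda>p. exp (- (lam * \<bar>fst p\<bar>)) *\<^sub>R
    (Tc c (fst p) B0 (snd p) + duhamel c (\<lambda>s x. F x (U Z s x)) (fst p) (snd p)))" for Z
  \<comment> \<open>Chosen so that \<open>l2norm B0 + M / 2 \<le> M\<close>; the 1 keeps
    \<open>M\<close> positive when the datum vanishes.\<close>
  define M where "M = 2 * (l2norm B0 + 1)"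
  have Mpos: "0 < M" by (simp add: M_def add_nonneg_pos)
  have U: "continuous_on S (\<lambda>p. U Z (f p) (g p))" if "continuous_on S f" "continuous_on S g" for Z S f g
    unfolding U_def
    by (intro continuous_intros that continuous_on_compose2[OF continuous_on_apply_bcontfun[of UNIV Z]]) auto
  have FU: "continuous_on UNIV (\<lambda>(s, x). F x (U Z s x))" for Z
    unfolding split_beta' by (intro continuous_on_F U continuous_intros)
  have norm_U: "norm (U Z s x) \<le> norm Z * exp (lam * \<bar>s\<bar>)" for Z s x
    using norm_bounded[of Z "(s, x)"] by (simp add: U_def mult.commute)
  have half: "2 * (L * k) / lam \<le> k / 2" "L * k / lam \<le> k / 2" if "0 \<le> k" for k
  proof -
    have "4 * (L * k) \<le> k * lam" "0 \<le> L * k"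
      using mult_right_mono[OF lam(3) that] that L_pos by (simp_all add: mult_ac)
    then have "2 * (L * k) \<le> k * lam / 2" "L * k \<le> k * lam / 2" by linarith+
    then show "2 * (L * k) / lam \<le> k / 2" "L * k / lam \<le> k / 2"
      unfolding pos_divide_le_eq[OF lam(1)] by simp_all
  qed
  have Pc: "P Z \<in> bcontfun" for Z
  proof (rule bcontfun_normI[where b="2 * m + norm Z / 2"])
    have "continuous_on UNIV (\<lambda>p. duhamel c (\<lambda>s x. F x (U Z s x)) (fst p) (snd p))"
      using continuous_on_duhamel[OF FU] by (simp add: split_beta')
    moreover have "continuous_on UNIV (\<lambda>p :: real \<times> real. Tc c (fst p) B0 (snd p))"
      by (rule continuous_on_Tc[of "\<lambda>_. B0", where \<sigma>=fst])
         (auto simp: split_beta' intro!: continuous_intros continuous_on_compose2[OF B0(1)])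
    ultimately show "continuous_on UNIV (P Z)" unfolding P_def by (intro continuous_intros)
    fix p
    have "norm (F x (U Z s x)) \<le> L * norm Z * exp (lam * \<bar>s\<bar>)" for s x
      using order_trans[OF F_le mult_left_mono[OF norm_U, of L]] L_pos by (simp add: mult.assoc)
    from duhamel_sup[OF this lam(1)]
    have "norm (duhamel c (\<lambda>s x. F x (U Z s x)) (fst p) (snd p)) \<le> 2 * (L * norm Z) / lam * exp (lam * \<bar>fst p\<bar>)" .
    also have "\<dots> \<le> norm Z / 2 * exp (lam * \<bar>fst p\<bar>)" by (intro mult_right_mono half) auto
    finally have 1: "norm (duhamel c (\<lambda>s x. F x (U Z s x)) (fst p) (snd p)) \<le> norm Z / 2 * exp (lam * \<bar>fst p\<bar>)" .
    have m0: "0 \<le> m" using order_trans[OF norm_ge_zero B0(2)] .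
    have "norm (Tc c (fst p) B0 (snd p)) \<le> 2 * m" by (rule norm_Tc_le) (rule B0(2))
    also have "\<dots> \<le> 2 * m * exp (lam * \<bar>fst p\<bar>)" using m0 lam by (simp add: mult_le_cancel_left1)
    finally have "norm (Tc c (fst p) B0 (snd p) + duhamel c (\<lambda>s x. F x (U Z s x)) (fst p) (snd p))
        \<le> (2 * m + norm Z / 2) * exp (lam * \<bar>fst p\<bar>)"
      unfolding distrib_right using 1 by (intro order_trans[OF norm_triangle_ineq] add_mono)
    then have "norm (P Z p) \<le> exp (- (lam * \<bar>fst p\<bar>)) * ((2 * m + norm Z / 2) * exp (lam * \<bar>fst p\<bar>))"
      by (simp add: P_def)
    then show "norm (P Z p) \<le> 2 * m + norm Z / 2" unfolding exp_weight_cancel .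
  qed
  define T where "T Z = Bcontfun (P Z)" for Z
  have T: "apply_bcontfun (T Z) = P Z" for Z unfolding T_def by (rule Bcontfun_inverse[OF Pc])
  define S where "S = {Z :: (real \<times> real) \<Rightarrow>\<^sub>C (real \<times> real). \<forall>t. (\<lambda>x. apply_bcontfun Z (t, x)) \<in> L2 \<and> l2norm (\<lambda>x. apply_bcontfun Z (t, x)) \<le> M}"
  have U2: "U Z s \<in> L2" "l2norm (U Z s) \<le> M * exp (lam * \<bar>s\<bar>)" if "Z \<in> S" for Z s
    using that unfolding S_def U_def[abs_def] by (auto simp: l2norm_scaleR mult.commute)
  have "\<exists>!Z\<in>S. T Z = Z"
  proof (rule Banach_fix[where c="1/2"])
    \<comment> \<open>Uniform limits are pointwise limits, and Fatou keeps the L2 bound; the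
      iterates are not asked to converge in L2.\<close>
    have "closed S"
      unfolding closed_sequential_limits
    proof (intro allI impI, elim conjE)
      fix Zn Z assume Zn: "\<forall>n. Zn n \<in> S" and lim: "Zn \<longlonglongrightarrow> Z"
      have "(\<lambda>n. apply_bcontfun (Zn n) p) \<longlonglongrightarrow> apply_bcontfun Z p" for p
      proof (rule metric_tendsto_imp_tendsto[OF lim])
        show "\<forall>\<^sub>F n in sequentially. dist (apply_bcontfun (Zn n) p) (apply_bcontfun Z p) \<le> dist (Zn n) Z"
          by (simp add: dist_bounded)
      qed
      moreover have "(\<lambda>x. apply_bcontfun Z (t, x)) \<in> borel_measurable borel" for t
        by (intro borel_measurable_continuous_onI
            continuous_on_compose2[OF continuous_on_apply_bcontfun[of UNIV Z]] continuous_intros) auto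
      ultimately show "Z \<in> S" using Zn L2_Fatou[of "\<lambda>n x. apply_bcontfun (Zn n) (t, x)" M "\<lambda>x. apply_bcontfun Z (t, x)" for t]
        unfolding S_def by auto
    qed
    then show "complete S" by (simp add: complete_eq_closed)
    have "0 \<in> S" using Mpos by (simp add: S_def)
    then show "S \<noteq> {}" by blast
    show "T ` S \<subseteq> S"
    proof (safe, unfold S_def mem_Collect_eq, intro allI conjI)
      fix Z :: "(real \<times> real) \<Rightarrow>\<^sub>C (real \<times> real)" and t :: real
      assume "\<forall>t. (\<lambda>x. apply_bcontfun Z (t, x)) \<in> L2 \<and> l2norm (\<lambda>x. apply_bcontfun Z (t, x)) \<le> M"
      then have Z: "Z \<in> S" by (simp add: S_def)
      have 1: "l2norm (\<lambda>x. F x (U Z s x)) \<le> L * M * exp (lam * \<bar>s\<bar>)" for s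
        using order_trans[OF F_L2(2)[OF U2(1)[OF Z]] mult_left_mono[OF U2(2)[OF Z], of L]] L_pos
        by (simp add: mult.assoc)
      note d = duhamel_L2[OF FU F_L2(1)[OF U2(1)[OF Z]] 1 lam(1) mult_pos_pos[OF L_pos Mpos], of c t]
      have P: "(\<lambda>x. apply_bcontfun (T Z) (t, x)) = (\<lambda>x. exp (- (lam * \<bar>t\<bar>)) *\<^sub>R
          (Tc c t B0 x + duhamel c (\<lambda>s x. F x (U Z s x)) t x))" by (simp add: T P_def)
      show "(\<lambda>x. apply_bcontfun (T Z) (t, x)) \<in> L2"
        unfolding P by (intro L2_scaleR L2_add Tc_L2 B0 d)
      have "l2norm (\<lambda>x. Tc c t B0 x + duhamel c (\<lambda>s x. F x (U Z s x)) t x)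
          \<le> l2norm B0 + L * M / lam * exp (lam * \<bar>t\<bar>)"
        using l2norm_triangle[OF Tc_L2(1)[OF B0(3)] d(1), of c t] d(2) by (simp add: Tc_L2(2)[OF B0(3)])
      also have "\<dots> \<le> l2norm B0 * exp (lam * \<bar>t\<bar>) + M / 2 * exp (lam * \<bar>t\<bar>)"
        using lam Mpos leD[OF l2norm_nonneg[of B0]]
        by (intro add_mono mult_right_mono half) (auto simp: mult_le_cancel_left1)
      also have "\<dots> \<le> M * exp (lam * \<bar>t\<bar>)" by (simp add: M_def algebra_simps)
      finally show "l2norm (\<lambda>x. apply_bcontfun (T Z) (t, x)) \<le> M"
        unfolding P l2norm_scaleR by (simp add: exp_minus field_simps)
    qed
    show "dist (T Y) (T Z) \<le> 1 / 2 * dist Y Z" for Y Z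
    proof (rule dist_bound)
      fix p
      have "norm (F x (U Y s x) - F x (U Z s x)) \<le> L * dist Y Z * exp (lam * \<bar>s\<bar>)" for s x
      proof -
        have "norm (U Y s x - U Z s x) = exp (lam * \<bar>s\<bar>) * dist (apply_bcontfun Y (s, x)) (apply_bcontfun Z (s, x))"
          by (simp add: U_def dist_norm flip: scaleR_diff_right)
        also have "\<dots> \<le> exp (lam * \<bar>s\<bar>) * dist Y Z" by (intro mult_left_mono dist_bounded) simp
        finally have "L * norm (U Y s x - U Z s x) \<le> L * (exp (lam * \<bar>s\<bar>) * dist Y Z)"
          using L_pos by (intro mult_left_mono) auto
        then show ?thesis using F_lipschitz[of x "U Y s x" "U Z s x"] by (simp add: mult_ac)
      qed
      from duhamel_sup[where c=c and t="fst p" and x="snd p" and G="\<lambda>s x. F x (U Y s x) - F x (U Z s x)", OF this lam(1)]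
      have "norm (duhamel c (\<lambda>s x. F x (U Y s x)) (fst p) (snd p) - duhamel c (\<lambda>s x. F x (U Z s x)) (fst p) (snd p))
          \<le> 2 * (L * dist Y Z) / lam * exp (lam * \<bar>fst p\<bar>)"
        by (simp add: duhamel_diff[OF FU FU])
      also have "\<dots> \<le> dist Y Z / 2 * exp (lam * \<bar>fst p\<bar>)" by (intro mult_right_mono half) auto
      finally have *: "norm (duhamel c (\<lambda>s x. F x (U Y s x)) (fst p) (snd p) - duhamel c (\<lambda>s x. F x (U Z s x)) (fst p) (snd p))
          \<le> dist Y Z / 2 * exp (lam * \<bar>fst p\<bar>)" .
      have "dist (P Y p) (P Z p) = exp (- (lam * \<bar>fst p\<bar>)) *
          norm (duhamel c (\<lambda>s x. F x (U Y s x)) (fst p) (snd p) - duhamel c (\<lambda>s x. F x (U Z s x)) (fst p) (snd p))"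
        by (simp add: P_def dist_norm flip: scaleR_diff_right)
      also have "\<dots> \<le> exp (- (lam * \<bar>fst p\<bar>)) * (dist Y Z / 2 * exp (lam * \<bar>fst p\<bar>))"
        by (intro mult_left_mono *) simp
      finally show "dist (apply_bcontfun (T Y) p) (apply_bcontfun (T Z) p) \<le> 1 / 2 * dist Y Z"
        unfolding exp_weight_cancel by (simp add: T)
    qed
  qed auto
  then obtain Z where Z: "Z \<in> S" "T Z = Z" by blast
  have eq: "U Z t x = Tc c t B0 x + duhamel c (\<lambda>s x. F x (U Z s x)) t x" for t x
  proof -
    have "U Z t x = exp (lam * \<bar>t\<bar>) *\<^sub>R P Z (t, x)" by (subst T[symmetric]) (simp add: Z(2) U_def)
    then show ?thesis by (simp add: P_def flip: exp_add)
  qed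
  \<comment> \<open>The radius \<open>M\<close> is not proportional to the datum; the a priori
    estimate replaces it by \<open>2 * l2norm B0\<close>, as a growth bound linear in the datum
    requires.\<close>
  have UL: "l2norm (U Z t) \<le> 2 * (l2norm B0 + 0) * exp (lam * \<bar>t\<bar>)" for t
    by (rule L2_estimate[OF eq FU F_L2(1)[OF U2(1)[OF Z(1)]] _ B0(3) U2(2)[OF Z(1)] order_refl])
       (use F_L2(2)[OF U2(1)[OF Z(1)]] in auto)
  show thesis
  proof (rule that[of "U Z" "norm Z"])
    show "continuous_on UNIV (case_prod (U Z))"
      unfolding split_beta' by (intro U continuous_intros)
    show "l2norm (U Z t) \<le> 2 * l2norm B0 * exp (lam * \<bar>t\<bar>)" for t using UL[of t] by simp
  qed (rule eq norm_U U2(1)[OF Z(1)])+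
qed

end

section \<open>Convergence of difference quotients in L2\<close>

text \<open>Membership is part of the notion: outside L2 the value of \<open>l2norm\<close> may be 0
  by the default of the integral, so convergence of the norms alone would say little.\<close>

definition L2_tendsto :: "('a \<Rightarrow> real \<Rightarrow> real \<times> real) \<Rightarrow> (real \<Rightarrow> real \<times> real) \<Rightarrow> 'a filter \<Rightarrow> bool" where
  "L2_tendsto f g \<F> \<longleftrightarrow> (\<forall>\<^sub>F h in \<F>. f h \<in> L2) \<and> g \<in> L2 \<and> ((\<lambda>h. l2norm (\<lambda>x. f h x - g x)) \<longlongrightarrow> 0) \<F>"

lemma L2_tendstoD: "L2_tendsto f g \<F> \<Longrightarrow> ((\<lambda>h. l2norm (\<lambda>x. f h x - g x)) \<longlongrightarrow> 0) \<F>"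
  by (simp add: L2_tendsto_def)

lemma L2_tendsto_bound:
  assumes "\<forall>\<^sub>F h in \<F>. f h \<in> L2" "g \<in> L2"
    and le: "\<forall>\<^sub>F h in \<F>. l2norm (\<lambda>x. f h x - g x) \<le> r h" and r: "(r \<longlongrightarrow> 0) \<F>"
  shows "L2_tendsto f g \<F>"
  unfolding L2_tendsto_def
  by (intro conjI assms tendsto_sandwich[OF _ le tendsto_const r]) (simp add: eventually_mono)

lemma L2_tendsto_add:
  assumes "L2_tendsto f f0 \<F>" "L2_tendsto g g0 \<F>"
  shows "L2_tendsto (\<lambda>h x. f h x + g h x) (\<lambda>x. f0 x + g0 x) \<F>"
proof (rule L2_tendsto_bound)
  have ev: "\<forall>\<^sub>F h in \<F>. f h \<in> L2 \<and> g h \<in> L2" using assms by (auto simp: L2_tendsto_def eventually_conj_iff)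
  then show "\<forall>\<^sub>F h in \<F>. (\<lambda>x. f h x + g h x) \<in> L2" by (rule eventually_mono) auto
  show "(\<lambda>x. f0 x + g0 x) \<in> L2" using assms by (auto simp: L2_tendsto_def)
  show "\<forall>\<^sub>F h in \<F>. l2norm (\<lambda>x. f h x + g h x - (f0 x + g0 x))
      \<le> l2norm (\<lambda>x. f h x - f0 x) + l2norm (\<lambda>x. g h x - g0 x)"
    using ev
  proof (rule eventually_mono)
    fix h assume "f h \<in> L2 \<and> g h \<in> L2"
    then have "l2norm (\<lambda>x. (f h x - f0 x) + (g h x - g0 x)) \<le> l2norm (\<lambda>x. f h x - f0 x) + l2norm (\<lambda>x. g h x - g0 x)"
      using assms by (intro l2norm_triangle) (auto simp: L2_tendsto_def)
    then show "l2norm (\<lambda>x. f h x + g h x - (f0 x + g0 x)) \<le> l2norm (\<lambda>x. f h x - f0 x) + l2norm (\<lambda>x. g h x - g0 x)"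
      by (simp add: algebra_simps)
  qed
  show "((\<lambda>h. l2norm (\<lambda>x. f h x - f0 x) + l2norm (\<lambda>x. g h x - g0 x)) \<longlongrightarrow> 0) \<F>"
    using tendsto_add[OF assms[THEN L2_tendstoD]] by simp
qed

lemma L2_tendsto_linear:
  fixes T :: "real \<times> real \<Rightarrow> real \<times> real"
  assumes f: "L2_tendsto f f0 \<F>" and T: "bounded_linear T"
  shows "L2_tendsto (\<lambda>h x. T (f h x)) (\<lambda>x. T (f0 x)) \<F>"
proof -
  obtain K where K: "0 \<le> K" "\<And>y. norm (T y) \<le> norm y * K" using bounded_linear.nonneg_bounded[OF T] by blast
  have [measurable]: "T \<in> borel_measurable borel"
    by (intro borel_measurable_continuous_onI linear_continuous_on T)
  have T2: "(\<lambda>x. T (k x)) \<in> L2 \<and> l2norm (\<lambda>x. T (k x)) \<le> K * l2norm k" if "k \<in> L2" for k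
    using l2norm_mono[OF that, of "\<lambda>x. T (k x)" K] K L2_measurable[OF that] by (auto simp: mult.commute)
  have ev: "\<forall>\<^sub>F h in \<F>. f h \<in> L2" and f0: "f0 \<in> L2" using f by (auto simp: L2_tendsto_def)
  show ?thesis
  proof (rule L2_tendsto_bound)
    show "\<forall>\<^sub>F h in \<F>. (\<lambda>x. T (f h x)) \<in> L2" using ev by (rule eventually_mono) (use T2 in blast)
    show "(\<lambda>x. T (f0 x)) \<in> L2" using T2[OF f0] by blast
    show "\<forall>\<^sub>F h in \<F>. l2norm (\<lambda>x. T (f h x) - T (f0 x)) \<le> K * l2norm (\<lambda>x. f h x - f0 x)"
      using ev
    proof (rule eventually_mono)
      fix h assume "f h \<in> L2"
      then show "l2norm (\<lambda>x. T (f h x) - T (f0 x)) \<le> K * l2norm (\<lambda>x. f h x - f0 x)"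
        using T2[OF L2_diff[OF _ f0, of "f h"]] by (simp add: linear_diff[OF bounded_linear.linear[OF T]])
    qed
    show "((\<lambda>h. K * l2norm (\<lambda>x. f h x - f0 x)) \<longlongrightarrow> 0) \<F>"
      using tendsto_mult_right_zero[OF L2_tendstoD[OF f]] .
  qed
qed

lemma L2_tendsto_scaleR: "L2_tendsto f f0 \<F> \<Longrightarrow> L2_tendsto (\<lambda>h x. r *\<^sub>R f h x) (\<lambda>x. r *\<^sub>R f0 x) \<F>"
  by (rule L2_tendsto_linear[where T="\<lambda>y. r *\<^sub>R y"]) (auto intro: bounded_linear_scaleR_right)

lemma L2_tendsto_diff:
  assumes "L2_tendsto f f0 \<F>" "L2_tendsto g g0 \<F>"
  shows "L2_tendsto (\<lambda>h x. f h x - g h x) (\<lambda>x. f0 x - g0 x) \<F>"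
  using L2_tendsto_add[OF assms(1) L2_tendsto_scaleR[OF assms(2), of "-1"]] by simp

lemma L2_tendsto_norm:
  assumes f: "L2_tendsto f g \<F>"
  shows "((\<lambda>h. l2norm (f h)) \<longlongrightarrow> l2norm g) \<F>"
proof (rule LIM_zero_cancel, rule tendsto_0_le[OF L2_tendstoD[OF f], where K=1])
  have ev: "\<forall>\<^sub>F h in \<F>. f h \<in> L2" and g: "g \<in> L2" using f by (auto simp: L2_tendsto_def)
  from ev show "\<forall>\<^sub>F h in \<F>. norm (l2norm (f h) - l2norm g) \<le> norm (l2norm (\<lambda>x. f h x - g x)) * 1"
  proof (rule eventually_mono)
    fix h assume fh: "f h \<in> L2"
    show "norm (l2norm (f h) - l2norm g) \<le> norm (l2norm (\<lambda>x. f h x - g x)) * 1"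
      using l2norm_triangle_sub[OF fh g] l2norm_triangle_sub[OF g fh] l2norm_minus_commute[of g "f h"] by simp
  qed
qed

lemma L2_tendsto_compose: "L2_tendsto f g \<F> \<Longrightarrow> filterlim X \<F> \<G> \<Longrightarrow> L2_tendsto (\<lambda>n. f (X n)) g \<G>"
  unfolding L2_tendsto_def
  by (auto intro: filterlim_compose[where g="\<lambda>h. l2norm (\<lambda>x. f h x - g x)"] simp: filterlim_iff)

lemma L2_average_le:
  fixes Y :: "real \<Rightarrow> real \<Rightarrow> real \<times> real"
  assumes "case_prod Y \<in> borel_measurable borel" "\<And>\<theta>. \<theta> \<in> {0..1} \<Longrightarrow> Y \<theta> \<in> L2"
    and "\<And>\<theta>. \<theta> \<in> {0..1} \<Longrightarrow> l2norm (Y \<theta>) \<le> e" "0 < e"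
  shows "(\<lambda>x. LINT \<theta>:{0..1}|lborel. Y \<theta> x) \<in> L2" and "l2norm (\<lambda>x. LINT \<theta>:{0..1}|lborel. Y \<theta> x) \<le> e"
proof -
  have int: "set_integrable lborel {0..1} (\<lambda>\<theta>::real. e)"
    by (intro borel_integrable_atLeastAtMost' continuous_intros)
  have eq: "(LINT \<theta>:{0..1::real}|lborel. e) = e" by (simp add: set_lebesgue_integral_def)
  note M = L2_Minkowski[where Y=Y and \<kappa>="\<lambda>_. e" and A="{0..1}", OF assms(1) _ _ assms(4) int assms(2,3)]
  show "(\<lambda>x. LINT \<theta>:{0..1}|lborel. Y \<theta> x) \<in> L2" by (rule M(1)) auto
  show "l2norm (\<lambda>x. LINT \<theta>:{0..1}|lborel. Y \<theta> x) \<le> e" using M(2) unfolding eq by auto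
qed

lemma Tc_strongly_continuous:
  assumes f: "f \<in> L2" and e: "0 < e"
  shows "\<exists>d>0. \<forall>s. \<bar>s\<bar> < d \<longrightarrow> l2norm (\<lambda>x. Tc c s f x - f x) < e"
proof -
  obtain d where d: "0 < d" "\<And>s. \<bar>s\<bar> < d \<Longrightarrow> l2norm (\<lambda>x. f (x + s) - f x) < e/2"
    using L2_translation_continuousE[OF f, of "e/2"] e by auto
  \<comment> \<open>Dominates both characteristic speeds, so one threshold on s serves both
    translations.\<close>
  define k where "k = \<bar>c\<bar> + 1"
  have k: "0 < k" "\<bar>c + 1\<bar> \<le> k" "\<bar>c - 1\<bar> \<le> k" by (auto simp: k_def)
  have "l2norm (\<lambda>x. Tc c s f x - f x) < e" if s: "\<bar>s\<bar> < d / k" for s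
  proof -
    have ks: "k * \<bar>s\<bar> < d" using s k(1) by (simp add: pos_less_divide_eq mult.commute)
    have "\<bar>(c + 1) * s\<bar> < d" "\<bar>(c - 1) * s\<bar> < d"
      using le_less_trans[OF mult_right_mono[OF k(2) abs_ge_zero] ks] le_less_trans[OF mult_right_mono[OF k(3) abs_ge_zero] ks]
      by (simp_all add: abs_mult)
    note lt = this[THEN d(2)]
    have dif: "(\<lambda>x. f (x + r) - f x) \<in> L2" for r by (intro L2_diff L2_translate f)
    have "Tc c s f x - f x = dplus (f (x + (c + 1) * s) - f x) + dminus (f (x + (c - 1) * s) - f x)" for x
    proof -
      have "Tc c s f x - f x = dplus (f (x + (c + 1) * s)) + dminus (f (x + (c - 1) * s)) - (dplus (f x) + dminus (f x))"
        by (simp only: Tc_eq dplus_add_dminus)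
      then show ?thesis by (simp only: dplus_dminus_diff add_diff_add)
    qed
    then have "l2norm (\<lambda>x. Tc c s f x - f x)
        \<le> l2norm (\<lambda>x. dplus (f (x + (c + 1) * s) - f x)) + l2norm (\<lambda>x. dminus (f (x + (c - 1) * s) - f x))"
      by (simp add: l2norm_triangle L2_dplus L2_dminus dif)
    then show ?thesis
      using L2_dplus(2)[OF dif, of "(c + 1) * s"] L2_dminus(2)[OF dif, of "(c - 1) * s"] lt by linarith
  qed
  then show ?thesis using d(1) k(1) by (intro exI[of _ "d / k"]) simp
qed

text \<open>After rescaling, the integrand is close to \<open>G 0\<close> uniformly in \<theta>:
  isometry of \<open>Tc\<close> handles \<open>G (h * \<theta>) - G 0\<close>, and strong continuity
  is needed only on the single function \<open>G 0\<close>. Averaging keeps the bound.\<close>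

lemma duhamel_average:
  assumes G: "continuous_on UNIV (case_prod G)" "\<And>s. G s \<in> L2" and lim: "L2_tendsto G (G 0) (at 0)"
  shows "L2_tendsto (\<lambda>h x. (1 / h) *\<^sub>R duhamel c G h x) (G 0) (at 0)"
proof -
  define Y where "Y h \<theta> x = Tc c (h - h * \<theta>) (G (h * \<theta>)) x - G 0 x" for h \<theta> x
  have Gc: "continuous_on S (\<lambda>p. G (f p) (g p))" if "continuous_on S f" "continuous_on S g" for S f g
    using continuous_on_compose2[OF G(1) continuous_on_Pair[OF that]] by simp
  have Ym: "case_prod (Y h) \<in> borel_measurable borel" for h
    unfolding Y_def split_beta' by (intro borel_measurable_continuous_onI continuous_intros continuous_on_Tc[OF G(1)] Gc)
  have Y2: "Y h \<theta> \<in> L2" for h \<theta> unfolding Y_def by (intro L2_diff Tc_L2 G)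
  have eq: "(1 / h) *\<^sub>R duhamel c G h x - G 0 x = (LINT \<theta>:{0..1}|lborel. Y h \<theta> x)" if "h \<noteq> 0" for h x
  proof -
    have "(LINT \<theta>:{0..1}|lborel. Y h \<theta> x)
        = (LINT \<theta>:{0..1}|lborel. Tc c (h - h * \<theta>) (G (h * \<theta>)) x) - (LINT \<theta>:{0..1::real}|lborel. G 0 x)"
      unfolding Y_def
      by (intro set_integral_diff(2) borel_integrable_atLeastAtMost' continuous_intros continuous_on_Tc[OF G(1)])
    then show ?thesis using that by (simp add: duhamel_def) (simp add: set_lebesgue_integral_def)
  qed
  have small: "\<exists>d>0. \<forall>h. h \<noteq> 0 \<and> \<bar>h\<bar> < d \<longrightarrow> (\<forall>\<theta>\<in>{0..1}. l2norm (Y h \<theta>) \<le> e)" if "0 < e" for e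
  proof -
    obtain d1 where d1: "0 < d1" "\<forall>s. \<bar>s\<bar> < d1 \<longrightarrow> l2norm (\<lambda>x. Tc c s (G 0) x - G 0 x) < e/2"
      using Tc_strongly_continuous[OF G(2)[of 0], of "e/2" c] \<open>0 < e\<close> by (meson half_gt_zero)
    from LIM_D[OF L2_tendstoD[OF lim], of "e/2"] \<open>0 < e\<close>
    obtain d2 where d2: "0 < d2" "\<And>s. s \<noteq> 0 \<Longrightarrow> \<bar>s\<bar> < d2 \<Longrightarrow> l2norm (\<lambda>x. G s x - G 0 x) < e/2" by auto
    have "l2norm (Y h \<theta>) \<le> e" if h: "\<bar>h\<bar> < min d1 d2" and \<theta>: "\<theta> \<in> {0..1}" for h \<theta>
    proof -
      have "\<bar>h\<bar> * \<bar>\<theta>\<bar> \<le> \<bar>h\<bar> * 1" "\<bar>h\<bar> * \<bar>1 - \<theta>\<bar> \<le> \<bar>h\<bar> * 1" using \<theta> by (intro mult_left_mono; auto)+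
      then have "\<bar>h * \<theta>\<bar> \<le> \<bar>h\<bar>" "\<bar>h - h * \<theta>\<bar> \<le> \<bar>h\<bar>" by (simp_all add: abs_mult[symmetric] right_diff_distrib)
      then have "\<bar>h - h * \<theta>\<bar> < d1" "\<bar>h * \<theta>\<bar> < d2" using h by linarith+
      then have 1: "l2norm (\<lambda>x. Tc c (h - h * \<theta>) (G 0) x - G 0 x) < e/2" and "\<bar>h * \<theta>\<bar> < d2"
        using d1(2) by blast+
      then have 2: "l2norm (\<lambda>x. G (h * \<theta>) x - G 0 x) < e/2"
        using d2(2)[of "h * \<theta>"] \<open>0 < e\<close> by (cases "h * \<theta> = 0") auto
      have "Y h \<theta> x = Tc c (h - h * \<theta>) (\<lambda>x. G (h * \<theta>) x - G 0 x) x + (Tc c (h - h * \<theta>) (G 0) x - G 0 x)" for x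
        by (simp add: Y_def Tc_diff)
      then have "Y h \<theta> = (\<lambda>x. Tc c (h - h * \<theta>) (\<lambda>x. G (h * \<theta>) x - G 0 x) x + (Tc c (h - h * \<theta>) (G 0) x - G 0 x))"
        by blast
      then have "l2norm (Y h \<theta>) \<le> l2norm (Tc c (h - h * \<theta>) (\<lambda>x. G (h * \<theta>) x - G 0 x))
          + l2norm (\<lambda>x. Tc c (h - h * \<theta>) (G 0) x - G 0 x)"
        by (simp only:) (intro l2norm_triangle Tc_L2 L2_diff G)
      also have "l2norm (Tc c (h - h * \<theta>) (\<lambda>x. G (h * \<theta>) x - G 0 x)) = l2norm (\<lambda>x. G (h * \<theta>) x - G 0 x)"
        by (intro Tc_L2 L2_diff G)
      finally show ?thesis using 1 2 by linarith
    qed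
    then show ?thesis using d1(1) d2(1) by (intro exI[of _ "min d1 d2"]) auto
  qed
  have mem: "(\<lambda>x. (1 / h) *\<^sub>R duhamel c G h x - G 0 x) \<in> L2 \<and> l2norm (\<lambda>x. (1 / h) *\<^sub>R duhamel c G h x - G 0 x) \<le> e"
    if "h \<noteq> 0" "\<forall>\<theta>\<in>{0..1}. l2norm (Y h \<theta>) \<le> e" "0 < e" for h e
    using L2_average_le[OF Ym Y2, of h e] that by (simp add: eq)
  have ev: "\<forall>\<^sub>F h in at 0. (\<lambda>x. (1 / h) *\<^sub>R duhamel c G h x) \<in> L2"
  proof -
    obtain d where d: "0 < d" "\<And>h. h \<noteq> 0 \<Longrightarrow> \<bar>h\<bar> < d \<Longrightarrow> \<forall>\<theta>\<in>{0..1}. l2norm (Y h \<theta>) \<le> 1"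
      using small[of 1] by auto
    have "(\<lambda>x. (1 / h) *\<^sub>R duhamel c G h x) \<in> L2" if "h \<noteq> 0" "\<bar>h\<bar> < d" for h
      using L2_add[OF conjunct1[OF mem[OF that(1) d(2)[OF that] zero_less_one]] G(2)[of 0]] by simp
    then show ?thesis using d(1) by (auto simp: eventually_at dist_real_def)
  qed
  have "((\<lambda>h. l2norm (\<lambda>x. (1 / h) *\<^sub>R duhamel c G h x - G 0 x)) \<longlongrightarrow> 0) (at 0)"
  proof (rule LIM_I)
    fix e :: real assume "0 < e"
    then obtain d where d: "0 < d" "\<And>h. h \<noteq> 0 \<Longrightarrow> \<bar>h\<bar> < d \<Longrightarrow> \<forall>\<theta>\<in>{0..1}. l2norm (Y h \<theta>) \<le> e/2"
      using small[of "e/2"] by auto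
    have "l2norm (\<lambda>x. (1 / h) *\<^sub>R duhamel c G h x - G 0 x) < e" if "h \<noteq> 0" "\<bar>h\<bar> < d" for h
      using mem[OF that(1) d(2)[OF that]] \<open>0 < e\<close> by simp
    then show "\<exists>d>0. \<forall>h. h \<noteq> 0 \<and> norm (h - 0) < d \<longrightarrow>
        norm (l2norm (\<lambda>x. (1 / h) *\<^sub>R duhamel c G h x - G 0 x) - 0) < e"
      using d(1) by (intro exI[of _ d]) auto
  qed
  then show ?thesis unfolding L2_tendsto_def using ev G(2)[of 0] by blast
qed

lemma L2_shift_set_integrable:
  assumes "g \<in> L2"
  shows "set_integrable lborel {0..1} (\<lambda>\<theta>. g (x + r * \<theta>))"
proof (cases "r = 0")
  case True
  then show ?thesis by (auto intro!: borel_integrable_atLeastAtMost' continuous_intros)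
next
  case False
  have [measurable]: "g \<in> borel_measurable borel" using assms by (rule L2_measurable)
  have "integrable lborel (\<lambda>u. indicator {x - \<bar>r\<bar>..x + \<bar>r\<bar>} u *\<^sub>R g u)"
    using L2_interval_integrable[OF assms] by (simp add: set_integrable_def)
  from lborel_integrable_real_affine[OF this False, of x]
  have "integrable lborel (\<lambda>\<theta>. indicator {x - \<bar>r\<bar>..x + \<bar>r\<bar>} (x + r * \<theta>) *\<^sub>R g (x + r * \<theta>))" .
  then show ?thesis
    unfolding set_integrable_def
  proof (rule Bochner_Integration.integrable_bound)
    have "\<bar>r * \<theta>\<bar> \<le> \<bar>r\<bar>" if "\<theta> \<in> {0..1}" for \<theta>
      using that mult_left_mono[of "\<bar>\<theta>\<bar>" 1 "\<bar>r\<bar>"] by (simp add: abs_mult)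
    then show "AE \<theta> in lborel. norm (indicator {0..1} \<theta> *\<^sub>R g (x + r * \<theta>))
        \<le> norm (indicator {x - \<bar>r\<bar>..x + \<bar>r\<bar>} (x + r * \<theta>) *\<^sub>R g (x + r * \<theta>))"
      by (intro AE_I2) (auto simp: indicator_def abs_le_iff; fastforce)
  qed measurable
qed

text \<open>The increment formula makes the quotient an average of translates of \<open>a\<close>
  times \<open>g\<close>, so continuity of translations gives the limit. The speed \<open>a\<close>
  is carried along because the two components of \<open>Tc\<close> move by (c + 1) h and (c - 1)
  h.\<close>

lemma L2_difference_quotient:
  assumes f: "f \<in> L2" and g: "g \<in> L2"
    and inc: "\<And>x r. f (x + r) - f x = (LINT \<theta>:{0..1}|lborel. r *\<^sub>R g (x + r * \<theta>))"
  shows "L2_tendsto (\<lambda>h x. (1 / h) *\<^sub>R (f (x + a * h) - f x)) (\<lambda>x. a *\<^sub>R g x) (at 0)"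
  unfolding L2_tendsto_def
proof (intro conjI)
  note [measurable] = L2_measurable[OF g]
  show "\<forall>\<^sub>F h in at 0. (\<lambda>x. (1 / h) *\<^sub>R (f (x + a * h) - f x)) \<in> L2"
    by (intro always_eventually allI L2_scaleR L2_diff L2_translate f)
  show "(\<lambda>x. a *\<^sub>R g x) \<in> L2" using g by blast
  define Y where "Y h \<theta> x = a *\<^sub>R (g (x + a * h * \<theta>) - g x)" for h \<theta> x
  have Ym: "case_prod (Y h) \<in> borel_measurable borel" for h
  proof -
    have [measurable]: "(\<lambda>p :: real \<times> real. snd p + a * h * fst p) \<in> borel_measurable borel"
      "(\<lambda>p :: real \<times> real. snd p) \<in> borel_measurable borel"
      by (intro borel_measurable_continuous_onI continuous_intros)+
    show ?thesis unfolding Y_def split_beta' by measurable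
  qed
  have Y2: "Y h \<theta> \<in> L2" for h \<theta> unfolding Y_def by (intro L2_scaleR L2_diff L2_translate g)
  have eq: "(1 / h) *\<^sub>R (f (x + a * h) - f x) - a *\<^sub>R g x = (LINT \<theta>:{0..1}|lborel. Y h \<theta> x)" if "h \<noteq> 0" for h x
  proof -
    have c: "set_integrable lborel {0..1::real} (\<lambda>\<theta>. g x)"
      by (intro borel_integrable_atLeastAtMost' continuous_intros)
    have "(LINT \<theta>:{0..1}|lborel. Y h \<theta> x) = a *\<^sub>R ((LINT \<theta>:{0..1}|lborel. g (x + a * h * \<theta>)) - (LINT \<theta>:{0..1::real}|lborel. g x))"
      unfolding Y_def set_integral_scaleR_right set_integral_diff(2)[OF L2_shift_set_integrable[OF g] c] by simp
    then show ?thesis using that unfolding inc set_integral_scaleR_right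
      by (simp add: scaleR_diff_right) (simp add: set_lebesgue_integral_def)
  qed
  show "((\<lambda>h. l2norm (\<lambda>x. (1 / h) *\<^sub>R (f (x + a * h) - f x) - a *\<^sub>R g x)) \<longlongrightarrow> 0) (at 0)"
  proof (rule LIM_I)
    fix e :: real assume e: "0 < e"
    define k where "k = \<bar>a\<bar> + 1"
    have k: "0 < k" "\<bar>a\<bar> \<le> k" by (auto simp: k_def)
    obtain d where d: "0 < d" "\<And>s. \<bar>s\<bar> < d \<Longrightarrow> l2norm (\<lambda>x. g (x + s) - g x) < e / (2 * k)"
      using L2_translation_continuousE[OF g, of "e / (2 * k)"] e k by auto
    have "l2norm (\<lambda>x. (1 / h) *\<^sub>R (f (x + a * h) - f x) - a *\<^sub>R g x) < e" if h: "h \<noteq> 0" "\<bar>h\<bar> < d / k" for h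
    proof -
      have "l2norm (Y h \<theta>) \<le> e / 2" if \<theta>: "\<theta> \<in> {0..1}" for \<theta>
      proof -
        have "\<bar>a * h * \<theta>\<bar> \<le> k * \<bar>h\<bar> * 1"
          unfolding abs_mult using \<theta> k by (intro mult_mono) auto
        also have "\<dots> < d" using h(2) k(1) by (simp add: pos_less_divide_eq mult.commute)
        finally have "l2norm (\<lambda>x. g (x + a * h * \<theta>) - g x) < e / (2 * k)" by (rule d(2))
        then have "\<bar>a\<bar> * l2norm (\<lambda>x. g (x + a * h * \<theta>) - g x) \<le> k * (e / (2 * k))"
          using k by (intro mult_mono) auto
        also have "\<dots> = e / 2" using k(1) by simp
        finally show ?thesis by (simp add: Y_def[abs_def] l2norm_scaleR)
      qed
      from L2_average_le(2)[OF Ym Y2 this] e h(1) show ?thesis by (simp add: eq)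
    qed
    then show "\<exists>d>0. \<forall>h. h \<noteq> 0 \<and> norm (h - 0) < d \<longrightarrow>
        norm (l2norm (\<lambda>x. (1 / h) *\<^sub>R (f (x + a * h) - f x) - a *\<^sub>R g x) - 0) < e"
      using d(1) k(1) by (intro exI[of _ "d / k"]) auto
  qed
qed

lemma duhamel_small:
  assumes "\<And>s x. \<bar>s\<bar> \<le> \<bar>t\<bar> \<Longrightarrow> norm (G s x) \<le> K"
  shows "norm (duhamel c G t x) \<le> 2 * \<bar>t\<bar> * K"
proof -
  have int: "set_integrable lborel {0..1} (\<lambda>\<theta>::real. 2 * \<bar>t\<bar> * K)"
    by (intro borel_integrable_atLeastAtMost' continuous_intros)
  have "norm (duhamel c G t x) \<le> (LINT \<theta>:{0..1::real}|lborel. 2 * \<bar>t\<bar> * K)"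
    unfolding duhamel_def
  proof (rule set_integral_norm_le[OF _ int])
    fix \<theta> :: real assume \<theta>: "\<theta> \<in> {0..1}"
    have "\<bar>t * \<theta>\<bar> \<le> \<bar>t\<bar>" using \<theta> mult_left_mono[of "\<bar>\<theta>\<bar>" 1 "\<bar>t\<bar>"] by (simp add: abs_mult)
    then have "norm (Tc c (t - t * \<theta>) (G (t * \<theta>)) x) \<le> 2 * K" by (intro norm_Tc_le assms)
    then have "\<bar>t\<bar> * norm (Tc c (t - t * \<theta>) (G (t * \<theta>)) x) \<le> \<bar>t\<bar> * (2 * K)" by (intro mult_left_mono) auto
    then show "norm (t *\<^sub>R Tc c (t - t * \<theta>) (G (t * \<theta>)) x) \<le> 2 * \<bar>t\<bar> * K" by (simp add: mult_ac)
  qed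
  then show ?thesis by (simp add: set_lebesgue_integral_def)
qed

text \<open>The scalar majorant is realised as a plane-valued \<open>q\<close> with second component
  0, so that the L2 triangle inequality applies to it.\<close>

lemma l2norm_le_sum3:
  assumes f: "f1 \<in> L2" "f2 \<in> L2" "f3 \<in> L2" and [measurable]: "f \<in> borel_measurable borel"
    and a: "0 \<le> a1" "0 \<le> a2" "0 \<le> a3"
    and le: "\<And>x. norm (f x) \<le> a1 * norm (f1 x) + a2 * norm (f2 x) + a3 * norm (f3 x)"
  shows "l2norm f \<le> a1 * l2norm f1 + a2 * l2norm f2 + a3 * l2norm f3"
proof -
  define p where "p k x = (norm (k x :: real \<times> real), 0::real)" for k and x :: real
  have p: "p k \<in> L2" "l2norm (p k) = l2norm k" if "k \<in> L2" for k
  proof -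
    have [measurable]: "k \<in> borel_measurable borel" using that by (rule L2_measurable)
    have "p k \<in> borel_measurable borel" unfolding p_def[abs_def] by measurable
    then show "p k \<in> L2" "l2norm (p k) = l2norm k"
      using that by (simp_all add: p_def[abs_def] L2_def l2norm_def)
  qed
  define q where "q x = a1 *\<^sub>R p f1 x + a2 *\<^sub>R p f2 x + a3 *\<^sub>R p f3 x" for x
  have q: "q \<in> L2" unfolding q_def by (intro L2_add L2_scaleR p f)
  have nq: "norm (q x) = a1 * norm (f1 x) + a2 * norm (f2 x) + a3 * norm (f3 x)" for x
    using a by (simp add: q_def p_def)
  have "l2norm f \<le> 1 * l2norm q"
    by (rule l2norm_mono(2)[OF q]) (simp_all add: nq le)
  also have "l2norm q \<le> a1 * l2norm f1 + a2 * l2norm f2 + a3 * l2norm f3"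
    unfolding q_def
    using l2norm_triangle[of "\<lambda>x. a1 *\<^sub>R p f1 x + a2 *\<^sub>R p f2 x" "\<lambda>x. a3 *\<^sub>R p f3 x"]
      l2norm_triangle[of "\<lambda>x. a1 *\<^sub>R p f1 x" "\<lambda>x. a2 *\<^sub>R p f2 x"] a
    by (simp add: l2norm_scaleR p f L2_add L2_scaleR)
  finally show ?thesis by simp
qed

section \<open>Regularity of the solution\<close>

text \<open>\<open>B0\<close> is the continuous representative with weak derivative
  \<open>g\<close>, so the increment formula holds at every point. \<open>K\<close> is a qualitative
  sup bound and does not appear in the final growth constant.\<close>

locale semilinear_solution = semilinear +
  fixes B0 g :: "real \<Rightarrow> real \<times> real" and B :: "real \<Rightarrow> real \<Rightarrow> real \<times> real" and K :: real
  assumes speed: "c \<noteq> 1" "c \<noteq> -1"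
    and B0_L2: "B0 \<in> L2" and g_L2: "g \<in> L2"
    and B0_increment: "\<And>x r. B0 (x + r) - B0 x = (LINT \<theta>:{0..1}|lborel. r *\<^sub>R g (x + r * \<theta>))"
    and B_cont: "continuous_on UNIV (case_prod B)"
    and B_eq: "\<And>t x. B t x = Tc c t B0 x + duhamel c (\<lambda>s x. F x (B s x)) t x"
    and B_sup: "\<And>t x. norm (B t x) \<le> K * exp (lam * \<bar>t\<bar>)"
    and B_L2: "\<And>t. B t \<in> L2"
    and B_L2_le: "\<And>t. l2norm (B t) \<le> 2 * l2norm B0 * exp (lam * \<bar>t\<bar>)"
begin

section \<open>Time difference quotients and their uniform bounds\<close>

definition FB :: "real \<Rightarrow> real \<Rightarrow> real \<times> real" where "FB s x = F x (B s x)"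

definition E :: "real \<Rightarrow> real \<Rightarrow> real \<Rightarrow> real \<times> real" where
  "E h t x = (1 / h) *\<^sub>R (B (t + h) x - B t x)"

text \<open>The expected time derivative at t = 0, \<Sigma> g + F(x, B0), with \<Sigma> written
  through its spectral projections.\<close>

definition E0 :: "real \<Rightarrow> real \<times> real" where
  "E0 x = (c + 1) *\<^sub>R dplus (g x) + (c - 1) *\<^sub>R dminus (g x) + FB 0 x"

lemma continuous_on_B:
  assumes "continuous_on S f" "continuous_on S k"
  shows "continuous_on S (\<lambda>p. B (f p) (k p))"
  using continuous_on_compose2[OF B_cont continuous_on_Pair[OF assms]] by simp

lemma continuous_on_FB:
  assumes "continuous_on S f" "continuous_on S k"
  shows "continuous_on S (\<lambda>p. FB (f p) (k p))"
  unfolding FB_def by (intro continuous_on_F continuous_on_B assms)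

lemma FB_cont: "continuous_on UNIV (\<lambda>(s, x). FB (s + h) x)" "continuous_on UNIV (\<lambda>(s, x). FB s x)"
  unfolding split_beta' by (intro continuous_on_FB continuous_intros)+

lemma FB_L2: "FB s \<in> L2" "l2norm (FB s) \<le> L * l2norm (B s)"
  using F_L2[OF B_L2] unfolding FB_def[abs_def] by auto

lemma FB_diff: "norm (FB s x - FB t x) \<le> L * norm (B s x - B t x)"
  unfolding FB_def by (rule F_lipschitz)

lemma B_eq': "B t x = Tc c t B0 x + duhamel c FB t x"
  using B_eq[of t x] unfolding FB_def[abs_def] .

lemma B_0: "B 0 = B0"
  by (rule ext) (simp add: B_eq'[of 0])

lemma B_shift: "B (t + h) x = Tc c t (B h) x + duhamel c (\<lambda>s. FB (s + h)) t x"
proof -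
  have "B h = (\<lambda>y. Tc c h B0 y + duhamel c FB h y)" by (rule ext) (rule B_eq')
  then have "Tc c t (B h) x = Tc c t (Tc c h B0) x + Tc c t (duhamel c FB h) x"
    by (simp only: Tc_add)
  moreover have "continuous_on UNIV (case_prod FB)" using FB_cont(2) by simp
  ultimately show ?thesis
    by (simp add: B_eq'[of "t + h"] duhamel_shift Tc_Tc)
qed

text \<open>The shifted solution solves the same equation with datum \<open>B h\<close>; subtracting
  gives a Duhamel equation to which the sup estimate and, after division by h, the L2 estimate
  apply.\<close>

lemma B_difference:
  "B (t + h) x - B t x = Tc c t (\<lambda>x. B h x - B0 x) x + duhamel c (\<lambda>s x. FB (s + h) x - FB s x) t x"
  unfolding duhamel_diff[OF FB_cont] Tc_diff using B_shift[of t h x] B_eq'[of t x] by simp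

lemma E_eq: "E h t x = Tc c t (E h 0) x + duhamel c (\<lambda>s x. (1 / h) *\<^sub>R (FB (s + h) x - FB s x)) t x"
  unfolding E_def[abs_def] Tc_scaleR duhamel_scaleR B_difference[of t h x]
  by (simp add: B_0 scaleR_add_right)

lemma E_L2: "E h t \<in> L2"
  unfolding E_def[abs_def] by (intro L2_scaleR L2_diff B_L2)

text \<open>Modulus of continuity at t = 0, uniform in x: Hoelder-1/2 increments of the datum along
  the two characteristics, plus the Duhamel term over a time of length |h|.\<close>

definition m :: "real \<Rightarrow> real" where
  "m h = (sqrt \<bar>(c + 1) * h\<bar> + sqrt \<bar>(c - 1) * h\<bar>) * l2norm g + 2 * \<bar>h\<bar> * (L * (\<bar>K\<bar> * exp (lam * \<bar>h\<bar>)))"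

lemma m_tendsto: "(m \<longlongrightarrow> 0) (at 0)"
proof -
  have "isCont m 0" unfolding m_def by (intro continuous_intros)
  then have "(m \<longlongrightarrow> m 0) (at 0)" by (simp add: isCont_def)
  then show ?thesis by (simp add: m_def)
qed

lemma B0_increment_le: "norm (B0 (x + r) - B0 x) \<le> sqrt \<bar>r\<bar> * l2norm g"
  unfolding B0_increment shift_average_eq_interval_integral by (rule L2_interval_integral_le[OF g_L2])

lemma m_bound: "norm (B h x - B0 x) \<le> m h"
proof -
  have "norm (FB s x) \<le> L * (\<bar>K\<bar> * exp (lam * \<bar>h\<bar>))" if "\<bar>s\<bar> \<le> \<bar>h\<bar>" for s x
  proof -
    have "norm (B s x) \<le> \<bar>K\<bar> * exp (lam * \<bar>h\<bar>)"
      using that lam by (intro order_trans[OF B_sup] mult_mono) auto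
    then show ?thesis unfolding FB_def using L_pos by (intro order_trans[OF F_le] mult_left_mono) auto
  qed
  then have 1: "norm (duhamel c FB h x) \<le> 2 * \<bar>h\<bar> * (L * (\<bar>K\<bar> * exp (lam * \<bar>h\<bar>)))"
    by (rule duhamel_small)
  have "Tc c h B0 x - B0 x = Tc c h B0 x - (dplus (B0 x) + dminus (B0 x))" by simp
  also have "\<dots> = dplus (B0 (x + (c + 1) * h) - B0 x) + dminus (B0 (x + (c - 1) * h) - B0 x)"
    by (simp only: Tc_eq dplus_dminus_diff add_diff_add)
  finally have "norm (Tc c h B0 x - B0 x) \<le> norm (B0 (x + (c + 1) * h) - B0 x) + norm (B0 (x + (c - 1) * h) - B0 x)"
    using norm_triangle_mono[OF norm_dplus_le norm_dminus_le] by simp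
  then have "norm (Tc c h B0 x - B0 x) \<le> (sqrt \<bar>(c + 1) * h\<bar> + sqrt \<bar>(c - 1) * h\<bar>) * l2norm g"
    using B0_increment_le[of x "(c + 1) * h"] B0_increment_le[of x "(c - 1) * h"]
    unfolding distrib_right by linarith
  moreover have "B h x - B0 x = (Tc c h B0 x - B0 x) + duhamel c FB h x" by (simp add: B_eq'[of h])
  ultimately show ?thesis unfolding m_def using 1 by (simp only:) (intro norm_triangle_mono; assumption)
qed

lemma m_nonneg: "0 \<le> m h"
  using order_trans[OF norm_ge_zero m_bound] .

text \<open>Propagates the modulus from t = 0 to all times; this uniform smallness later tames the
  quadratic remainder.\<close>

lemma B_increment_sup: "norm (B (t + h) x - B t x) \<le> 4 * m h * exp (lam * \<bar>t\<bar>)"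
proof (rule sup_estimate[where X="\<lambda>t x. B (t + h) x - B t x" and ?X0.0="\<lambda>x. B h x - B0 x"
      and G="\<lambda>s x. FB (s + h) x - FB s x" and K="\<bar>K\<bar> * (exp (lam * \<bar>h\<bar>) + 1)", OF B_difference FB_diff m_bound])
  fix t x
  have "norm (B (t + h) x) \<le> \<bar>K\<bar> * (exp (lam * \<bar>h\<bar>) * exp (lam * \<bar>t\<bar>))"
  proof (rule order_trans[OF B_sup], rule mult_mono)
    have "\<bar>t + h\<bar> \<le> \<bar>h\<bar> + \<bar>t\<bar>" by simp
    then show "exp (lam * \<bar>t + h\<bar>) \<le> exp (lam * \<bar>h\<bar>) * exp (lam * \<bar>t\<bar>)"
      using lam by (simp flip: exp_add distrib_left)
  qed auto
  moreover have "norm (B t x) \<le> \<bar>K\<bar> * exp (lam * \<bar>t\<bar>)"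
    by (rule order_trans[OF B_sup]) (auto intro: mult_right_mono)
  ultimately show "norm (B (t + h) x - B t x) \<le> \<bar>K\<bar> * (exp (lam * \<bar>h\<bar>) + 1) * exp (lam * \<bar>t\<bar>)"
    using norm_triangle_ineq4[of "B (t + h) x" "B t x"] by (simp add: algebra_simps)
qed

text \<open>The constant contains the factor 1/|h|; it is only the finite a priori bound that starts
  the halving iteration.\<close>

lemma E_finite: "\<exists>M. \<forall>t. l2norm (E h t) \<le> M * exp (lam * \<bar>t\<bar>)"
proof -
  define M where "M = 2 * l2norm B0"
  have M: "0 \<le> M" by (simp add: M_def)
  have "l2norm (E h t) \<le> \<bar>1 / h\<bar> * (M * exp (lam * \<bar>h\<bar>) + M) * exp (lam * \<bar>t\<bar>)" for t
  proof -
    have "\<bar>t + h\<bar> \<le> \<bar>h\<bar> + \<bar>t\<bar>" by simp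
    then have "exp (lam * \<bar>t + h\<bar>) \<le> exp (lam * \<bar>h\<bar>) * exp (lam * \<bar>t\<bar>)"
      using lam by (simp flip: exp_add distrib_left)
    then have "l2norm (B (t + h)) \<le> M * (exp (lam * \<bar>h\<bar>) * exp (lam * \<bar>t\<bar>))"
      unfolding M_def by (intro order_trans[OF B_L2_le] mult_left_mono) auto
    then have "l2norm (\<lambda>x. B (t + h) x - B t x) \<le> (M * exp (lam * \<bar>h\<bar>) + M) * exp (lam * \<bar>t\<bar>)"
      using B_L2_le[of t] l2norm_triangle_diff[OF B_L2 B_L2, of "t + h" t] by (simp add: M_def algebra_simps)
    then show ?thesis unfolding E_def[abs_def] l2norm_scaleR mult.assoc by (intro mult_left_mono) auto
  qed
  then show ?thesis by blast
qed

text \<open>The quotients obey the L2 inequality without forcing, so their size is governed by the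
  value at t = 0 with a factor independent of \<open>h\<close>.\<close>

lemma E_le: "l2norm (E h t) \<le> 2 * l2norm (E h 0) * exp (lam * \<bar>t\<bar>)"
proof -
  obtain M where M: "\<And>t. l2norm (E h t) \<le> M * exp (lam * \<bar>t\<bar>)" using E_finite by blast
  have "l2norm (E h t) \<le> 2 * (l2norm (E h 0) + 0) * exp (lam * \<bar>t\<bar>)"
  proof (rule L2_estimate[OF E_eq _ _ _ E_L2 M order_refl order_refl])
    show "continuous_on UNIV (\<lambda>(s, x). (1 / h) *\<^sub>R (FB (s + h) x - FB s x))"
      unfolding split_beta' by (intro continuous_intros continuous_on_FB)
    show G: "(\<lambda>x. (1 / h) *\<^sub>R (FB (s + h) x - FB s x)) \<in> L2" for s by (intro L2_scaleR L2_diff FB_L2)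
    have "norm ((1 / h) *\<^sub>R (FB (s + h) x - FB s x)) \<le> L * norm (E h s x)" for s x
      using mult_left_mono[OF FB_diff[of "s + h" x s], of "\<bar>1 / h\<bar>"] by (simp add: E_def mult_ac)
    then show "l2norm (\<lambda>x. (1 / h) *\<^sub>R (FB (s + h) x - FB s x)) \<le> L * l2norm (E h s) + 0 * exp (lam * \<bar>s\<bar>)" for s
      using l2norm_mono(2)[OF E_L2 L2_measurable[OF G], of s L h s] L_pos by simp
  qed
  then show ?thesis by simp
qed

text \<open>Continuity at t = 0 has to be shown by hand, because it enters the limit of the initial
  quotients and thus precedes their boundedness; at general times it then follows from
  \<open>E_le\<close>.\<close>

lemma B_tendsto_0: "L2_tendsto B B0 (at 0)"
proof (rule L2_tendsto_bound)
  define M where "M = L * (2 * l2norm B0 * exp lam) + 1"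
  have M: "0 < M" unfolding M_def using L_pos by (intro add_nonneg_pos mult_nonneg_nonneg) auto
  have duh: "l2norm (duhamel c FB h) \<le> \<bar>h\<bar> * M" if "\<bar>h\<bar> < 1" "h \<noteq> 0" for h
  proof -
    have m': "(\<lambda>(\<theta>, x). h *\<^sub>R Tc c (h - h * \<theta>) (FB (h * \<theta>)) x) \<in> borel_measurable borel"
      unfolding split_beta'
      by (intro borel_measurable_continuous_onI continuous_intros continuous_on_Tc) (use FB_cont(2) in simp)
    have 2: "l2norm (\<lambda>x. h *\<^sub>R Tc c (h - h * \<theta>) (FB (h * \<theta>)) x) \<le> \<bar>h\<bar> * M" if \<theta>: "\<theta> \<in> {0..1}" for \<theta>
    proof -
      have "\<bar>h * \<theta>\<bar> \<le> 1 * 1" unfolding abs_mult using \<theta> \<open>\<bar>h\<bar> < 1\<close> by (intro mult_mono) auto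
      then have "exp (lam * \<bar>h * \<theta>\<bar>) \<le> exp lam" using lam by simp
      then have "l2norm (B (h * \<theta>)) \<le> 2 * l2norm B0 * exp lam"
        by (intro order_trans[OF B_L2_le] mult_left_mono) auto
      then have "l2norm (FB (h * \<theta>)) \<le> L * (2 * l2norm B0 * exp lam)"
        using L_pos by (intro order_trans[OF FB_L2(2)] mult_left_mono) auto
      then have "l2norm (FB (h * \<theta>)) \<le> M" by (simp add: M_def)
      then show ?thesis by (simp add: l2norm_scaleR Tc_L2(2)[OF FB_L2(1)] mult_left_mono)
    qed
    have d: "duhamel c FB h = (\<lambda>x. LINT \<theta>:{0..1}|lborel. h *\<^sub>R Tc c (h - h * \<theta>) (FB (h * \<theta>)) x)"
      by (rule ext) (simp add: duhamel_def)
    have pos: "0 < \<bar>h\<bar> * M" using M \<open>h \<noteq> 0\<close> by simp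
    show ?thesis unfolding d
      by (rule L2_average_le(2)[OF m' _ 2 pos]) (auto intro!: L2_scaleR Tc_L2 FB_L2)
  qed
  define r where "r h = l2norm (\<lambda>x. Tc c h B0 x - B0 x) + \<bar>h\<bar> * M" for h
  have duhL2: "duhamel c FB h \<in> L2" for h
    using L2_diff[OF B_L2[of h] Tc_L2(1)[OF B0_L2, of c h]] by (simp add: B_eq'[of h])
  have Tr: "((\<lambda>h. l2norm (\<lambda>x. Tc c h B0 x - B0 x)) \<longlongrightarrow> 0) (at 0)"
  proof (rule LIM_I)
    fix e :: real assume "0 < e"
    then obtain d where "0 < d" "\<forall>s. \<bar>s\<bar> < d \<longrightarrow> l2norm (\<lambda>x. Tc c s B0 x - B0 x) < e"
      using Tc_strongly_continuous[OF B0_L2, of e c] by blast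
    then show "\<exists>d>0. \<forall>h. h \<noteq> 0 \<and> norm (h - 0) < d \<longrightarrow> norm (l2norm (\<lambda>x. Tc c h B0 x - B0 x) - 0) < e"
      by (intro exI[of _ d]) auto
  qed
  have "(r \<longlongrightarrow> 0 + \<bar>0\<bar> * M) (at 0)" unfolding r_def by (intro tendsto_add Tr tendsto_intros)
  then show "(r \<longlongrightarrow> 0) (at 0)" by simp
  have "l2norm (\<lambda>x. B h x - B0 x) \<le> r h" if "\<bar>h\<bar> < 1" "h \<noteq> 0" for h
  proof -
    have "l2norm (\<lambda>x. (Tc c h B0 x - B0 x) + duhamel c FB h x) \<le> l2norm (\<lambda>x. Tc c h B0 x - B0 x) + l2norm (duhamel c FB h)"
      by (intro l2norm_triangle L2_diff Tc_L2 B0_L2 duhL2)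
    then show ?thesis unfolding r_def using duh[OF that] by (simp add: B_eq'[of h] diff_add_eq)
  qed
  then show "\<forall>\<^sub>F h in at 0. l2norm (\<lambda>x. B h x - B0 x) \<le> r h"
    unfolding eventually_at by (intro exI[of _ 1]) (auto simp: dist_real_def)
qed (use B_L2 B0_L2 in auto)

lemma FB_tendsto:
  assumes "L2_tendsto (\<lambda>n. B (X n)) (B t) \<F>"
  shows "L2_tendsto (\<lambda>n. FB (X n)) (FB t) \<F>"
proof (rule L2_tendsto_bound)
  show "\<forall>\<^sub>F n in \<F>. l2norm (\<lambda>x. FB (X n) x - FB t x) \<le> L * l2norm (\<lambda>x. B (X n) x - B t x)"
    unfolding FB_def by (intro always_eventually allI F_L2_diff B_L2)
  show "((\<lambda>n. L * l2norm (\<lambda>x. B (X n) x - B t x)) \<longlongrightarrow> 0) \<F>"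
    using tendsto_mult_right_zero[OF L2_tendstoD[OF assms]] .
qed (use FB_L2 in auto)

text \<open>Projecting splits the quotient of \<open>Tc c h B0\<close> into quotients of
  \<open>B0\<close> at speeds c + 1 and c - 1; the Duhamel part averages to
  \<open>FB 0\<close>.\<close>

lemma E_tendsto_0: "L2_tendsto (\<lambda>h. E h 0) E0 (at 0)"
proof -
  have FB0: "L2_tendsto FB (FB 0) (at 0)"
    using FB_tendsto[of "\<lambda>n. n" 0 "at 0"] B_tendsto_0 by (simp add: B_0)
  have "L2_tendsto (\<lambda>h x. (1 / h) *\<^sub>R duhamel c FB h x) (FB 0) (at 0)"
    by (rule duhamel_average[OF _ FB_L2(1) FB0]) (use FB_cont(2) in simp)
  note lim = L2_tendsto_add[OF L2_tendsto_add[OF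
      L2_tendsto_linear[OF L2_difference_quotient[OF B0_L2 g_L2 B0_increment, of "c + 1"] bounded_linear_dplus]
      L2_tendsto_linear[OF L2_difference_quotient[OF B0_L2 g_L2 B0_increment, of "c - 1"] bounded_linear_dminus]] this]
  have "dplus ((1 / h) *\<^sub>R (B0 (x + (c + 1) * h) - B0 x)) + dminus ((1 / h) *\<^sub>R (B0 (x + (c - 1) * h) - B0 x))
      + (1 / h) *\<^sub>R duhamel c FB h x = E h 0 x" for h x
  proof -
    have "E h 0 x = (1 / h) *\<^sub>R (Tc c h B0 x + duhamel c FB h x - (dplus (B0 x) + dminus (B0 x)))"
      by (simp add: E_def B_0 B_eq'[of h])
    also have "\<dots> = dplus ((1 / h) *\<^sub>R (B0 (x + (c + 1) * h) - B0 x)) + dminus ((1 / h) *\<^sub>R (B0 (x + (c - 1) * h) - B0 x))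
      + (1 / h) *\<^sub>R duhamel c FB h x"
      unfolding Tc_eq dplus_dminus_scale
        dplus_dminus_diff
      by (simp only: scaleR_add_right scaleR_diff_right) (simp only: algebra_simps)
    finally show ?thesis by simp
  qed
  with lim show ?thesis
    by (simp add: dplus_dminus_scale E0_def[abs_def])
qed

lemma E0_L2: "E0 \<in> L2"
  using E_tendsto_0 by (simp add: L2_tendsto_def)

text \<open>The slack 1 turns convergence of the norms into a bound for all small steps; the
  admissible steps below are those with \<open>l2norm (E h 0) \<le> M\<close>.\<close>

definition M where "M = l2norm E0 + 1"

lemma E_0_bounded: "\<forall>\<^sub>F h in at 0. l2norm (E h 0) \<le> M"
  using order_tendstoD(2)[OF L2_tendsto_norm[OF E_tendsto_0], of M]
  by (auto simp: M_def elim: eventually_mono)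

lemma B_tendsto: "L2_tendsto (\<lambda>h. B (t + h)) (B t) (at 0)"
proof (rule L2_tendsto_bound)
  have ev: "\<forall>\<^sub>F h :: real in at 0. h \<noteq> 0" by (simp add: eventually_at_filter)
  show "\<forall>\<^sub>F h in at 0. l2norm (\<lambda>x. B (t + h) x - B t x) \<le> \<bar>h\<bar> * (2 * M * exp (lam * \<bar>t\<bar>))"
    using E_0_bounded ev
  proof eventually_elim
    fix h :: real assume h: "l2norm (E h 0) \<le> M" "h \<noteq> 0"
    have "l2norm (\<lambda>x. B (t + h) x - B t x) = \<bar>h\<bar> * l2norm (E h t)"
      using h(2) by (simp add: E_def[abs_def] flip: l2norm_scaleR)
    also have "\<dots> \<le> \<bar>h\<bar> * (2 * l2norm (E h 0) * exp (lam * \<bar>t\<bar>))" by (intro mult_left_mono E_le) auto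
    also have "\<dots> \<le> \<bar>h\<bar> * (2 * M * exp (lam * \<bar>t\<bar>))" using h(1) by (intro mult_left_mono mult_right_mono) auto
    finally show "l2norm (\<lambda>x. B (t + h) x - B t x) \<le> \<bar>h\<bar> * (2 * M * exp (lam * \<bar>t\<bar>))" .
  qed
  have "((\<lambda>h. \<bar>h\<bar> * (2 * M * exp (lam * \<bar>t\<bar>))) \<longlongrightarrow> \<bar>0\<bar> * (2 * M * exp (lam * \<bar>t\<bar>))) (at 0)"
    by (intro tendsto_intros)
  then show "((\<lambda>h. \<bar>h\<bar> * (2 * M * exp (lam * \<bar>t\<bar>))) \<longlongrightarrow> 0) (at 0)" by simp
qed (use B_L2 in auto)

text \<open>Chosen so that \<open>\<tau> h + \<tau> k\<close> is the Cauchy bound: the outer 2 comes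
  from \<open>L2_estimate\<close>, and 8 = 4 * 2 combines the sup bound \<open>4 * m h\<close> on
  increments with the bound \<open>2 * M\<close> on quotients.\<close>

definition \<tau> where "\<tau> h = 2 * (l2norm (\<lambda>x. E h 0 x - E0 x) + 8 * C * M * m h)"

lemma \<tau>_tendsto: "(\<tau> \<longlongrightarrow> 0) (at 0)"
proof -
  have "(\<tau> \<longlongrightarrow> 2 * (0 + 8 * C * M * 0)) (at 0)"
    unfolding \<tau>_def by (intro tendsto_intros L2_tendstoD[OF E_tendsto_0] m_tendsto)
  then show ?thesis by simp
qed

text \<open>Linearising \<open>F\<close> along the solution, the two difference quotients satisfy the same linear
  equation up to a remainder \<open>C * |B (s + h) x - B s x| * |E h s x|\<close>, whose first factor is
  uniformly small; the remainders are therefore small in \<open>L2\<close> although \<open>F\<close> is not differentiable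
  there as a map of \<open>L2\<close>.\<close>

lemma E_Cauchy:
  assumes h: "h \<noteq> 0" "l2norm (E h 0) \<le> M" and k: "k \<noteq> 0" "l2norm (E k 0) \<le> M"
  shows "l2norm (\<lambda>x. E h t x - E k t x) \<le> (\<tau> h + \<tau> k) * exp (2 * lam * \<bar>t\<bar>)"
proof -
  define G where "G h s x = (1 / h) *\<^sub>R (FB (s + h) x - FB s x)" for h s x
  have Gc: "continuous_on UNIV (case_prod (G h))" for h
    unfolding G_def split_beta' by (intro continuous_intros continuous_on_FB)
  have GL2: "G h s \<in> L2" for h s unfolding G_def by (intro L2_scaleR L2_diff FB_L2)
  have rem: "norm (G h s x - A x (B s x) (E h s x)) \<le> C * (4 * m h * exp (lam * \<bar>s\<bar>)) * norm (E h s x)"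
    if "h \<noteq> 0" for h s x
  proof -
    let ?w = "B (s + h) x - B s x"
    have "G h s x - A x (B s x) (E h s x) = (1 / h) *\<^sub>R (F x (B s x + ?w) - F x (B s x) - A x (B s x) ?w)"
    proof -
      have "A x (B s x) (E h s x) = (1 / h) *\<^sub>R A x (B s x) ?w"
        unfolding E_def by (rule linear_scale[OF bounded_linear.linear[OF A_linear]])
      moreover have "B s x + ?w = B (s + h) x" by simp
      ultimately show ?thesis unfolding G_def FB_def by (simp only: scaleR_diff_right)
    qed
    also have "norm \<dots> \<le> \<bar>1 / h\<bar> * (C * (norm ?w)\<^sup>2)"
      unfolding norm_scaleR real_norm_def by (intro mult_left_mono A_remainder) auto
    also have "\<dots> = C * norm ?w * norm (E h s x)"
      by (simp add: E_def power2_eq_square)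
    also have "\<dots> \<le> C * (4 * m h * exp (lam * \<bar>s\<bar>)) * norm (E h s x)"
      using C_pos by (intro mult_right_mono mult_left_mono B_increment_sup) auto
    finally show ?thesis .
  qed
  define \<gamma> where "\<gamma> = 8 * C * M * m h + 8 * C * M * m k"
  have M0: "0 \<le> M" by (simp add: M_def)
  have \<gamma>0: "0 \<le> \<gamma>" unfolding \<gamma>_def using C_pos M0 m_nonneg by simp
  have le: "l2norm (\<lambda>x. G h s x - G k s x) \<le> L * l2norm (\<lambda>x. E h s x - E k s x) + \<gamma> * exp (2 * lam * \<bar>s\<bar>)" for s
  proof -
    let ?a = "\<lambda>h. C * (4 * m h * exp (lam * \<bar>s\<bar>))"
    have "norm (G h s x - G k s x) \<le> L * norm (E h s x - E k s x) + ?a h * norm (E h s x) + ?a k * norm (E k s x)" for x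
    proof -
      let ?A = "A x (B s x)"
      have "G h s x - G k s x = ?A (E h s x - E k s x) + (G h s x - ?A (E h s x)) - (G k s x - ?A (E k s x))"
        by (simp add: linear_diff[OF bounded_linear.linear[OF A_linear]])
      then have "norm (G h s x - G k s x) \<le> norm (?A (E h s x - E k s x)) + norm (G h s x - ?A (E h s x)) + norm (G k s x - ?A (E k s x))"
        by (simp only:) (intro order_trans[OF norm_triangle_ineq4] add_mono norm_triangle_ineq order_refl)
      then show ?thesis using A_le[of x "B s x" "E h s x - E k s x"] rem[OF h(1), of s x] rem[OF k(1), of s x] by linarith
    qed
    then have "l2norm (\<lambda>x. G h s x - G k s x)
        \<le> L * l2norm (\<lambda>x. E h s x - E k s x) + ?a h * l2norm (E h s) + ?a k * l2norm (E k s)"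
      using L_pos C_pos m_nonneg
      by (intro l2norm_le_sum3 L2_diff E_L2 L2_measurable[OF L2_diff[OF GL2 GL2]]) auto
    \<comment> \<open>Increment and quotient each grow like exp (lam |s|), so their product forces
      the exponent \<open>2 * lam\<close>.\<close>
    moreover have b: "?a h * l2norm (E h s) \<le> 8 * C * M * m h * exp (2 * lam * \<bar>s\<bar>)" if "l2norm (E h 0) \<le> M" for h
    proof -
      have "l2norm (E h s) \<le> 2 * M * exp (lam * \<bar>s\<bar>)"
        by (rule order_trans[OF E_le]) (use that in \<open>auto intro!: mult_right_mono\<close>)
      then have "?a h * l2norm (E h s) \<le> ?a h * (2 * M * exp (lam * \<bar>s\<bar>))"
        using C_pos m_nonneg by (intro mult_left_mono) auto
      also have "\<dots> = 8 * C * M * m h * (exp (lam * \<bar>s\<bar>) * exp (lam * \<bar>s\<bar>))" by simp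
      also have "exp (lam * \<bar>s\<bar>) * exp (lam * \<bar>s\<bar>) = exp (2 * lam * \<bar>s\<bar>)" by (simp flip: exp_add)
      finally show ?thesis .
    qed
    ultimately show ?thesis using b[OF h(2)] b[OF k(2)] unfolding \<gamma>_def distrib_right by linarith
  qed
  obtain Mh where Mh: "\<And>t. l2norm (E h t) \<le> Mh * exp (lam * \<bar>t\<bar>)" using E_finite by blast
  obtain Mk where Mk: "\<And>t. l2norm (E k t) \<le> Mk * exp (lam * \<bar>t\<bar>)" using E_finite by blast
  have fin: "l2norm (\<lambda>x. E h t x - E k t x) \<le> (\<bar>Mh\<bar> + \<bar>Mk\<bar>) * exp (2 * lam * \<bar>t\<bar>)" for t
  proof -
    have "(Mh + Mk) * exp (lam * \<bar>t\<bar>) \<le> (\<bar>Mh\<bar> + \<bar>Mk\<bar>) * exp (2 * lam * \<bar>t\<bar>)"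
      using lam by (intro mult_mono) auto
    then show ?thesis
      using l2norm_triangle_diff[OF E_L2 E_L2, of h t k t] Mh[of t] Mk[of t] unfolding distrib_right by linarith
  qed
  have eq: "E h t x - E k t x = Tc c t (\<lambda>x. E h 0 x - E k 0 x) x + duhamel c (\<lambda>s x. G h s x - G k s x) t x" for t x
    using E_eq[of h t x, folded G_def] E_eq[of k t x, folded G_def]
    unfolding duhamel_diff[OF Gc Gc] Tc_diff by simp
  have "l2norm (\<lambda>x. E h t x - E k t x) \<le> 2 * (l2norm (\<lambda>x. E h 0 x - E k 0 x) + \<gamma>) * exp (2 * lam * \<bar>t\<bar>)"
  proof (rule L2_estimate[where X="\<lambda>t x. E h t x - E k t x" and G="\<lambda>s x. G h s x - G k s x", OF eq])
    show "continuous_on UNIV (\<lambda>(s, x). G h s x - G k s x)"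
      unfolding G_def split_beta' by (intro continuous_intros continuous_on_FB)
  qed (use le fin \<gamma>0 lam in \<open>auto intro!: L2_diff GL2 E_L2\<close>)
  also have "\<dots> \<le> (\<tau> h + \<tau> k) * exp (2 * lam * \<bar>t\<bar>)"
    using l2norm_dist_triangle[OF E_L2 E0_L2 E_L2, of h 0 k 0] l2norm_minus_commute[of E0 "E k 0"]
    by (intro mult_right_mono) (auto simp: \<tau>_def \<gamma>_def)
  finally show ?thesis .
qed

end

section \<open>The limit of the quotients, the spatial derivative and the growth bound\<close>

context semilinear_solution
begin

text \<open>One limit serves every admissible step with the rate \<open>\<tau> h\<close>, obtained
  by letting the second step in \<open>E_Cauchy\<close> tend to 0. The rate is locally uniform in t,
  which convergence at each separate t would not give.\<close>

lemma E_limit_ex: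
  "\<exists>w\<in>L2. \<forall>h. h \<noteq> 0 \<longrightarrow> l2norm (E h 0) \<le> M \<longrightarrow> l2norm (\<lambda>x. E h t x - w x) \<le> \<tau> h * exp (2 * lam * \<bar>t\<bar>)"
proof -
  define W where "W = exp (2 * lam * \<bar>t\<bar>)"
  have W: "0 < W" by (simp add: W_def)
  obtain d where d: "0 < d" "\<And>h. h \<noteq> 0 \<Longrightarrow> \<bar>h\<bar> < d \<Longrightarrow> l2norm (E h 0) \<le> M"
    using E_0_bounded by (auto simp: eventually_at dist_real_def)
  \<comment> \<open>Starting at d / 2 keeps every step strictly below the threshold d, so all of
    them are admissible.\<close>
  define X where "X n = d / 2 * inverse (real (Suc n))" for n
  have X: "X n \<noteq> 0" "l2norm (E (X n) 0) \<le> M" for n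
  proof -
    show "X n \<noteq> 0" using d(1) by (simp add: X_def)
    have "d / 2 * inverse (real (Suc n)) \<le> d / 2 * 1"
      using d(1) by (intro mult_left_mono) (auto simp: field_simps)
    then have "\<bar>X n\<bar> < d" using d(1) by (simp add: X_def)
    with \<open>X n \<noteq> 0\<close> show "l2norm (E (X n) 0) \<le> M" by (rule d(2))
  qed
  have "X \<longlonglongrightarrow> 0" unfolding X_def by (rule tendsto_mult_right_zero[OF LIMSEQ_inverse_real_of_nat])
  then have "filterlim X (at 0) sequentially" using X(1) by (simp add: filterlim_at)
  then have \<tau>X: "(\<lambda>n. \<tau> (X n)) \<longlonglongrightarrow> 0" by (rule filterlim_compose[OF \<tau>_tendsto])
  note Cauchy = E_Cauchy[where t=t, folded W_def]
  have "\<exists>w\<in>L2. (\<lambda>n. l2norm (\<lambda>x. E (X n) t x - w x)) \<longlonglongrightarrow> 0"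
  proof (rule L2_complete[OF E_L2])
    fix e :: real assume "0 < e"
    then have "\<forall>\<^sub>F n in sequentially. \<tau> (X n) < e / (2 * W)"
      using W by (intro order_tendstoD(2)[OF \<tau>X]) auto
    then obtain k where k: "\<And>n. n \<ge> k \<Longrightarrow> \<tau> (X n) < e / (2 * W)" by (auto simp: eventually_sequentially)
    have "l2norm (\<lambda>x. E (X p) t x - E (X q) t x) < e" if "p \<ge> k" "q \<ge> k" for p q
    proof -
      have "l2norm (\<lambda>x. E (X p) t x - E (X q) t x) \<le> (\<tau> (X p) + \<tau> (X q)) * W" by (intro Cauchy X)
      also have "\<dots> < (e / (2 * W) + e / (2 * W)) * W"
        using k[OF that(1)] k[OF that(2)] W by (intro mult_strict_right_mono) auto
      also have "\<dots> = e" using W by (simp add: field_simps)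
      finally show ?thesis .
    qed
    then show "\<exists>K. \<forall>p\<ge>K. \<forall>q\<ge>K. l2norm (\<lambda>x. E (X p) t x - E (X q) t x) < e" by blast
  qed
  then obtain w where w: "w \<in> L2" "(\<lambda>n. l2norm (\<lambda>x. E (X n) t x - w x)) \<longlonglongrightarrow> 0" by blast
  have "l2norm (\<lambda>x. E h t x - w x) \<le> \<tau> h * W" if h: "h \<noteq> 0" "l2norm (E h 0) \<le> M" for h
  proof (rule LIMSEQ_le_const)
    have "(\<lambda>n. (\<tau> h + \<tau> (X n)) * W + l2norm (\<lambda>x. E (X n) t x - w x)) \<longlonglongrightarrow> (\<tau> h + 0) * W + 0"
      by (intro tendsto_intros \<tau>X w)
    then show "(\<lambda>n. (\<tau> h + \<tau> (X n)) * W + l2norm (\<lambda>x. E (X n) t x - w x)) \<longlonglongrightarrow> \<tau> h * W" by simp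
    have "l2norm (\<lambda>x. E h t x - w x) \<le> (\<tau> h + \<tau> (X n)) * W + l2norm (\<lambda>x. E (X n) t x - w x)" for n
      using l2norm_dist_triangle[OF E_L2 E_L2 w(1), of h t "X n" t] Cauchy[OF h X[of n]] by linarith
    then show "\<exists>N. \<forall>n\<ge>N. l2norm (\<lambda>x. E h t x - w x) \<le> (\<tau> h + \<tau> (X n)) * W + l2norm (\<lambda>x. E (X n) t x - w x)"
      by blast
  qed
  then show ?thesis using w(1) unfolding W_def by blast
qed

text \<open>An L2 limit is determined only almost everywhere, so one is chosen; the rate is part of
  the choice and hence available for the chosen function.\<close>

definition Bd :: "real \<Rightarrow> real \<Rightarrow> real \<times> real" where
  "Bd t = (SOME w. w \<in> L2 \<and> (\<forall>h. h \<noteq> 0 \<longrightarrow> l2norm (E h 0) \<le> M \<longrightarrow>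
    l2norm (\<lambda>x. E h t x - w x) \<le> \<tau> h * exp (2 * lam * \<bar>t\<bar>)))"

lemma Bd_L2: "Bd t \<in> L2"
  and E_rate: "h \<noteq> 0 \<Longrightarrow> l2norm (E h 0) \<le> M \<Longrightarrow> l2norm (\<lambda>x. E h t x - Bd t x) \<le> \<tau> h * exp (2 * lam * \<bar>t\<bar>)"
proof -
  have "\<exists>w. w \<in> L2 \<and> (\<forall>h. h \<noteq> 0 \<longrightarrow> l2norm (E h 0) \<le> M \<longrightarrow>
    l2norm (\<lambda>x. E h t x - w x) \<le> \<tau> h * exp (2 * lam * \<bar>t\<bar>))"
    using E_limit_ex[of t] by blast
  from someI_ex[OF this, folded Bd_def]
  show "Bd t \<in> L2" "h \<noteq> 0 \<Longrightarrow> l2norm (E h 0) \<le> M \<Longrightarrow> l2norm (\<lambda>x. E h t x - Bd t x) \<le> \<tau> h * exp (2 * lam * \<bar>t\<bar>)"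
    by blast+
qed

lemma good_step: "\<forall>\<^sub>F h in at 0. h \<noteq> 0 \<and> l2norm (E h 0) \<le> M"
  using E_0_bounded eventually_neq_at_within[of "0::real" 0 UNIV] by eventually_elim simp

lemma E_tendsto: "L2_tendsto (\<lambda>h. E h t) (Bd t) (at 0)"
proof (rule L2_tendsto_bound)
  show "\<forall>\<^sub>F h in at 0. l2norm (\<lambda>x. E h t x - Bd t x) \<le> \<tau> h * exp (2 * lam * \<bar>t\<bar>)"
    using good_step by (rule eventually_mono) (use E_rate in blast)
  show "((\<lambda>h. \<tau> h * exp (2 * lam * \<bar>t\<bar>)) \<longlongrightarrow> 0) (at 0)"
    using tendsto_mult_left_zero[OF \<tau>_tendsto] .
qed (use E_L2 Bd_L2 in auto)

lemma Bd_le: "l2norm (Bd t) \<le> 2 * l2norm E0 * exp (lam * \<bar>t\<bar>)"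
proof (rule tendsto_le[OF _ _ L2_tendsto_norm[OF E_tendsto]])
  show "((\<lambda>h. 2 * l2norm (E h 0) * exp (lam * \<bar>t\<bar>)) \<longlongrightarrow> 2 * l2norm E0 * exp (lam * \<bar>t\<bar>)) (at 0)"
    by (intro tendsto_intros L2_tendsto_norm[OF E_tendsto_0])
qed (use E_le in auto)

lemma shift_filterlim: "filterlim (\<lambda>s. s - t) (at 0) (at (t :: real))"
  unfolding filterlim_at by (auto intro!: tendsto_eq_intros simp: eventually_at_filter)

lemma B_tendsto_at: "L2_tendsto B (B t) (at t)"
  using L2_tendsto_compose[OF B_tendsto[of t] shift_filterlim[of t]] by simp

lemma E_tendsto_at: "L2_tendsto (E h) (E h t) (at t)"
proof -
  have "filterlim (\<lambda>s. s + h) (at (t + h)) (at t)"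
    unfolding filterlim_at by (auto intro!: tendsto_eq_intros simp: eventually_at_filter)
  from L2_tendsto_compose[OF B_tendsto_at this]
  show ?thesis unfolding E_def[abs_def]
    by (intro L2_tendsto_scaleR L2_tendsto_diff B_tendsto_at)
qed

text \<open>A locally uniform limit of L2-continuous functions of time: one fixed step h has a small
  rate at all times within 1 of t, and \<open>E h\<close> is continuous in L2.\<close>

lemma Bd_tendsto: "L2_tendsto Bd (Bd t) (at t)"
  unfolding L2_tendsto_def
proof (intro conjI always_eventually allI Bd_L2 LIM_I)
  fix e :: real assume e: "0 < e"
  define W where "W = exp (2 * lam * (\<bar>t\<bar> + 1))"
  have W: "0 < W" by (simp add: W_def)
  have Ws: "exp (2 * lam * \<bar>s\<bar>) \<le> W" if "\<bar>s - t\<bar> < 1" for s using that lam by (simp add: W_def)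
  have "\<forall>\<^sub>F h in at 0. \<tau> h < e / (4 * W)" using e W by (intro order_tendstoD(2)[OF \<tau>_tendsto]) auto
  from eventually_happens'[OF at_neq_bot eventually_conj[OF this good_step]]
  obtain h where h: "\<tau> h < e / (4 * W)" "h \<noteq> 0" "l2norm (E h 0) \<le> M" by blast
  have rate: "l2norm (\<lambda>x. E h s x - Bd s x) \<le> e / 4" if "\<bar>s - t\<bar> < 1" for s
  proof -
    have \<tau>0: "0 \<le> \<tau> h" unfolding \<tau>_def using C_pos m_nonneg l2norm_nonneg[of E0]
      by (intro mult_nonneg_nonneg add_nonneg_nonneg) (auto simp: M_def)
    have "\<tau> h * exp (2 * lam * \<bar>s\<bar>) \<le> e / (4 * W) * W"
      using h(1) \<tau>0 Ws[OF that] e W by (intro mult_mono) auto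
    also have "\<dots> = e / 4" using W by simp
    finally show ?thesis using E_rate[OF h(2,3), of s] by linarith
  qed
  from LIM_D[OF L2_tendstoD[OF E_tendsto_at[of h t]], of "e / 4"] e
  obtain d where d: "0 < d" "\<And>s. s \<noteq> t \<Longrightarrow> \<bar>s - t\<bar> < d \<Longrightarrow> l2norm (\<lambda>x. E h s x - E h t x) < e / 4" by auto
  have "l2norm (\<lambda>x. Bd s x - Bd t x) < e" if s: "s \<noteq> t" "\<bar>s - t\<bar> < min d 1" for s
  proof -
    have "\<bar>s - t\<bar> < 1" "\<bar>s - t\<bar> < d" "\<bar>t - t\<bar> < 1" using s by auto
    from rate[OF this(1)] rate[OF this(3)] d(2)[OF s(1) this(2)]
    show ?thesis
      using l2norm_dist_triangle[OF Bd_L2 E_L2 Bd_L2, of s t h s] l2norm_dist_triangle[OF E_L2 E_L2 Bd_L2, of h s t h t]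
        l2norm_minus_commute[of "Bd s" "E h s"] e by linarith
  qed
  then show "\<exists>d>0. \<forall>s. s \<noteq> t \<and> norm (s - t) < d \<longrightarrow> norm (l2norm (\<lambda>x. Bd s x - Bd t x) - 0) < e"
    using d(1) by (intro exI[of _ "min d 1"]) auto
qed

text \<open>The equation \<open>B_t = \<Sigma> B_x + F\<close> solved for \<open>B_x\<close>; this is where \<open>c \<noteq> \<plusminus>1\<close> enters.\<close>

definition W :: "real \<Rightarrow> real \<Rightarrow> real \<times> real" where
  "W t x = (1 / (c + 1)) *\<^sub>R dplus (Bd t x - FB t x) + (1 / (c - 1)) *\<^sub>R dminus (Bd t x - FB t x)"

lemma W_L2: "W t \<in> L2"
  unfolding W_def[abs_def] by (intro L2_add L2_scaleR L2_dplus L2_dminus L2_diff Bd_L2 FB_L2)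

lemma W_tendsto: "L2_tendsto W (W t) (at t)"
  unfolding W_def[abs_def]
  by (intro L2_tendsto_add L2_tendsto_scaleR L2_tendsto_diff Bd_tendsto FB_tendsto B_tendsto_at
      L2_tendsto_linear[OF _ bounded_linear_dplus] L2_tendsto_linear[OF _ bounded_linear_dminus])

text \<open>A quotient along a characteristic of slope \<open>a\<close> is \<open>a\<close> times a
  spatial quotient with step \<open>a * h\<close>; for \<open>a \<noteq> 0\<close> these steps are
  nonzero and tend to 0.\<close>

lemma weak_deriv_of_L2_tendsto:
  assumes f: "f \<in> L2" and a: "a \<noteq> 0"
    and lim: "L2_tendsto (\<lambda>h x. (1 / h) *\<^sub>R (f (x + a * h) - f x)) w (at 0)"
  shows "weak_deriv f (\<lambda>x. (1 / a) *\<^sub>R w x)"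
proof -
  define X where "X n = inverse (real (Suc n))" for n
  have X0: "X \<longlonglongrightarrow> 0" unfolding X_def by (rule LIMSEQ_inverse_real_of_nat)
  then have X: "filterlim X (at 0) sequentially" by (auto simp: filterlim_at X_def)
  have "L2_tendsto (\<lambda>n x. (1 / a) *\<^sub>R ((1 / X n) *\<^sub>R (f (x + a * X n) - f x))) (\<lambda>x. (1 / a) *\<^sub>R w x) sequentially"
    by (rule L2_tendsto_scaleR[OF L2_tendsto_compose[OF lim X]])
  then have *: "L2_tendsto (\<lambda>n x. (1 / (a * X n)) *\<^sub>R (f (x + a * X n) - f x)) (\<lambda>x. (1 / a) *\<^sub>R w x) sequentially"
    by simp
  have aX: "(\<lambda>n. a * X n) \<longlonglongrightarrow> 0" "\<And>n. a * X n \<noteq> 0"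
    by (rule tendsto_mult_right_zero[OF X0]) (use a in \<open>simp add: X_def\<close>)
  have "(\<lambda>x. (1 / a) *\<^sub>R w x) \<in> L2" using * by (simp add: L2_tendsto_def)
  from weak_deriv_difference_quotients[OF f this aX L2_tendstoD[OF *]] show ?thesis .
qed

text \<open>Subtracting the Duhamel average from the time quotient leaves the quotient of
  \<open>Tc c h (B t)\<close>, whose projections are pure translations by (c + 1) h and (c - 1) h.
  Each therefore yields the weak derivative of one component.\<close>

lemma B_weak_deriv: "weak_deriv (B t) (W t)"
proof -
  have "L2_tendsto (\<lambda>s. FB (s + t)) (FB t) (at 0)"
    using FB_tendsto[OF B_tendsto[of t]] by (simp add: add.commute)
  then have "L2_tendsto (\<lambda>h x. (1 / h) *\<^sub>R duhamel c (\<lambda>s. FB (s + t)) h x) (FB t) (at 0)"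
    using duhamel_average[of "\<lambda>s. FB (s + t)" c] FB_cont(1)[of t] FB_L2(1) by simp
  note D = L2_tendsto_diff[OF E_tendsto[of t] this]
  have eq: "E h t x - (1 / h) *\<^sub>R duhamel c (\<lambda>s. FB (s + t)) h x
      = (1 / h) *\<^sub>R (Tc c h (B t) x - (dplus (B t x) + dminus (B t x)))" for h x
    unfolding E_def dplus_add_dminus add.commute[of t h] B_shift[of h t x]
    by (simp add: scaleR_diff_right scaleR_add_right)
  have p: "dplus (E h t x - (1 / h) *\<^sub>R duhamel c (\<lambda>s. FB (s + t)) h x)
      = (1 / h) *\<^sub>R (dplus (B t (x + (c + 1) * h)) - dplus (B t x))"
    and q: "dminus (E h t x - (1 / h) *\<^sub>R duhamel c (\<lambda>s. FB (s + t)) h x)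
      = (1 / h) *\<^sub>R (dminus (B t (x + (c - 1) * h)) - dminus (B t x))" for h x
    unfolding eq Tc_eq dplus_dminus_scale
      dplus_dminus_diff dplus_dminus_add
    by simp_all
  have "weak_deriv (\<lambda>x. dplus (B t x)) (\<lambda>x. (1 / (c + 1)) *\<^sub>R dplus (Bd t x - FB t x))"
    using L2_tendsto_linear[OF D bounded_linear_dplus] speed
    by (intro weak_deriv_of_L2_tendsto L2_dplus B_L2) (auto simp: p add_eq_0_iff2)
  moreover have "weak_deriv (\<lambda>x. dminus (B t x)) (\<lambda>x. (1 / (c - 1)) *\<^sub>R dminus (Bd t x - FB t x))"
    using L2_tendsto_linear[OF D bounded_linear_dminus] speed
    by (intro weak_deriv_of_L2_tendsto L2_dminus B_L2) (auto simp: q)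
  ultimately have "weak_deriv (\<lambda>x. dplus (B t x) + dminus (B t x)) (W t)"
    unfolding W_def[abs_def]
    by (rule weak_deriv_add) (intro L2_scaleR L2_dplus L2_dminus L2_diff Bd_L2 FB_L2 B_L2)+
  then show ?thesis by simp
qed

lemma sol_class_B: "sol_class B"
  unfolding sol_class_def
proof (intro conjI exI[of _ Bd] allI impI)
  fix t :: real assume "0 \<le> t"
  show "B t \<in> H1" unfolding H1_def using B_L2 W_L2 B_weak_deriv by blast
  \<comment> \<open>\<open>W s - W t\<close> is a weak derivative of the difference, so continuity
    in H1 reduces to L2 continuity of \<open>B\<close> and \<open>W\<close>.\<close>
  have h1: "h1norm (\<lambda>x. B s x - B t x) = sqrt ((l2norm (\<lambda>x. B s x - B t x))\<^sup>2 + (l2norm (\<lambda>x. W s x - W t x))\<^sup>2)" for s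
    by (intro h1norm_eq L2_diff weak_deriv_diff W_L2 B_L2 B_weak_deriv)
  have "((\<lambda>s. h1norm (\<lambda>x. B s x - B t x)) \<longlongrightarrow> sqrt (0\<^sup>2 + 0\<^sup>2)) (at t)"
    unfolding h1 by (intro tendsto_intros L2_tendstoD B_tendsto_at W_tendsto)
  then show "((\<lambda>s. h1norm (\<lambda>x. B s x - B t x)) \<longlongrightarrow> 0) (at t within {0..})"
    by (auto intro: tendsto_within_subset)
  show "Bd t \<in> L2" by (rule Bd_L2)
  show "((\<lambda>s. l2norm (\<lambda>x. Bd s x - Bd t x)) \<longlongrightarrow> 0) (at t within {0..})"
    by (rule tendsto_within_subset[OF L2_tendstoD[OF Bd_tendsto]]) simp
  show "((\<lambda>h. l2norm (\<lambda>x. (1 / h) *\<^sub>R (B (t + h) x - B t x) - Bd t x)) \<longlongrightarrow> 0) (at 0 within {- t..})"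
    by (rule tendsto_within_subset[OF L2_tendstoD[OF E_tendsto[of t], unfolded E_def]]) simp
qed

text \<open>The reciprocals come from solving \<Sigma> B_x = B_t - F for B_x. In the bracket the
  first term bounds \<Sigma> g inside \<open>E0\<close>, doubled by \<open>Bd_le\<close>, and 4 L is
  2 L from the nonlinear part of \<open>E0\<close> plus 2 L from \<open>FB t\<close>; the leading 2
  is the bound on \<open>B t\<close> itself.\<close>

lemma h1norm_B_le:
  "h1norm (B t) \<le> (2 + (1 / \<bar>c + 1\<bar> + 1 / \<bar>c - 1\<bar>) * (2 * (\<bar>c + 1\<bar> + \<bar>c - 1\<bar>) + 4 * L))
    * exp (lam * \<bar>t\<bar>) * (l2norm B0 + l2norm g)"
proof -
  define w where "w = exp (lam * \<bar>t\<bar>)"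
  define \<kappa> where "\<kappa> = 1 / \<bar>c + 1\<bar> + 1 / \<bar>c - 1\<bar>"
  have w: "0 \<le> w" and \<kappa>: "0 \<le> \<kappa>" by (auto simp: w_def \<kappa>_def)
  have n: "0 \<le> l2norm B0" "0 \<le> l2norm g" "0 \<le> L" using L_pos by auto
  have "l2norm E0 \<le> l2norm (\<lambda>x. (c + 1) *\<^sub>R dplus (g x) + (c - 1) *\<^sub>R dminus (g x)) + l2norm (FB 0)"
    unfolding E0_def[abs_def] by (intro l2norm_triangle L2_add L2_scaleR L2_dplus L2_dminus g_L2 FB_L2)
  also have "\<dots> \<le> (l2norm (\<lambda>x. (c + 1) *\<^sub>R dplus (g x)) + l2norm (\<lambda>x. (c - 1) *\<^sub>R dminus (g x))) + L * l2norm B0"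
    using FB_L2(2)[of 0] by (intro add_mono l2norm_triangle L2_scaleR L2_dplus L2_dminus g_L2) (simp add: B_0)
  also have "\<dots> \<le> (\<bar>c + 1\<bar> + \<bar>c - 1\<bar>) * l2norm g + L * l2norm B0"
    unfolding l2norm_scaleR distrib_right
    by (intro add_mono mult_left_mono L2_dplus L2_dminus g_L2 order_refl) auto
  finally have E0: "l2norm E0 \<le> (\<bar>c + 1\<bar> + \<bar>c - 1\<bar>) * l2norm g + L * l2norm B0" .
  have Bd: "l2norm (Bd t) \<le> 2 * ((\<bar>c + 1\<bar> + \<bar>c - 1\<bar>) * l2norm g + L * l2norm B0) * w"
    unfolding w_def by (rule order_trans[OF Bd_le]) (use E0 in \<open>auto intro!: mult_right_mono\<close>)
  have FBt: "l2norm (FB t) \<le> L * (2 * l2norm B0 * w)"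
    unfolding w_def by (rule order_trans[OF FB_L2(2)]) (use n in \<open>auto intro!: mult_left_mono B_L2_le\<close>)
  have D: "(\<lambda>x. Bd t x - FB t x) \<in> L2" by (intro L2_diff Bd_L2 FB_L2)
  have "l2norm (W t) \<le> l2norm (\<lambda>x. (1 / (c + 1)) *\<^sub>R dplus (Bd t x - FB t x)) + l2norm (\<lambda>x. (1 / (c - 1)) *\<^sub>R dminus (Bd t x - FB t x))"
    unfolding W_def[abs_def] by (intro l2norm_triangle L2_scaleR L2_dplus L2_dminus D)
  also have "\<dots> \<le> \<bar>1 / (c + 1)\<bar> * l2norm (\<lambda>x. Bd t x - FB t x) + \<bar>1 / (c - 1)\<bar> * l2norm (\<lambda>x. Bd t x - FB t x)"
    unfolding l2norm_scaleR by (intro add_mono mult_left_mono L2_dplus L2_dminus D) auto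
  also have "\<dots> = \<kappa> * l2norm (\<lambda>x. Bd t x - FB t x)" by (simp add: \<kappa>_def distrib_right)
  also have "\<dots> \<le> \<kappa> * ((2 * (\<bar>c + 1\<bar> + \<bar>c - 1\<bar>) + 4 * L) * w * (l2norm B0 + l2norm g))"
  proof (rule mult_left_mono[OF _ \<kappa>])
    have "0 \<le> (\<bar>c + 1\<bar> + \<bar>c - 1\<bar>) * w * l2norm B0" "0 \<le> L * w * l2norm g" using n w by auto
    then show "l2norm (\<lambda>x. Bd t x - FB t x) \<le> (2 * (\<bar>c + 1\<bar> + \<bar>c - 1\<bar>) + 4 * L) * w * (l2norm B0 + l2norm g)"
      using l2norm_triangle_diff[OF Bd_L2 FB_L2(1), of t t] Bd FBt by (simp add: algebra_simps)
  qed
  finally have Wt: "l2norm (W t) \<le> \<kappa> * ((2 * (\<bar>c + 1\<bar> + \<bar>c - 1\<bar>) + 4 * L) * w * (l2norm B0 + l2norm g))" .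
  have "2 * l2norm B0 * w \<le> 2 * w * (l2norm B0 + l2norm g)"
    using n w by (simp add: distrib_left mult_ac)
  then have Bt: "l2norm (B t) \<le> 2 * w * (l2norm B0 + l2norm g)"
    using B_L2_le[of t] unfolding w_def by linarith
  have "h1norm (B t) = sqrt ((l2norm (B t))\<^sup>2 + (l2norm (W t))\<^sup>2)"
    by (intro h1norm_eq W_L2 B_weak_deriv)
  also have "\<dots> \<le> l2norm (B t) + l2norm (W t)" by (rule sqrt_sum_squares_le_sum) auto
  also have "\<dots> \<le> (2 + \<kappa> * (2 * (\<bar>c + 1\<bar> + \<bar>c - 1\<bar>) + 4 * L)) * w * (l2norm B0 + l2norm g)"
    using Bt Wt by (simp add: algebra_simps)
  finally show ?thesis by (simp add: w_def \<kappa>_def)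
qed

text \<open>The pointwise Duhamel formula is paired with \<open>\<phi>\<close>, and Fubini exchanges
  the pairing with the time integral.\<close>

lemma B_mild:
  assumes t: "0 \<le> t" and \<phi>: "\<phi> \<in> L2"
  shows "set_integrable lborel {0..t} (\<lambda>s. l2inner (Tc c (t - s) (FB s)) \<phi>)"
    and "l2inner (B t) \<phi> = l2inner (Tc c t B0) \<phi> + (LINT s:{0..t}|lborel. l2inner (Tc c (t - s) (FB s)) \<phi>)"
proof -
  define Z where "Z s x = indicator {0..t} s *\<^sub>R inner (Tc c (t - s) (FB s) x) (\<phi> x)" for s x
  have [measurable]: "\<phi> \<in> borel_measurable borel" using \<phi> by (rule L2_measurable)
  have FBc: "continuous_on UNIV (case_prod FB)" using FB_cont(2) by simp
  have int: "integrable (lborel \<Otimes>\<^sub>M lborel) (case_prod Z)"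
  proof (rule pair_integrable_L2[where Y="\<lambda>s. Tc c (t - s) (FB s)" and a=0 and b=t and \<phi>=\<phi>
        and K="L * (2 * l2norm B0 * exp (lam * t))"])
    have [measurable]: "(\<lambda>p :: real \<times> real. Tc c (t - fst p) (FB (fst p)) (snd p)) \<in> borel_measurable borel"
      "(\<lambda>p :: real \<times> real. fst p) \<in> borel_measurable borel" "(\<lambda>p :: real \<times> real. snd p) \<in> borel_measurable borel"
      by (intro borel_measurable_continuous_onI continuous_intros continuous_on_Tc[OF FBc])+
    show "case_prod Z \<in> borel_measurable borel" unfolding Z_def split_beta' by measurable
    show "norm (Z s x) \<le> indicator {0..t} s * (norm (Tc c (t - s) (FB s) x) * norm (\<phi> x))" for s x
      using Cauchy_Schwarz_ineq2[of "Tc c (t - s) (FB s) x" "\<phi> x"] by (simp add: Z_def abs_mult mult_left_mono)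
    fix s assume s: "s \<in> {0..t}"
    show "Tc c (t - s) (FB s) \<in> L2" by (intro Tc_L2 FB_L2)
    have "l2norm (B s) \<le> 2 * l2norm B0 * exp (lam * t)"
      using s lam by (intro order_trans[OF B_L2_le] mult_left_mono) auto
    then show "l2norm (Tc c (t - s) (FB s)) \<le> L * (2 * l2norm B0 * exp (lam * t))"
      unfolding Tc_L2(2)[OF FB_L2(1)] using L_pos by (intro order_trans[OF FB_L2(2)] mult_left_mono) auto
  qed (rule \<phi>)
  have Zs: "(\<integral>x. Z s x \<partial>lborel) = indicator {0..t} s *\<^sub>R l2inner (Tc c (t - s) (FB s)) \<phi>" for s
    by (simp add: Z_def l2inner_def)
  show "set_integrable lborel {0..t} (\<lambda>s. l2inner (Tc c (t - s) (FB s)) \<phi>)"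
    using lborel_pair.integrable_fst'[OF int] by (simp add: set_integrable_def Zs)
  have "(LINT s:{0..t}|lborel. l2inner (Tc c (t - s) (FB s)) \<phi>) = (\<integral>s. (\<integral>x. Z s x \<partial>lborel) \<partial>lborel)"
    by (simp add: set_lebesgue_integral_def Zs)
  also have "\<dots> = (\<integral>x. (\<integral>s. Z s x \<partial>lborel) \<partial>lborel)" by (rule lborel_pair.Fubini_integral[OF int, symmetric])
  also have "\<dots> = l2inner (duhamel c FB t) \<phi>"
    unfolding l2inner_def
  proof (rule Bochner_Integration.integral_cong[OF refl])
    fix x
    have "set_integrable lborel {0..t} (\<lambda>s. Tc c (t - s) (FB s) x)"
      by (intro borel_integrable_atLeastAtMost' continuous_intros continuous_on_Tc[OF FBc])
    from integral_inner_left[OF this[unfolded set_integrable_def], of "\<phi> x"]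
    show "(\<integral>s. Z s x \<partial>lborel) = inner (duhamel c FB t x) (\<phi> x)"
      unfolding Z_def duhamel_Icc[OF t] set_lebesgue_integral_def by simp
  qed
  finally have d: "(LINT s:{0..t}|lborel. l2inner (Tc c (t - s) (FB s)) \<phi>) = l2inner (duhamel c FB t) \<phi>" .
  have "duhamel c FB t \<in> L2"
    using L2_diff[OF B_L2[of t] Tc_L2(1)[OF B0_L2, of c t]] by (simp add: B_eq'[of t])
  moreover have "B t = (\<lambda>x. Tc c t B0 x + duhamel c FB t x)" by (rule ext) (rule B_eq')
  ultimately show "l2inner (B t) \<phi> = l2inner (Tc c t B0) \<phi> + (LINT s:{0..t}|lborel. l2inner (Tc c (t - s) (FB s)) \<phi>)"
    unfolding d using l2inner_add_left[OF Tc_L2(1)[OF B0_L2] _ \<phi>] by simp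
qed

end

text \<open>Halving in place of Gronwall: only a pointwise bound on the L2 distance enters the
  integrand, so the distance itself is never integrated and no measurability in time is asked of
  it.\<close>

lemma (in semilinear) mild_unique:
  assumes U: "\<And>t. 0 \<le> t \<Longrightarrow> U t \<in> L2" and V: "\<And>t. 0 \<le> t \<Longrightarrow> V t \<in> L2"
    and bd: "\<And>T. \<exists>K. \<forall>t\<in>{0..T}. l2norm (\<lambda>x. U t x - V t x) \<le> K"
    and eqU: "\<And>t \<phi>. 0 \<le> t \<Longrightarrow> \<phi> \<in> L2 \<Longrightarrow>
      set_integrable lborel {0..t} (\<lambda>s. l2inner (Tc c (t - s) (\<lambda>y. F y (U s y))) \<phi>) \<and>
      l2inner (U t) \<phi> = I t \<phi> + (LINT s:{0..t}|lborel. l2inner (Tc c (t - s) (\<lambda>y. F y (U s y))) \<phi>)"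
    and eqV: "\<And>t \<phi>. 0 \<le> t \<Longrightarrow> \<phi> \<in> L2 \<Longrightarrow>
      set_integrable lborel {0..t} (\<lambda>s. l2inner (Tc c (t - s) (\<lambda>y. F y (V s y))) \<phi>) \<and>
      l2inner (V t) \<phi> = I t \<phi> + (LINT s:{0..t}|lborel. l2inner (Tc c (t - s) (\<lambda>y. F y (V s y))) \<phi>)"
    and T: "0 \<le> T"
  shows "l2norm (\<lambda>x. U T x - V T x) = 0"
proof -
  define \<delta> where "\<delta> t = l2norm (\<lambda>x. U t x - V t x)" for t
  \<comment> \<open>Extended by 0 outside [0, T], since the halving lemma compares on the whole
    line.\<close>
  define y where "y z = (if z \<in> {0..T} then \<delta> z else 0)" for z
  obtain K where K: "\<And>t. t \<in> {0..T} \<Longrightarrow> \<delta> t \<le> K" using bd[of T] unfolding \<delta>_def by blast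
  have "y T \<le> 2 * 0 * exp (lam * \<bar>T\<bar>)"
  proof (rule halving_bound[where y=y and w="\<lambda>z. exp (lam * \<bar>z\<bar>)" and K="\<bar>K\<bar> + 1"])
    fix z
    have "y z \<le> (\<bar>K\<bar> + 1) * 1" using K[of z] by (auto simp: y_def)
    also have "\<dots> \<le> (\<bar>K\<bar> + 1) * exp (lam * \<bar>z\<bar>)" using lam by (intro mult_left_mono) auto
    finally show "y z \<le> (\<bar>K\<bar> + 1) * exp (lam * \<bar>z\<bar>)" .
  next
    fix K z :: real assume K: "0 < K" and le: "\<And>z. y z \<le> K * exp (lam * \<bar>z\<bar>)"
    show "y z \<le> (0 + K / 2) * exp (lam * \<bar>z\<bar>)"
    proof (cases "z \<in> {0..T}")
      case True
      then have z: "0 \<le> z" "z \<le> T" by auto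
      \<comment> \<open>Testing with the difference at the final time z gives an inequality for the
        square of \<open>\<delta> z\<close>, from which one factor \<open>\<delta> z\<close> is
        cancelled.\<close>
      define \<phi> where "\<phi> x = U z x - V z x" for x
      have \<phi>: "\<phi> \<in> L2" unfolding \<phi>_def using U V z by blast
      let ?u = "\<lambda>s. l2inner (Tc c (z - s) (\<lambda>y. F y (U s y))) \<phi>"
      let ?v = "\<lambda>s. l2inner (Tc c (z - s) (\<lambda>y. F y (V s y))) \<phi>"
      have "(\<delta> z)\<^sup>2 = l2inner \<phi> \<phi>" by (simp add: l2inner_self \<delta>_def \<phi>_def[abs_def])
      also have "\<dots> = l2inner (U z) \<phi> - l2inner (V z) \<phi>"
        using l2inner_diff_left[OF U[OF z(1)] V[OF z(1)] \<phi>] by (simp add: \<phi>_def[abs_def])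
      also have "\<dots> = (LINT s:{0..z}|lborel. ?u s - ?v s)"
        using eqU[OF z(1) \<phi>] eqV[OF z(1) \<phi>] by (simp add: set_integral_diff(2))
      also have "\<dots> \<le> norm (LINT s:{0..z}|lborel. ?u s - ?v s)" by simp
      also have "\<dots> \<le> (LINT s:{0..z}|lborel. L * K * \<delta> z * exp (lam * s))"
      proof (rule set_integral_norm_le)
        fix s assume s: "s \<in> {0..z}"
        then have Us: "U s \<in> L2" "V s \<in> L2" using U V by auto
        note FU = F_L2(1)[OF Us(1)] and FV = F_L2(1)[OF Us(2)]
        have "?u s - ?v s = l2inner (\<lambda>x. Tc c (z - s) (\<lambda>y. F y (U s y)) x - Tc c (z - s) (\<lambda>y. F y (V s y)) x) \<phi>"
          by (intro l2inner_diff_left[symmetric] Tc_L2 FU FV \<phi>)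
        also have "\<dots> = l2inner (Tc c (z - s) (\<lambda>y. F y (U s y) - F y (V s y))) \<phi>"
          by (simp only: Tc_diff[symmetric])
        finally have "norm (?u s - ?v s) \<le> l2norm (\<lambda>y. F y (U s y) - F y (V s y)) * \<delta> z"
          using l2inner_le[OF Tc_L2(1)[OF L2_diff[OF FU FV]] \<phi>, of c "z - s"]
          by (simp add: Tc_L2(2)[OF L2_diff[OF FU FV]] \<delta>_def \<phi>_def[abs_def])
        also have "\<dots> \<le> L * (K * exp (lam * s)) * \<delta> z"
        proof (rule mult_right_mono)
          have "\<delta> s \<le> K * exp (lam * s)" using le[of s] s z by (auto simp: y_def)
          then show "l2norm (\<lambda>y. F y (U s y) - F y (V s y)) \<le> L * (K * exp (lam * s))"
            using L_pos by (intro order_trans[OF F_L2_diff[OF Us]] mult_left_mono) (auto simp: \<delta>_def)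
        qed (simp add: \<delta>_def)
        finally show "norm (?u s - ?v s) \<le> L * K * \<delta> z * exp (lam * s)" by (simp add: mult_ac)
      qed (intro borel_integrable_atLeastAtMost' continuous_intros)
      also have "\<dots> = L * K * \<delta> z / lam * exp (lam * z) - L * K * \<delta> z / lam * exp (lam * 0)"
        unfolding set_lebesgue_integral_def
      proof (rule integral_FTC_Icc[OF z(1)])
        show "((\<lambda>s. L * K * \<delta> z / lam * exp (lam * s)) has_vector_derivative L * K * \<delta> z * exp (lam * s)) (at s within {0..z})" for s
          unfolding has_real_derivative_iff_has_vector_derivative[symmetric]
          using lam(1) by (auto intro!: derivative_eq_intros)
      qed (intro continuous_intros)
      also have "\<dots> \<le> L * K * \<delta> z / lam * exp (lam * z)"
        using L_pos K lam by (simp add: \<delta>_def)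
      also have "\<dots> = \<delta> z * (L * K / lam * exp (lam * z))" by simp
      finally have sq: "(\<delta> z)\<^sup>2 \<le> \<delta> z * (L * K / lam * exp (lam * z))" .
      have "0 \<le> L * K / lam * exp (lam * z)" using L_pos K lam by simp
      moreover have "0 \<le> \<delta> z" by (simp add: \<delta>_def)
      ultimately have "\<delta> z \<le> L * K / lam * exp (lam * z)"
        using sq mult_left_le_imp_le[of "\<delta> z" "\<delta> z" "L * K / lam * exp (lam * z)"]
        unfolding power2_eq_square by (cases "\<delta> z = 0") (simp, linarith)
      also have "\<dots> \<le> K / 2 * exp (lam * z)"
      proof (rule mult_right_mono)
        have "4 * (L * K) \<le> lam * K" using mult_right_mono[OF lam(3), of K] K by simp
        moreover have "0 \<le> L * K" using L_pos K by simp
        ultimately have "L * K \<le> K / 2 * lam" by (simp add: mult.commute)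
        then show "L * K / lam \<le> K / 2" using lam(1) by (simp add: pos_divide_le_eq)
      qed simp
      finally show ?thesis using True z by (simp add: y_def)
    next
      case False
      then show ?thesis using K by (auto simp: y_def)
    qed
  qed auto
  then have "\<delta> T \<le> 0" using T by (simp add: y_def)
  then show ?thesis using l2norm_nonneg[of "\<lambda>x. U T x - V T x"] unfolding \<delta>_def by linarith
qed

section \<open>Passage from H1 data to continuous data and assembly of the result\<close>

lemma l2norm_le_h1norm: "l2norm f \<le> h1norm f"
  unfolding h1norm_def by (rule real_le_rsqrt) simp

text \<open>Provides the finite bound on compact time intervals from which the uniqueness argument
  starts.\<close>

lemma sol_class_L2_bounded:
  assumes "sol_class X"
  shows "\<exists>K. \<forall>t\<in>{0..T}. l2norm (X t) \<le> K"
proof -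
  have X: "X t \<in> L2" if "0 \<le> t" for t using assms that by (auto simp: sol_class_def H1_def)
  have "((\<lambda>s. l2norm (X s)) \<longlongrightarrow> l2norm (X t)) (at t within {0..})" if t: "0 \<le> t" for t
  proof (rule L2_tendsto_norm, rule L2_tendsto_bound)
    show "\<forall>\<^sub>F s in at t within {0..}. X s \<in> L2" using X by (auto simp: eventually_at_filter)
    show "\<forall>\<^sub>F s in at t within {0..}. l2norm (\<lambda>x. X s x - X t x) \<le> h1norm (\<lambda>x. X s x - X t x)"
      by (intro always_eventually allI l2norm_le_h1norm)
    show "((\<lambda>s. h1norm (\<lambda>x. X s x - X t x)) \<longlongrightarrow> 0) (at t within {0..})"
      using assms t by (auto simp: sol_class_def)
  qed (use X t in auto)
  then have "continuous_on {0..} (\<lambda>s. l2norm (X s))" by (auto simp: continuous_on_def)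
  then have "continuous_on {0..T} (\<lambda>s. l2norm (X s))" by (rule continuous_on_subset) auto
  then have "bounded ((\<lambda>s. l2norm (X s)) ` {0..T})"
    by (intro compact_imp_bounded compact_continuous_image) auto
  then show ?thesis unfolding bounded_iff by (metis abs_le_D1 imageI real_norm_def)
qed

lemma H1_continuous_representative:
  assumes f: "f \<in> L2" and g: "g \<in> L2" and w: "weak_deriv f g"
  obtains F m where "F \<in> L2" "AE x in lborel. f x = F x" "continuous_on UNIV F" "\<And>x. norm (F x) \<le> m"
    and "\<And>x r. F (x + r) - F x = (LINT \<theta>:{0..1}|lborel. r *\<^sub>R g (x + r * \<theta>))"
proof -
  obtain F where F: "AE x in lborel. f x = F x"
    and inc: "\<And>x r. F (x + r) - F x = (LINT \<theta>:{0..1}|lborel. r *\<^sub>R g (x + r * \<theta>))"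
    using H1_representative[OF assms] by metis
  have le: "norm (F (x + r) - F x) \<le> sqrt \<bar>r\<bar> * l2norm g" for x r
    unfolding inc shift_average_eq_interval_integral by (rule L2_interval_integral_le[OF g])
  have "isCont F x" for x
  proof -
    have "((\<lambda>r. F (x + r) - F x) \<longlongrightarrow> 0) (at 0)"
    proof (rule tendsto_0_le[where K="l2norm g"])
      have "((\<lambda>r. sqrt \<bar>r\<bar>) \<longlongrightarrow> sqrt \<bar>0\<bar>) (at 0)" by (intro tendsto_intros)
      then show "((\<lambda>r. sqrt \<bar>r\<bar>) \<longlongrightarrow> 0) (at 0)" by simp
    qed (use le in auto)
    then show ?thesis unfolding isCont_iff by (rule LIM_zero_cancel)
  qed
  then have c: "continuous_on UNIV F" by (simp add: continuous_on_eq_continuous_at)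
  have F2: "F \<in> L2" by (rule L2_cong_AE(1)[OF f borel_measurable_continuous_onI[OF c] F])
  \<comment> \<open>If \<open>F\<close> exceeded this at x, the Hoelder bound would keep it above
    \<open>l2norm F + 1\<close> on the unit interval [x, x + 1], contradicting the value of its L2
    norm.\<close>
  have "norm (F x) \<le> l2norm F + 1 + l2norm g" for x
  proof (rule ccontr)
    assume neg: "\<not> norm (F x) \<le> l2norm F + 1 + l2norm g"
    have "l2norm F + 1 \<le> norm (F u)" if "u \<in> {x..x + 1}" for u
    proof -
      have "sqrt \<bar>u - x\<bar> * l2norm g \<le> 1 * l2norm g" using that by (intro mult_right_mono) auto
      then have "norm (F u - F x) \<le> l2norm g" using le[of x "u - x"] by simp
      then show ?thesis using neg norm_triangle_ineq2[of "F x" "F u"] by (simp add: norm_minus_commute)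
    qed
    then have "(l2norm F + 1)\<^sup>2 * indicator {x..x + 1} u \<le> (norm (F u))\<^sup>2" for u
      by (auto simp: indicator_def intro!: power_mono)
    then have "(\<integral>u. (l2norm F + 1)\<^sup>2 * indicator {x..x + 1} u \<partial>lborel) \<le> (\<integral>u. (norm (F u))\<^sup>2 \<partial>lborel)"
      using L2_integrable[OF F2]
      by (intro integral_mono integrable_mult_right integrable_real_indicator) (auto simp: emeasure_lborel_Icc_eq)
    then have "(l2norm F + 1)\<^sup>2 \<le> (l2norm F)\<^sup>2" by (simp add: l2norm_power2[symmetric])
    then show False using l2norm_nonneg[of F] by (simp add: power2_sum)
  qed
  with F2 F c inc show thesis using that by blast
qed

lemma (in semilinear) semilinear_solution_ex:
  assumes "c \<noteq> 1" "c \<noteq> -1" and f: "f \<in> L2" and g: "g \<in> L2" "weak_deriv f g"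
  shows "\<exists>B0 B K. semilinear_solution c L C F A B0 g B K \<and> (AE x in lborel. f x = B0 x)"
proof (rule H1_continuous_representative[OF f g])
  fix B0 m assume B0: "B0 \<in> L2" "AE x in lborel. f x = B0 x" "continuous_on UNIV B0" "\<And>x. norm (B0 x) \<le> m"
    and inc: "\<And>x r. B0 (x + r) - B0 x = (LINT \<theta>:{0..1}|lborel. r *\<^sub>R g (x + r * \<theta>))"
  show ?thesis
  proof (rule picard_solution[OF B0(3,4,1)])
    fix B K assume B: "continuous_on UNIV (case_prod B)"
      "\<And>t x. B t x = Tc c t B0 x + duhamel c (\<lambda>s x. F x (B s x)) t x"
      "\<And>t x. norm (B t x) \<le> K * exp (lam * \<bar>t\<bar>)"
      "\<And>t. B t \<in> L2" "\<And>t. l2norm (B t) \<le> 2 * l2norm B0 * exp (lam * \<bar>t\<bar>)"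
    have "semilinear_solution c L C F A B0 g B K"
      by unfold_locales (fact assms B0 g inc B)+
    with B0(2) show ?thesis by blast
  qed
qed

theorem theorem3p2:
  fixes N :: "real \<Rightarrow> real" and c :: real and u v :: "real \<Rightarrow> real"
  assumes "nonlinearity N" and "saturable N"
    and "c \<noteq> 1" and "c \<noteq> -1"
    and "heteroclinic_profile N c u v"
  shows "\<exists>C. \<forall>B0\<in>H1. \<exists>B.
           sol_class B \<and> mild_solution N c u v B0 B \<and>
           (\<forall>t\<ge>0. h1norm (B t) \<le> C * exp (C * t) * h1norm B0) \<and>
           (\<forall>B'. sol_class B' \<and> mild_solution N c u v B0 B' \<longrightarrow>
                 (\<forall>t\<ge>0. l2norm (\<lambda>x. B' t x - B t x) = 0))"
proof -
  obtain L C A where "semilinear L C (Nstar N u v) A"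
    using Nstar_properties[OF assms(2,5)] unfolding semilinear_def by (metis (no_types, lifting))
  then interpret semilinear c L C "Nstar N u v" A .
  define Q where "Q = 2 + (1 / \<bar>c + 1\<bar> + 1 / \<bar>c - 1\<bar>) * (2 * (\<bar>c + 1\<bar> + \<bar>c - 1\<bar>) + 4 * L)"
  have Q: "0 \<le> Q" unfolding Q_def using L_pos by (intro add_nonneg_nonneg mult_nonneg_nonneg) auto
  show ?thesis
  \<comment> \<open>\<open>Q\<close> is the prefactor in \<open>h1norm_B_le\<close>, and the 2
    compares \<open>l2norm B0 + l2norm g\<close> with \<open>h1norm f\<close>; adding
    \<open>lam\<close> lets one constant serve as prefactor and exponent.\<close>
  proof (intro exI[of _ "2 * Q + lam"] ballI)
    fix f assume "f \<in> H1"
    then obtain g where f: "f \<in> L2" and g: "g \<in> L2" "weak_deriv f g" by (auto simp: H1_def)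
    obtain B0 B K where "semilinear_solution c L C (Nstar N u v) A B0 g B K"
      and B0: "AE x in lborel. f x = B0 x"
      using semilinear_solution_ex[OF assms(3,4) f g] by blast
    then interpret semilinear_solution c L C "Nstar N u v" A B0 g B K by simp
    \<comment> \<open>\<open>B\<close> was built from the continuous representative; the pairing
      does not see the null set on which it differs from \<open>f\<close>.\<close>
    have inner_eq: "l2inner (Tc c t f) \<phi> = l2inner (Tc c t B0) \<phi>" if "\<phi> \<in> L2" for t \<phi>
    proof -
      have "l2norm (\<lambda>x. f x - B0 x) = l2norm (\<lambda>x. 0)"
        by (rule L2_cong_AE(2)) (use B0 B0_L2 f in \<open>auto intro!: L2_measurable L2_diff\<close>)
      then have "\<bar>l2inner (Tc c t (\<lambda>x. f x - B0 x)) \<phi>\<bar> \<le> 0"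
        using l2inner_le[OF Tc_L2(1)[OF L2_diff[OF f B0_L2]] that, of c t]
        by (simp add: Tc_L2(2)[OF L2_diff[OF f B0_L2]])
      moreover have "l2inner (Tc c t (\<lambda>x. f x - B0 x)) \<phi> = l2inner (Tc c t f) \<phi> - l2inner (Tc c t B0) \<phi>"
        using l2inner_diff_left[OF Tc_L2(1)[OF f] Tc_L2(1)[OF B0_L2] that, of c t c t] by (simp only: Tc_diff[symmetric])
      ultimately show ?thesis by simp
    qed
    have mild: "mild_solution N c u v f B"
      unfolding mild_solution_def using B_mild inner_eq by (auto simp: FB_def[abs_def])
    have "l2norm B0 = l2norm f"
      by (rule L2_cong_AE(2)[OF f L2_measurable[OF B0_L2] B0])
    moreover have "h1norm f = sqrt ((l2norm f)\<^sup>2 + (l2norm g)\<^sup>2)" by (rule h1norm_eq[OF g])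
    ultimately have n: "l2norm B0 + l2norm g \<le> 2 * h1norm f"
      using real_sqrt_sum_squares_ge1[of "l2norm f" "l2norm g"] real_sqrt_sum_squares_ge2[of "l2norm g" "l2norm f"] by linarith
    have bound: "h1norm (B t) \<le> (2 * Q + lam) * exp ((2 * Q + lam) * t) * h1norm f" if "0 \<le> t" for t
    proof -
      have h: "0 \<le> h1norm f" using l2norm_nonneg[of f] l2norm_le_h1norm[of f] by linarith
      have "h1norm (B t) \<le> Q * exp (lam * t) * (l2norm B0 + l2norm g)"
        using h1norm_B_le[of t] that by (simp add: Q_def)
      also have "\<dots> \<le> Q * exp (lam * t) * (2 * h1norm f)" using n Q by (intro mult_left_mono) auto
      also have "\<dots> = 2 * Q * exp (lam * t) * h1norm f" by simp
      also have "\<dots> \<le> (2 * Q + lam) * exp ((2 * Q + lam) * t) * h1norm f"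
        using Q lam that h by (intro mult_right_mono mult_mono) (auto intro!: mult_right_mono)
      finally show ?thesis .
    qed
    have unique: "l2norm (\<lambda>x. B' t x - B t x) = 0"
      if B': "sol_class B'" "mild_solution N c u v f B'" and "0 \<le> t" for B' t
    proof (rule mild_unique[where I="\<lambda>t \<phi>. l2inner (Tc c t f) \<phi>"])
      show B'2: "B' t \<in> L2" if "0 \<le> t" for t using B'(1) that by (auto simp: sol_class_def H1_def)
      show "B t \<in> L2" for t by (rule B_L2)
      show "\<exists>K. \<forall>t\<in>{0..T}. l2norm (\<lambda>x. B' t x - B t x) \<le> K" for T
      proof -
        obtain K1 K2 where "\<forall>t\<in>{0..T}. l2norm (B' t) \<le> K1" "\<forall>t\<in>{0..T}. l2norm (B t) \<le> K2"
          using sol_class_L2_bounded[OF B'(1)] sol_class_L2_bounded[OF sol_class_B] by metis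
        then have "\<forall>t\<in>{0..T}. l2norm (\<lambda>x. B' t x - B t x) \<le> K1 + K2"
          using l2norm_triangle_diff[OF B'2 B_L2] by (fastforce intro: order_trans)
        then show ?thesis by blast
      qed
    qed (use B'(2) mild \<open>0 \<le> t\<close> in \<open>auto simp: mild_solution_def\<close>)
    show "\<exists>B. sol_class B \<and> mild_solution N c u v f B \<and>
           (\<forall>t\<ge>0. h1norm (B t) \<le> (2 * Q + lam) * exp ((2 * Q + lam) * t) * h1norm f) \<and>
           (\<forall>B'. sol_class B' \<and> mild_solution N c u v f B' \<longrightarrow>
                 (\<forall>t\<ge>0. l2norm (\<lambda>x. B' t x - B t x) = 0))"
      using sol_class_B mild bound unique by blast
  qed
qed

end
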